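(* Let $(M,g_M)$ and $(N,g_N)$ be compact Riemannian manifolds with $\dim M=m>n=\dim N$ and $N$ oriented. Let $F:[0,\infty)\to[0,\infty)$ be a $C^2$ strictly increasing function with $F(0)=0$. Let $u:(M,g_M)\to(N,g_N)$ be an $F$-harmonic map which is a horizontally conformal submersion with dilation $\lambda$. Assume that the horizontal distribution $\mathcal{H}$ of $u$ has mean curvature vector $\frac{\operatorname{grad}(\lambda^2)}{2\lambda^2}$, and that the zeros of the function $t\mapsto (n-2)F'(t)-2tF''(t)$ are isolated. Then the pullback under $u$ of the volume element of $N$ is a harmonic $n$-form on $M$ if and only if the horizontal distribution $\mathcal{H}$ of $u$ is completely integrable.
   Context: A smooth map $u:(M,g_M)\to(N,g_N)$ between compact Riemannian manifolds is $F$-harmonic if it is a critical point, with respect to smooth variations, of the $F$-energy $E_F(u)=\int_M F\left(\frac{|du|^2}{2}\right)dv_g$, where $|du|$ is the Hilbert-Schmidt norm of $du$ with respect to $g_M$ and $g_N$. For a submersion $u$, the vertical space at $x\in M$ is $\ker du_x$, the horizontal space $\mathcal{H}_x$ is the orthogonal complement of $\ker du_x$ in $T_xM$, and $\mathcal{H}=\{\mathcal{H}_x:x\in M\}$ is the horizontal distribution. A submersion $u$ is horizontally conformal with dilation $\lambda$ if $\lambda$ is a smooth positive function on $M$ with $g_N(du_x(X),du_x(Y))=\lambda^2(x)\,g_M(X,Y)$ for all $x\in M$ and $X,Y\in\mathcal{H}_x$. The mean curvature vector of $\mathcal{H}$ is $\frac1n\sum_{i=1}^n(\nabla_{e_i}e_i)^{\mathcal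 V}$, where $e_1,\dots,e_n$ is a local orthonormal frame of $\mathcal{H}$, $\nabla$ is the Levi-Civita connection of $g_M$ and $(\cdot)^{\mathcal V}$ is the orthogonal projection onto $\ker du$. A differential form is harmonic if it is closed and co-closed. Compact manifolds are without boundary.
   Formalization: Here "strictly increasing" also includes F'(t) > 0 for all t > 0; without it the claim fails, e.g. for u(x,y) = x from T² with metric dx² + f(x)²dy² (f non-constant) to S¹ with F(t) = (t − 1/2)³ + 1/8. *)

theory Defs
  imports "HOL-Analysis.Analysis"
begin

section \<open>Smooth maps between normed spaces\<close>

text \<open>Only used on open sets, where these are the usual notions of \<open>C\<^sup>k\<close> and \<open>C\<^sup>\<infinity>\<close>.\<close>

primrec Ck_on :: "nat \<Rightarrow> 'v::real_normed_vector set \<Rightarrow> ('v \<Rightarrow> 'w::real_normed_vector) \<Rightarrow> bool" where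
  "Ck_on 0 S f \<longleftrightarrow> continuous_on S f"
| "Ck_on (Suc k) S f \<longleftrightarrow> (\<forall>x\<in>S. f differentiable (at x)) \<and>
     (\<forall>v. Ck_on k S (\<lambda>x. frechet_derivative f (at x) v))"

definition smooth_on :: "'v::real_normed_vector set \<Rightarrow> ('v \<Rightarrow> 'w::real_normed_vector) \<Rightarrow> bool" where
  "smooth_on S f \<longleftrightarrow> (\<forall>k. Ck_on k S f)"

section \<open>Riemannian manifolds\<close>

text \<open>
  A chart is a pair of a domain and a coordinate map. Local objects are functions of a chart
  \<open>c\<close> and of the coordinates \<open>y\<close> of a point in \<open>c\<close>; a tangent vector at the point is represented
  by its components with respect to the coordinate frame of \<open>c\<close>. In particular the metric
  is given by its Gram matrices. Manifolds need not be connected.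
\<close>

type_synonym ('a, 'm) chart = "'a set \<times> ('a \<Rightarrow> real^'m)"

record ('a, 'm) riemannian =
  mtop :: "'a topology"
  atlas :: "('a, 'm) chart set"
  gram :: "('a, 'm) chart \<Rightarrow> real^'m \<Rightarrow> real^'m^'m"

definition cdom :: "('a, 'm::finite) chart \<Rightarrow> 'a set" where
  "cdom c = fst c"

definition cmap :: "('a, 'm::finite) chart \<Rightarrow> 'a \<Rightarrow> real^'m" where
  "cmap c = snd c"

definition cimg :: "('a, 'm::finite) chart \<Rightarrow> (real^'m) set" where
  "cimg c = cmap c ` cdom c"

definition cinv :: "('a, 'm::finite) chart \<Rightarrow> real^'m \<Rightarrow> 'a" where
  "cinv c = inv_into (cdom c) (cmap c)"

definition transition :: "('a, 'm::finite) chart \<Rightarrow> ('a, 'm) chart \<Rightarrow> real^'m \<Rightarrow> real^'m" where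
  "transition c d = cmap d \<circ> cinv c"

definition chart_at :: "('a, 'm::finite) riemannian \<Rightarrow> 'a \<Rightarrow> ('a, 'm) chart" where
  "chart_at M x = (SOME c. c \<in> atlas M \<and> x \<in> cdom c)"

definition smooth_atlas :: "('a, 'm::finite) riemannian \<Rightarrow> bool" where
  "smooth_atlas M \<longleftrightarrow>
     (\<Union>c\<in>atlas M. cdom c) = topspace (mtop M) \<and>
     (\<forall>c\<in>atlas M. openin (mtop M) (cdom c) \<and> open (cimg c) \<and>
        homeomorphic_map (subtopology (mtop M) (cdom c)) (top_of_set (cimg c)) (cmap c)) \<and>
     (\<forall>c\<in>atlas M. \<forall>d\<in>atlas M. smooth_on (cmap c ` (cdom c \<inter> cdom d)) (transition c d))"

definition ginner :: "('a, 'm::finite) riemannian \<Rightarrow> ('a, 'm) chart \<Rightarrow> real^'m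
    \<Rightarrow> real^'m \<Rightarrow> real^'m \<Rightarrow> real" where
  "ginner M c y v w = v \<bullet> (gram M c y *v w)"

definition riemannian_metric :: "('a, 'm::finite) riemannian \<Rightarrow> bool" where
  "riemannian_metric M \<longleftrightarrow>
     (\<forall>c\<in>atlas M. smooth_on (cimg c) (gram M c) \<and>
        (\<forall>y\<in>cimg c. transpose (gram M c y) = gram M c y \<and>
           (\<forall>v. v \<noteq> 0 \<longrightarrow> ginner M c y v v > 0) \<and>
           (\<forall>d\<in>atlas M. cinv c y \<in> cdom d \<longrightarrow>
              (\<forall>v w. ginner M c y v w =
                 ginner M d (transition c d y)
                   (frechet_derivative (transition c d) (at y) v)
                   (frechet_derivative (transition c d) (at y) w)))))"

definition compact_riemannian_manifold :: "('a, 'm::finite) riemannian \<Rightarrow> bool" where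
  "compact_riemannian_manifold M \<longleftrightarrow>
     compact_space (mtop M) \<and> Hausdorff_space (mtop M) \<and> smooth_atlas M \<and> riemannian_metric M"

text \<open>
  The Riemannian volume measure: the Borel measure with density \<open>\<surd>(det g)\<close> in every chart, which
  exists and is unique on a compact manifold.
\<close>

definition vol_measure :: "('a, 'm::finite) riemannian \<Rightarrow> 'a measure" where
  "vol_measure M = (SOME \<mu>. space \<mu> = topspace (mtop M) \<and>
     sets \<mu> = sigma_sets (topspace (mtop M)) {U. openin (mtop M) U} \<and>
     (\<forall>c\<in>atlas M. \<forall>A\<in>sets \<mu>. A \<subseteq> cdom c \<longrightarrow>
        emeasure \<mu> A = (\<integral>\<^sup>+y\<in>cmap c ` A. ennreal (sqrt (det (gram M c y))) \<partial>lborel)))"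

definition smooth_fun :: "('a, 'm::finite) riemannian \<Rightarrow> ('a \<Rightarrow> real) \<Rightarrow> bool" where
  "smooth_fun M f \<longleftrightarrow> (\<forall>c\<in>atlas M. smooth_on (cimg c) (f \<circ> cinv c))"

definition grad :: "('a, 'm::finite) riemannian \<Rightarrow> ('a \<Rightarrow> real) \<Rightarrow> ('a, 'm) chart
    \<Rightarrow> real^'m \<Rightarrow> real^'m" where
  "grad M f c y = matrix_inv (gram M c y) *v
     (\<chi> i. frechet_derivative (f \<circ> cinv c) (at y) (axis i 1))"

text \<open>
  The Levi-Civita connection of a chart: \<open>christoffel M c y v w\<close> is the vector with components
  \<open>\<Gamma>\<^sup>k\<^sub>i\<^sub>j v\<^sup>i w\<^sup>j\<close>, where
  \<open>\<Gamma>\<^sup>k\<^sub>i\<^sub>j = g\<^sup>k\<^sup>l (\<partial>\<^sub>i g\<^sub>j\<^sub>l + \<partial>\<^sub>j g\<^sub>i\<^sub>l - \<partial>\<^sub>l g\<^sub>i\<^sub>j) / 2\<close>, and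
  \<open>levi_civita M c X Y y\<close> is \<open>\<nabla>\<^sub>X Y\<close> at \<open>y\<close>.
\<close>

definition christoffel :: "('a, 'm::finite) riemannian \<Rightarrow> ('a, 'm) chart \<Rightarrow> real^'m
    \<Rightarrow> real^'m \<Rightarrow> real^'m \<Rightarrow> real^'m" where
  "christoffel M c y v w = (1/2) *\<^sub>R (matrix_inv (gram M c y) *v
     (\<chi> l. frechet_derivative (\<lambda>z. ginner M c z w (axis l 1)) (at y) v
         + frechet_derivative (\<lambda>z. ginner M c z v (axis l 1)) (at y) w
         - frechet_derivative (\<lambda>z. ginner M c z v w) (at y) (axis l 1)))"

definition levi_civita :: "('a, 'm::finite) riemannian \<Rightarrow> ('a, 'm) chart
    \<Rightarrow> (real^'m \<Rightarrow> real^'m) \<Rightarrow> (real^'m \<Rightarrow> real^'m) \<Rightarrow> real^'m \<Rightarrow> real^'m" where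
  "levi_civita M c X Y y =
     frechet_derivative Y (at y) (X y) + christoffel M c y (X y) (Y y)"

definition lie_bracket :: "(real^'m \<Rightarrow> real^'m) \<Rightarrow> (real^'m \<Rightarrow> real^'m) \<Rightarrow> real^'m
    \<Rightarrow> real^'m::finite" where
  "lie_bracket X Y y = frechet_derivative Y (at y) (X y) - frechet_derivative X (at y) (Y y)"

section \<open>Smooth maps and \<open>F\<close>-harmonic maps\<close>

definition local_rep :: "('a, 'm::finite) chart \<Rightarrow> ('b, 'n::finite) chart \<Rightarrow> ('a \<Rightarrow> 'b)
    \<Rightarrow> real^'m \<Rightarrow> real^'n" where
  "local_rep c d u = cmap d \<circ> u \<circ> cinv c"

definition smooth_map :: "('a, 'm::finite) riemannian \<Rightarrow> ('b, 'n::finite) riemannian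
    \<Rightarrow> ('a \<Rightarrow> 'b) \<Rightarrow> bool" where
  "smooth_map M N u \<longleftrightarrow> continuous_map (mtop M) (mtop N) u \<and>
     (\<forall>c\<in>atlas M. \<forall>d\<in>atlas N.
        smooth_on {y \<in> cimg c. u (cinv c y) \<in> cdom d} (local_rep c d u))"

text \<open>
  The differential of \<open>u\<close> in the chart \<open>c\<close> of the source and the chosen chart of the target at the
  image point. Every notion below that uses \<^const>\<open>chart_at\<close> is independent of this choice.
\<close>

definition differential :: "('a, 'm::finite) riemannian \<Rightarrow> ('b, 'n::finite) riemannian
    \<Rightarrow> ('a \<Rightarrow> 'b) \<Rightarrow> ('a, 'm) chart \<Rightarrow> real^'m \<Rightarrow> real^'m \<Rightarrow> real^'n" where
  "differential M N u c y =
     frechet_derivative (local_rep c (chart_at N (u (cinv c y))) u) (at y)"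

definition target_inner :: "('a, 'm::finite) riemannian \<Rightarrow> ('b, 'n::finite) riemannian
    \<Rightarrow> ('a \<Rightarrow> 'b) \<Rightarrow> ('a, 'm) chart \<Rightarrow> real^'m \<Rightarrow> real^'n \<Rightarrow> real^'n \<Rightarrow> real" where
  "target_inner M N u c y a b =
     (let x = cinv c y; d = chart_at N (u x) in ginner N d (cmap d (u x)) a b)"

text \<open>The squared Hilbert-Schmidt norm \<open>g\<^sup>i\<^sup>j h(du \<partial>\<^sub>i, du \<partial>\<^sub>j)\<close> of \<open>du\<close>.\<close>

definition hs_norm_sq :: "('a, 'm::finite) riemannian \<Rightarrow> ('b, 'n::finite) riemannian
    \<Rightarrow> ('a \<Rightarrow> 'b) \<Rightarrow> 'a \<Rightarrow> real" where
  "hs_norm_sq M N u x =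
     (let c = chart_at M x; y = cmap c x in
        \<Sum>i\<in>UNIV. \<Sum>j\<in>UNIV. matrix_inv (gram M c y) $ i $ j *
          target_inner M N u c y (differential M N u c y (axis i 1))
                                 (differential M N u c y (axis j 1)))"

definition F_energy :: "(real \<Rightarrow> real) \<Rightarrow> ('a, 'm::finite) riemannian
    \<Rightarrow> ('b, 'n::finite) riemannian \<Rightarrow> ('a \<Rightarrow> 'b) \<Rightarrow> real" where
  "F_energy F M N u = (LINT x|vol_measure M. F (hs_norm_sq M N u x / 2))"

definition smooth_variation :: "('a, 'm::finite) riemannian \<Rightarrow> ('b, 'n::finite) riemannian
    \<Rightarrow> ('a \<Rightarrow> 'b) \<Rightarrow> real \<Rightarrow> (real \<Rightarrow> 'a \<Rightarrow> 'b) \<Rightarrow> bool" where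
  "smooth_variation M N u \<epsilon> U \<longleftrightarrow> \<epsilon> > 0 \<and> (\<forall>x\<in>topspace (mtop M). U 0 x = u x) \<and>
     continuous_map (prod_topology (top_of_set {-\<epsilon><..<\<epsilon>}) (mtop M)) (mtop N) (\<lambda>(t, x). U t x) \<and>
     (\<forall>c\<in>atlas M. \<forall>d\<in>atlas N.
        smooth_on {(t, y). t \<in> {-\<epsilon><..<\<epsilon>} \<and> y \<in> cimg c \<and> U t (cinv c y) \<in> cdom d}
          (\<lambda>(t, y). local_rep c d (U t) y))"

definition F_harmonic :: "(real \<Rightarrow> real) \<Rightarrow> ('a, 'm::finite) riemannian
    \<Rightarrow> ('b, 'n::finite) riemannian \<Rightarrow> ('a \<Rightarrow> 'b) \<Rightarrow> bool" where
  "F_harmonic F M N u \<longleftrightarrow> smooth_map M N u \<and>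
     (\<forall>\<epsilon> U. smooth_variation M N u \<epsilon> U \<longrightarrow>
        ((\<lambda>t. F_energy F M N (U t)) has_real_derivative 0) (at 0))"

section \<open>Horizontally conformal submersions\<close>

definition vertical :: "('a, 'm::finite) riemannian \<Rightarrow> ('b, 'n::finite) riemannian
    \<Rightarrow> ('a \<Rightarrow> 'b) \<Rightarrow> ('a, 'm) chart \<Rightarrow> real^'m \<Rightarrow> (real^'m) set" where
  "vertical M N u c y = {v. differential M N u c y v = 0}"

definition horizontal :: "('a, 'm::finite) riemannian \<Rightarrow> ('b, 'n::finite) riemannian
    \<Rightarrow> ('a \<Rightarrow> 'b) \<Rightarrow> ('a, 'm) chart \<Rightarrow> real^'m \<Rightarrow> (real^'m) set" where
  "horizontal M N u c y = {X. \<forall>v\<in>vertical M N u c y. ginner M c y X v = 0}"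

definition vertical_part :: "('a, 'm::finite) riemannian \<Rightarrow> ('b, 'n::finite) riemannian
    \<Rightarrow> ('a \<Rightarrow> 'b) \<Rightarrow> ('a, 'm) chart \<Rightarrow> real^'m \<Rightarrow> real^'m \<Rightarrow> real^'m" where
  "vertical_part M N u c y X =
     (THE v. v \<in> vertical M N u c y \<and> X - v \<in> horizontal M N u c y)"

definition submersion :: "('a, 'm::finite) riemannian \<Rightarrow> ('b, 'n::finite) riemannian
    \<Rightarrow> ('a \<Rightarrow> 'b) \<Rightarrow> bool" where
  "submersion M N u \<longleftrightarrow> smooth_map M N u \<and>
     (\<forall>c\<in>atlas M. \<forall>y\<in>cimg c. surj (differential M N u c y))"

definition horizontally_conformal :: "('a, 'm::finite) riemannian
    \<Rightarrow> ('b, 'n::finite) riemannian \<Rightarrow> ('a \<Rightarrow> 'b) \<Rightarrow> ('a \<Rightarrow> real) \<Rightarrow> bool" where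
  "horizontally_conformal M N u lam \<longleftrightarrow>
     smooth_fun M lam \<and> (\<forall>x\<in>topspace (mtop M). lam x > 0) \<and>
     (\<forall>c\<in>atlas M. \<forall>y\<in>cimg c. \<forall>X\<in>horizontal M N u c y. \<forall>Y\<in>horizontal M N u c y.
        target_inner M N u c y (differential M N u c y X) (differential M N u c y Y)
          = (lam (cinv c y))\<^sup>2 * ginner M c y X Y)"

text \<open>For a submersion the horizontal spaces have dimension \<open>CARD('n)\<close>.\<close>

definition horizontal_frame :: "('a, 'm::finite) riemannian \<Rightarrow> ('b, 'n::finite) riemannian
    \<Rightarrow> ('a \<Rightarrow> 'b) \<Rightarrow> ('a, 'm) chart \<Rightarrow> (real^'m) set \<Rightarrow> ('n \<Rightarrow> real^'m \<Rightarrow> real^'m) \<Rightarrow> bool" where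
  "horizontal_frame M N u c W e \<longleftrightarrow> (\<forall>i. smooth_on W (e i)) \<and>
     (\<forall>y\<in>W. \<forall>i. e i y \<in> horizontal M N u c y \<and>
        (\<forall>j. ginner M c y (e i y) (e j y) = (if i = j then 1 else 0)))"

text \<open>
  \<open>Z\<close> is the mean curvature vector of the horizontal distribution. Local orthonormal frames exist
  and the vector computed from a frame does not depend on it.
\<close>

definition horizontal_mean_curvature :: "('a, 'm::finite) riemannian
    \<Rightarrow> ('b, 'n::finite) riemannian \<Rightarrow> ('a \<Rightarrow> 'b)
    \<Rightarrow> (('a, 'm) chart \<Rightarrow> real^'m \<Rightarrow> real^'m) \<Rightarrow> bool" where
  "horizontal_mean_curvature M N u Z \<longleftrightarrow>
     (\<forall>c\<in>atlas M. \<forall>y\<in>cimg c. \<exists>W e. open W \<and> y \<in> W \<and> W \<subseteq> cimg c \<and>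
        horizontal_frame M N u c W e \<and>
        Z c y = (1 / real CARD('n)) *\<^sub>R
          (\<Sum>i\<in>UNIV. vertical_part M N u c y (levi_civita M c (e i) (e i) y)))"

text \<open>
  Complete integrability in the sense of Warner, Foundations of Differentiable Manifolds and Lie
  Groups, Definition 1.56: brackets of (local) horizontal vector fields are horizontal.
\<close>

definition horizontal_completely_integrable :: "('a, 'm::finite) riemannian
    \<Rightarrow> ('b, 'n::finite) riemannian \<Rightarrow> ('a \<Rightarrow> 'b) \<Rightarrow> bool" where
  "horizontal_completely_integrable M N u \<longleftrightarrow>
     (\<forall>c\<in>atlas M. \<forall>W X Y. open W \<and> W \<subseteq> cimg c \<and> smooth_on W X \<and> smooth_on W Y \<and>
        (\<forall>y\<in>W. X y \<in> horizontal M N u c y \<and> Y y \<in> horizontal M N u c y) \<longrightarrow>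
        (\<forall>y\<in>W. lie_bracket X Y y \<in> horizontal M N u c y))"

section \<open>Differential forms\<close>

text \<open>
  A \<open>k\<close>-form is evaluated on lists of \<open>k\<close> tangent vectors; its values on lists of other lengths are
  irrelevant.
\<close>

type_synonym ('a, 'm) form = "('a, 'm) chart \<Rightarrow> real^'m \<Rightarrow> (real^'m) list \<Rightarrow> real"

definition differential_form :: "('a, 'm::finite) riemannian \<Rightarrow> nat \<Rightarrow> ('a, 'm) form \<Rightarrow> bool" where
  "differential_form M k \<omega> \<longleftrightarrow>
     (\<forall>c\<in>atlas M. \<forall>vs. length vs = k \<longrightarrow>
        smooth_on (cimg c) (\<lambda>y. \<omega> c y vs) \<and>
        (\<forall>y\<in>cimg c.
          (\<forall>i<k. linear (\<lambda>v. \<omega> c y (vs[i := v]))) \<and>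
          (\<forall>i j. i < j \<and> j < k \<and> vs ! i = vs ! j \<longrightarrow> \<omega> c y vs = 0) \<and>
          (\<forall>d\<in>atlas M. cinv c y \<in> cdom d \<longrightarrow>
             \<omega> c y vs = \<omega> d (transition c d y)
               (map (frechet_derivative (transition c d) (at y)) vs))))"

text \<open>The usual formula for \<open>d\<omega>\<close> on vector fields with constant coefficients in the chart.\<close>

definition ext_deriv :: "('a, 'm::finite) form \<Rightarrow> ('a, 'm) form" where
  "ext_deriv \<omega> c y vs = (\<Sum>i<length vs.
     (-1) ^ i * frechet_derivative (\<lambda>z. \<omega> c z (take i vs @ drop (Suc i) vs)) (at y) (vs ! i))"

definition cov_deriv :: "('a, 'm::finite) riemannian \<Rightarrow> ('a, 'm) form \<Rightarrow> ('a, 'm) chart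
    \<Rightarrow> real^'m \<Rightarrow> real^'m \<Rightarrow> (real^'m) list \<Rightarrow> real" where
  "cov_deriv M \<omega> c y w vs = frechet_derivative (\<lambda>z. \<omega> c z vs) (at y) w
     - (\<Sum>j<length vs. \<omega> c y (vs[j := christoffel M c y w (vs ! j)]))"

text \<open>
  The codifferential as minus the divergence, \<open>- g\<^sup>i\<^sup>j (\<nabla>\<^sub>i \<omega>)(\<partial>\<^sub>j, \<dots>)\<close>; this does not need an
  orientation.
\<close>

definition codiff :: "('a, 'm::finite) riemannian \<Rightarrow> ('a, 'm) form \<Rightarrow> ('a, 'm) form" where
  "codiff M \<omega> c y vs = - (\<Sum>i\<in>UNIV. \<Sum>j\<in>UNIV.
     matrix_inv (gram M c y) $ i $ j * cov_deriv M \<omega> c y (axis i 1) (axis j 1 # vs))"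

definition harmonic_form :: "('a, 'm::finite) riemannian \<Rightarrow> nat \<Rightarrow> ('a, 'm) form \<Rightarrow> bool" where
  "harmonic_form M k \<omega> \<longleftrightarrow> differential_form M k \<omega> \<and>
     (\<forall>c\<in>atlas M. \<forall>y\<in>cimg c.
        (\<forall>vs. length vs = k + 1 \<longrightarrow> ext_deriv \<omega> c y vs = 0) \<and>
        (\<forall>vs. length vs + 1 = k \<longrightarrow> codiff M \<omega> c y vs = 0))"

definition pullback :: "('a, 'm::finite) riemannian \<Rightarrow> ('b, 'n::finite) riemannian
    \<Rightarrow> ('a \<Rightarrow> 'b) \<Rightarrow> ('b, 'n) form \<Rightarrow> ('a, 'm) form" where
  "pullback M N u \<omega> c y vs =
     (let x = cinv c y; d = chart_at N (u x) in
        \<omega> d (cmap d (u x)) (map (differential M N u c y) vs))"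

text \<open>
  An orientation gives, in each chart and at each point, the sign of the coordinate frame. To
  speak of the sign of a frame the coordinates have to be numbered; we fix a numbering once and
  for all. The atlas itself need not be oriented.
\<close>

definition coord_index :: "'n::finite \<Rightarrow> nat" where
  "coord_index = (SOME b. bij_betw b UNIV {..<CARD('n)})"

definition orientation :: "('b, 'n::finite) riemannian
    \<Rightarrow> (('b, 'n) chart \<Rightarrow> real^'n \<Rightarrow> real) \<Rightarrow> bool" where
  "orientation N sg \<longleftrightarrow>
     (\<forall>c\<in>atlas N. continuous_on (cimg c) (sg c) \<and>
        (\<forall>y\<in>cimg c. sg c y \<in> {1, -1} \<and>
           (\<forall>d\<in>atlas N. cinv c y \<in> cdom d \<longrightarrow>
              sg c y = sgn (det (matrix (frechet_derivative (transition c d) (at y))))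
                         * sg d (transition c d y))))"

definition volume_form :: "('b, 'n::finite) riemannian
    \<Rightarrow> (('b, 'n) chart \<Rightarrow> real^'n \<Rightarrow> real) \<Rightarrow> ('b, 'n) form" where
  "volume_form N sg c y vs =
     sg c y * sqrt (det (gram N c y)) * det (\<chi> i. vs ! coord_index i)"

end

(*
Let A = df be the differential of u in charts and beta its second fundamental form. The mean
curvature vector of the horizontal distribution is vertical, so the hypothesis says that the
dilation lambda is constant along horizontal directions. Differentiating
<df X, df Y> = lambda^2 <X, Y> then shows that beta vanishes on pairs of horizontal vectors.
Moreover |du|^2 = n lambda^2 is constant along horizontal directions, so the Euler-Lagrange
equation of the F-energy reduces to F'(|du|^2 / 2) tau = 0, that is, the tension field
tau = tr beta vanishes; the Euler-Lagrange equation is obtained from variations supported in a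
single chart. The pullback of the volume form is always closed, and its covariant derivative is

  (nabla_w omega)(v_1, ..., v_n) = vol(df v_1, ..., beta(w, v_j), ..., df v_n)   summed over j.

Hence its codifferential only involves the bilinear forms <beta(X, v), df Y> with X, Y horizontal
and v vertical, and vanishes iff these are symmetric in X and Y. Since their antisymmetric part is
<[X, Y], v>, this is integrability.
*)
theory Submission
  imports Defs
begin

section \<open>Calculus of smooth maps\<close>

text \<open>Two choice operators shape the work. \<open>chart_at\<close> selects the target chart
  point by point and may jump, so the pulled back form cannot be differentiated as it is defined.
  Everything is first rewritten for a fixed pair of charts on the open set \<open>reg c d\<close>;
  the Jacobian of the change of target chart cancels. \<open>vol_measure\<close> is a choice as
  well, so before any energy can be evaluated a measure with the prescribed chart densities has to
  be constructed and shown to be finite; the densities fit together by the change of variables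
  formula. \<open>F\<close> has two-sided derivatives only at positive arguments. This is enough
  because the dilation is positive: |du|^2 is bounded below on the compact support of a test
  variation and stays positive for small parameters. Positivity of \<open>F'\<close> there is what
  allows it to be cancelled from the Euler-Lagrange equation. The last equivalence is linear
  algebra: a symmetric array contracted with a determinant that alternates in the same two indices
  vanishes, and conversely a suitable choice of arguments leaves a single antisymmetric
  coefficient.\<close>

abbreviation fder :: "('v::real_normed_vector \<Rightarrow> 'w::real_normed_vector) \<Rightarrow> 'v \<Rightarrow> 'v \<Rightarrow> 'w" where
  "fder f y \<equiv> frechet_derivative f (at y)"

lemma fder_eqI: "(f has_derivative f') (at y) \<Longrightarrow> fder f y = f'"
  using frechet_derivative_at by metis

lemma fder_works: "f differentiable (at y) \<Longrightarrow> (f has_derivative fder f y) (at y)"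
  using frechet_derivative_works by blast

section \<open>Locality of derivatives and of smoothness\<close>

lemma fder_cong_open:
  assumes "open T" "y \<in> T" "\<And>z. z \<in> T \<Longrightarrow> f z = g z"
  shows "fder f y = fder g y"
proof -
  have "(f has_derivative f') (at y) \<longleftrightarrow> (g has_derivative f') (at y)" for f'
    using has_derivative_transform_within_open[OF _ assms(1,2), of f f' UNIV g]
      has_derivative_transform_within_open[OF _ assms(1,2), of g f' UNIV f] assms(3) by auto
  then show ?thesis unfolding frechet_derivative_def by simp
qed

lemma differentiable_cong_open:
  assumes "open T" "y \<in> T" "\<And>z. z \<in> T \<Longrightarrow> f z = g z" "g differentiable (at y)"
  shows "f differentiable (at y)"
  using has_derivative_transform_within_open[OF _ assms(1,2), of g _ UNIV f] assms(3,4)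
  unfolding differentiable_def by metis

text \<open>\<open>Ck_on\<close> uses unrestricted derivatives at the points of \<open>S\<close>, so
  a witness on a neighbourhood of each point suffices even if \<open>S\<close> is not open. In the
  induction the derivative of a local witness is a local witness for the derivative.\<close>

lemma Ck_on_local:
  assumes "\<And>x. x \<in> S \<Longrightarrow> \<exists>T g. open T \<and> x \<in> T \<and> Ck_on k T g \<and> (\<forall>z\<in>T. f z = g z)"
  shows "Ck_on k S f"
  using assms
proof (induction k arbitrary: f)
  case 0
  show ?case unfolding Ck_on.simps
  proof (rule continuous_at_imp_continuous_on, rule ballI)
    fix x assume "x \<in> S"
    then obtain T g where T: "open T" "x \<in> T" "continuous_on T g" "\<And>z. z \<in> T \<Longrightarrow> f z = g z"
      using 0 by (metis Ck_on.simps(1))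
    then have "continuous_on T f" using continuous_on_cong by metis
    then show "isCont f x" using T continuous_on_eq_continuous_at by blast
  qed
next
  case (Suc k)
  show ?case unfolding Ck_on.simps
  proof (intro conjI ballI allI)
    fix x assume "x \<in> S"
    then obtain T g where T: "open T" "x \<in> T" "Ck_on (Suc k) T g" "\<And>z. z \<in> T \<Longrightarrow> f z = g z"
      using Suc.prems by metis
    then show "f differentiable (at x)" using differentiable_cong_open[OF T(1,2,4)] by auto
  next
    fix v show "Ck_on k S (\<lambda>x. fder f x v)"
    proof (rule Suc.IH)
      fix x assume "x \<in> S"
      then obtain T g where T: "open T" "x \<in> T" "Ck_on (Suc k) T g" "\<And>z. z \<in> T \<Longrightarrow> f z = g z"
        using Suc.prems by metis
      have "\<forall>z\<in>T. fder f z v = fder g z v"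
      proof
        fix z assume "z \<in> T"
        then show "fder f z v = fder g z v" using fder_cong_open[OF T(1), of z f g] T(4) by simp
      qed
      moreover have "Ck_on k T (\<lambda>x. fder g x v)" using T by simp
      ultimately show "\<exists>T g. open T \<and> x \<in> T \<and> Ck_on k T g \<and> (\<forall>z\<in>T. fder f z v = g z)"
        using T by blast
    qed
  qed
qed

lemma smooth_on_local:
  assumes "\<And>x. x \<in> S \<Longrightarrow> \<exists>T g. open T \<and> x \<in> T \<and> smooth_on T g \<and> (\<forall>z\<in>T. f z = g z)"
  shows "smooth_on S f"
  unfolding smooth_on_def using assms Ck_on_local[of S _ f] unfolding smooth_on_def by meson

lemma Ck_on_subset: "Ck_on k S f \<Longrightarrow> T \<subseteq> S \<Longrightarrow> Ck_on k T f"
  by (induction k arbitrary: f) (auto intro: continuous_on_subset)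

lemma smooth_on_subset: "smooth_on S f \<Longrightarrow> T \<subseteq> S \<Longrightarrow> smooth_on T f"
  unfolding smooth_on_def using Ck_on_subset by blast

lemma Ck_on_cong:
  assumes "open S" "\<And>z. z \<in> S \<Longrightarrow> f z = g z" "Ck_on k S g"
  shows "Ck_on k S f"
  using assms by (intro Ck_on_local) blast

lemma smooth_on_cong:
  assumes "open S" "\<And>z. z \<in> S \<Longrightarrow> f z = g z" "smooth_on S g"
  shows "smooth_on S f"
  using assms Ck_on_cong[OF assms(1,2)] unfolding smooth_on_def by simp

lemma Ck_on_SucD: "Ck_on (Suc k) S f \<Longrightarrow> Ck_on k S f"
proof (induction k arbitrary: f)
  case 0
  then show ?case
    by (auto intro!: continuous_at_imp_continuous_on differentiable_imp_continuous_within)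
next
  case (Suc k)
  then show ?case by (metis Ck_on.simps(2))
qed

lemma smooth_on_imp_differentiable: "smooth_on S f \<Longrightarrow> x \<in> S \<Longrightarrow> f differentiable (at x)"
  unfolding smooth_on_def by (metis Ck_on.simps(2))

lemma smooth_on_has_derivative: "smooth_on S f \<Longrightarrow> x \<in> S \<Longrightarrow> (f has_derivative fder f x) (at x)"
  using smooth_on_imp_differentiable fder_works by blast

lemma smooth_on_fder: "smooth_on S f \<Longrightarrow> smooth_on S (\<lambda>x. fder f x v)"
  unfolding smooth_on_def by (metis Ck_on.simps(2))

lemma smooth_on_continuous: "smooth_on S f \<Longrightarrow> continuous_on S f"
  unfolding smooth_on_def by (metis Ck_on.simps(1))

section \<open>Closure properties of C^k and smooth maps\<close>

lemma Ck_on_const: "Ck_on k S (\<lambda>x. c)"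
  by (induction k arbitrary: c) auto

lemma Ck_on_bounded_linear:
  assumes "open S" "bounded_linear B" "Ck_on k S f"
  shows "Ck_on k S (\<lambda>x. B (f x))"
  using assms(3)
proof (induction k arbitrary: f)
  case 0
  then show ?case using assms by (auto intro: bounded_linear.continuous_on)
next
  case (Suc k)
  have der: "((\<lambda>x. B (f x)) has_derivative (\<lambda>v. B (fder f x v))) (at x)" if "x \<in> S" for x
    using bounded_linear.has_derivative[OF assms(2) fder_works[of f x]] Suc.prems that by simp
  have "Ck_on k S (\<lambda>x. B (fder f x v))" for v
    using Suc.IH[of "\<lambda>x. fder f x v"] Suc.prems by simp
  then have "Ck_on k S (\<lambda>x. fder (\<lambda>x. B (f x)) x v)" for v
    by (rule Ck_on_cong[OF assms(1), rotated]) (simp add: fder_eqI[OF der])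
  then show ?case using der by (auto simp: differentiable_def)
qed

lemma Ck_on_add:
  assumes "open S" "Ck_on k S f" "Ck_on k S g" shows "Ck_on k S (\<lambda>x. f x + g x)"
  using assms(2,3)
proof (induction k arbitrary: f g)
  case 0 then show ?case by (auto intro: continuous_on_add)
next
  case (Suc k)
  have der: "((\<lambda>x. f x + g x) has_derivative (\<lambda>v. fder f x v + fder g x v)) (at x)" if "x \<in> S" for x
    using Suc.prems that by (auto intro!: has_derivative_add fder_works)
  have "Ck_on k S (\<lambda>x. fder f x v + fder g x v)" for v
    using Suc.IH[of "\<lambda>x. fder f x v" "\<lambda>x. fder g x v"] Suc.prems by simp
  then have "Ck_on k S (\<lambda>x. fder (\<lambda>x. f x + g x) x v)" for v
    by (rule Ck_on_cong[OF assms(1), rotated]) (simp add: fder_eqI[OF der])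
  then show ?case using der by (auto simp: differentiable_def)
qed

lemma Ck_on_bounded_bilinear:
  assumes "open S" "bounded_bilinear B" "Ck_on k S f" "Ck_on k S g"
  shows "Ck_on k S (\<lambda>x. B (f x) (g x))"
proof -
  interpret bounded_bilinear B by fact
  show ?thesis using assms(3,4)
  proof (induction k arbitrary: f g)
    case 0 then show ?case by (auto intro: continuous_on)
  next
    case (Suc k)
    have der: "((\<lambda>x. B (f x) (g x)) has_derivative (\<lambda>v. B (f x) (fder g x v) + B (fder f x v) (g x))) (at x)" if "x \<in> S" for x
      using Suc.prems that by (auto intro!: FDERIV fder_works)
    have "Ck_on k S (\<lambda>x. B (f x) (fder g x v) + B (fder f x v) (g x))" for v
      using Suc.prems Suc.prems[THEN Ck_on_SucD] by (intro Ck_on_add assms(1) Suc.IH) (auto simp del: Ck_on.simps simp: Ck_on.simps(2)[of k])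
    then have "Ck_on k S (\<lambda>x. fder (\<lambda>x. B (f x) (g x)) x v)" for v
      by (rule Ck_on_cong[OF assms(1), rotated]) (simp add: fder_eqI[OF der])
    then show ?case using der by (auto simp: differentiable_def)
  qed
qed

lemma Ck_on_sum:
  assumes "open S" "\<And>i. i \<in> I \<Longrightarrow> Ck_on k S (f i)" shows "Ck_on k S (\<lambda>x. \<Sum>i\<in>I. f i x)"
proof (cases "finite I")
  case True
  then show ?thesis using assms(2)
    by (induction I rule: finite_induct) (auto intro: Ck_on_const Ck_on_add[OF assms(1)])
qed (simp add: Ck_on_const)

text \<open>The chain rule applies the derivative of \<open>g\<close> to a vector that varies with
  \<open>x\<close>, whereas \<open>Ck_on\<close> controls derivatives in fixed directions only.
  Expanding that vector in \<open>Basis\<close> leaves products of functions covered by the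
  induction hypothesis.\<close>

lemma Ck_on_compose:
  fixes g :: "'b::euclidean_space \<Rightarrow> 'c::real_normed_vector"
  assumes "open S" "open T" "Ck_on k T g" "Ck_on k S f" "f ` S \<subseteq> T"
  shows "Ck_on k S (\<lambda>x. g (f x))"
  using assms(3,4)
proof (induction k arbitrary: g)
  case 0
  then show ?case using assms(5) continuous_on_compose2 by auto
next
  case (Suc k)
  have der: "((\<lambda>x. g (f x)) has_derivative (\<lambda>v. fder g (f x) (fder f x v))) (at x)" if "x \<in> S" for x
    using that Suc.prems assms(5) by (intro has_derivative_compose[of f _ x UNIV g] fder_works) auto
  have eq: "fder g (f x) (fder f x v) = (\<Sum>b\<in>Basis. (fder f x v \<bullet> b) *\<^sub>R fder g (f x) b)" if "x \<in> S" for x v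
  proof -
    have "linear (fder g (f x))"
      using Suc.prems that assms(5) by (intro linear_frechet_derivative) auto
    then have "fder g (f x) (\<Sum>b\<in>Basis. (fder f x v \<bullet> b) *\<^sub>R b) = (\<Sum>b\<in>Basis. (fder f x v \<bullet> b) *\<^sub>R fder g (f x) b)"
      by (simp add: linear_sum linear_scale)
    then show ?thesis by (simp add: euclidean_representation)
  qed
  have "Ck_on k S (\<lambda>x. \<Sum>b\<in>Basis. (fder f x v \<bullet> b) *\<^sub>R fder g (f x) b)" for v
  proof (intro Ck_on_sum assms(1) Ck_on_bounded_bilinear[OF _ bounded_bilinear_scaleR])
    fix b :: 'b assume "b \<in> Basis"
    show "Ck_on k S (\<lambda>x. fder f x v \<bullet> b)"
      using Ck_on_bounded_linear[OF assms(1) bounded_linear_inner_left, of k "\<lambda>x. fder f x v" b] Suc.prems by simp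
    show "Ck_on k S (\<lambda>x. fder g (f x) b)"
      using Suc.IH[of "\<lambda>x. fder g x b"] Suc.prems Suc.prems(2)[THEN Ck_on_SucD] by simp
  qed
  then have "Ck_on k S (\<lambda>x. fder (\<lambda>x. g (f x)) x v)" for v
    by (rule Ck_on_cong[OF assms(1), rotated]) (simp add: fder_eqI[OF der] eq)
  then show ?case using der by (auto simp: differentiable_def)
qed

lemma smooth_on_const: "smooth_on S (\<lambda>x. c)"
  unfolding smooth_on_def by (simp add: Ck_on_const)

lemma smooth_on_add: "open S \<Longrightarrow> smooth_on S f \<Longrightarrow> smooth_on S g \<Longrightarrow> smooth_on S (\<lambda>x. f x + g x)"
  unfolding smooth_on_def by (simp add: Ck_on_add)

lemma smooth_on_sum: "open S \<Longrightarrow> (\<And>i. i \<in> I \<Longrightarrow> smooth_on S (f i)) \<Longrightarrow> smooth_on S (\<lambda>x. \<Sum>i\<in>I. f i x)"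
  unfolding smooth_on_def by (simp add: Ck_on_sum)

lemma smooth_on_bounded_linear: "bounded_linear B \<Longrightarrow> open S \<Longrightarrow> smooth_on S f \<Longrightarrow> smooth_on S (\<lambda>x. B (f x))"
  unfolding smooth_on_def by (simp add: Ck_on_bounded_linear)

lemma smooth_on_bounded_bilinear:
  "bounded_bilinear B \<Longrightarrow> open S \<Longrightarrow> smooth_on S f \<Longrightarrow> smooth_on S g \<Longrightarrow> smooth_on S (\<lambda>x. B (f x) (g x))"
  unfolding smooth_on_def by (simp add: Ck_on_bounded_bilinear)

lemmas smooth_on_scaleR = smooth_on_bounded_bilinear[OF bounded_bilinear_scaleR]
lemmas smooth_on_mult = smooth_on_bounded_bilinear[OF bounded_bilinear_mult]
lemmas smooth_on_inner = smooth_on_bounded_bilinear[OF bounded_bilinear_inner]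

lemma smooth_on_minus: "open S \<Longrightarrow> smooth_on S f \<Longrightarrow> smooth_on S (\<lambda>x. - f x)"
  using smooth_on_bounded_linear[OF bounded_linear_minus[OF bounded_linear_ident], of S f] by simp

lemma smooth_on_compose:
  fixes g :: "'b::euclidean_space \<Rightarrow> 'c::real_normed_vector"
  assumes "open S" "open T" "smooth_on T g" "smooth_on S f" "f ` S \<subseteq> T"
  shows "smooth_on S (\<lambda>x. g (f x))"
  using assms unfolding smooth_on_def by (simp add: Ck_on_compose)

lemma smooth_on_ident: "smooth_on S (\<lambda>x. x)"
proof -
  have "Ck_on k S (\<lambda>x. x)" for k :: nat
    by (cases k) (auto simp: Ck_on_const)
  then show ?thesis unfolding smooth_on_def by simp
qed

lemma smooth_on_linear: "bounded_linear B \<Longrightarrow> smooth_on S B"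
  using smooth_on_bounded_linear[OF _ open_UNIV smooth_on_ident, of B] smooth_on_subset by blast

lemma smooth_on_prod:
  fixes f :: "'i \<Rightarrow> 'a::real_normed_vector \<Rightarrow> real"
  assumes "open S" "\<And>i. i \<in> I \<Longrightarrow> smooth_on S (f i)" shows "smooth_on S (\<lambda>x. \<Prod>i\<in>I. f i x)"
proof (cases "finite I")
  case True
  then show ?thesis using assms(2)
    by (induction I rule: finite_induct) (auto intro: smooth_on_const smooth_on_mult[OF assms(1)])
qed (simp add: smooth_on_const)

lemma smooth_on_vec_nth: "open S \<Longrightarrow> smooth_on S f \<Longrightarrow> smooth_on S (\<lambda>x. f x $ i)"
  by (rule smooth_on_bounded_linear[OF bounded_linear_vec_nth])

lemma smooth_on_vecI:
  fixes f :: "'a::real_normed_vector \<Rightarrow> 'b::euclidean_space^'n::finite"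
  assumes "open S" "\<And>i. smooth_on S (\<lambda>x. f x $ i)" shows "smooth_on S f"
proof -
  have bl: "bounded_linear (\<lambda>b::'b. axis i b :: 'b^'n)" for i
    by (intro linear_conv_bounded_linear[THEN iffD1] linearI) (auto simp: vec_eq_iff axis_def)
  have "smooth_on S (\<lambda>x. \<Sum>i\<in>UNIV. axis i (f x $ i))"
    by (intro smooth_on_sum smooth_on_bounded_linear[OF bl] assms)
  moreover have "(\<Sum>i\<in>UNIV. axis i (f x $ i)) = f x" for x
    by (auto simp: vec_eq_iff axis_def)
  ultimately show ?thesis by simp
qed

section \<open>Determinants, roots and inverse matrices\<close>

lemma smooth_on_det: "open S \<Longrightarrow> smooth_on S f \<Longrightarrow> smooth_on S (\<lambda>x. det (f x :: real^'n^'n::finite))"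
  unfolding det_def by (intro smooth_on_sum smooth_on_mult smooth_on_const smooth_on_prod smooth_on_vec_nth)

lemma smooth_on_matrix_vector_mult:
  assumes "open S" "smooth_on S (f :: _ \<Rightarrow> real^'n::finite^'k::finite)" "smooth_on S g"
  shows "smooth_on S (\<lambda>x. f x *v g x)"
  by (rule smooth_on_vecI[OF assms(1)])
     (auto simp: matrix_vector_mult_def intro!: smooth_on_sum smooth_on_mult smooth_on_vec_nth assms)

text \<open>Bootstrapping for functions such as \<open>inverse\<close> and \<open>sqrt\<close>,
  whose derivative is an expression in the function itself: C^k for \<open>f\<close> gives C^k for
  \<open>f'\<close>, hence C^(k+1) for \<open>f\<close>.\<close>

lemma smooth_on_real:
  fixes f f' :: "real \<Rightarrow> real"
  assumes S: "open S" and der: "\<And>x. x \<in> S \<Longrightarrow> (f has_real_derivative f' x) (at x)"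
    and step: "\<And>k. Ck_on k S f \<Longrightarrow> Ck_on k S f'"
  shows "smooth_on S f"
proof -
  have "Ck_on k S f" for k
  proof (induction k)
    case 0
    then show ?case using der DERIV_isCont by (auto intro!: continuous_at_imp_continuous_on)
  next
    case (Suc k)
    have d: "(f has_derivative (\<lambda>v. v * f' x)) (at x)" if "x \<in> S" for x
      using der[OF that] by (metis has_field_derivative_def mult_commute_abs)
    have "Ck_on k S (\<lambda>x. v * f' x)" for v :: real
      by (rule Ck_on_bounded_linear[OF S bounded_linear_mult_right step[OF Suc.IH]])
    then have "Ck_on k S (\<lambda>x. fder f x v)" for v
      by (rule Ck_on_cong[OF S, of "\<lambda>x. fder f x v" "\<lambda>x. v * f' x", rotated]) (simp add: fder_eqI[OF d])
    then show ?case using d by (auto simp: differentiable_def)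
  qed
  then show ?thesis unfolding smooth_on_def by simp
qed

lemma smooth_on_inverse_real: "smooth_on (- {0::real}) inverse"
proof (rule smooth_on_real)
  fix k assume k: "Ck_on k (- {0::real}) inverse"
  show "Ck_on k (- {0::real}) (\<lambda>x. - (inverse x * inverse x))"
    using Ck_on_bounded_linear[OF _ bounded_linear_minus[OF bounded_linear_ident]
      Ck_on_bounded_bilinear[OF _ bounded_bilinear_mult k k]] by auto
qed (auto intro!: derivative_eq_intros)

lemma smooth_on_inverse:
  assumes "open S" "smooth_on S f" "\<And>x. x \<in> S \<Longrightarrow> f x \<noteq> 0"
  shows "smooth_on S (\<lambda>x. inverse (f x :: real))"
  by (rule smooth_on_compose[OF assms(1) _ smooth_on_inverse_real assms(2)]) (use assms in auto)

lemma smooth_on_divide: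
  assumes "open S" "smooth_on S f" "smooth_on S g" "\<And>x. x \<in> S \<Longrightarrow> g x \<noteq> 0"
  shows "smooth_on S (\<lambda>x. f x / (g x :: real))"
  unfolding divide_inverse by (intro smooth_on_mult smooth_on_inverse assms)

lemma smooth_on_sqrt_real: "smooth_on {0<..} sqrt"
proof (rule smooth_on_real)
  fix k assume k: "Ck_on k {0<..} sqrt"
  have "Ck_on k {0<..} (\<lambda>x. inverse (sqrt x))"
    by (rule Ck_on_compose[OF _ _ _ k, where T="-{0}"]) (use smooth_on_inverse_real in \<open>auto simp: smooth_on_def\<close>)
  then show "Ck_on k {0<..} (\<lambda>x. inverse (sqrt x) / 2)"
    by (rule Ck_on_bounded_linear[OF open_greaterThan bounded_linear_divide])
qed (auto intro!: derivative_eq_intros simp: field_simps)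

lemma smooth_on_sqrt:
  assumes "open S" "smooth_on S f" "\<And>x. x \<in> S \<Longrightarrow> f x > 0"
  shows "smooth_on S (\<lambda>x. sqrt (f x))"
  by (rule smooth_on_compose[OF assms(1) _ smooth_on_sqrt_real assms(2)]) (use assms in auto)

lemma matrix_inv_det_nz:
  fixes A :: "real^'n^'n::finite"
  assumes "det A \<noteq> 0"
  shows "A ** matrix_inv A = mat 1" "matrix_inv A ** A = mat 1"
proof -
  have "\<exists>B. A ** B = mat 1 \<and> B ** A = mat 1"
    using assms unfolding invertible_det_nz[symmetric] invertible_def .
  then have "A ** matrix_inv A = mat 1 \<and> matrix_inv A ** A = mat 1"
    unfolding matrix_inv_def by (rule someI_ex)
  then show "A ** matrix_inv A = mat 1" "matrix_inv A ** A = mat 1" by auto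
qed

text \<open>Cramer's rule for the columns of the identity. It presents the entries of the inverse as
  quotients of determinants, from which their smoothness follows.\<close>

lemma matrix_inv_cramer:
  fixes A :: "real^'n^'n::finite"
  assumes "det A \<noteq> 0"
  shows "matrix_inv A $ i $ j = det (\<chi> r s. if s = i then axis j 1 $ r else A $ r $ s) / det A"
proof -
  have "A *v (matrix_inv A *v axis j 1) = axis j 1"
    by (simp add: matrix_vector_mul_assoc matrix_inv_det_nz[OF assms])
  then have "matrix_inv A *v axis j 1 = (\<chi> k. det (\<chi> r s. if s = k then axis j 1 $ r else A $ r $ s) / det A)"
    using cramer[OF assms] by blast
  moreover have "matrix_inv A $ i $ j = (matrix_inv A *v axis j 1) $ i"
    by (simp add: matrix_vector_mul_component inner_axis)
  ultimately show ?thesis by simp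
qed

lemma smooth_on_matrix_inv:
  fixes f :: "_ \<Rightarrow> real^'n^'n::finite"
  assumes "open S" "smooth_on S f" "\<And>x. x \<in> S \<Longrightarrow> det (f x) \<noteq> 0"
  shows "smooth_on S (\<lambda>x. matrix_inv (f x))"
proof (intro smooth_on_vecI assms(1))
  fix i j
  show "smooth_on S (\<lambda>x. matrix_inv (f x) $ i $ j)"
  proof (rule smooth_on_cong[OF assms(1) matrix_inv_cramer[OF assms(3)]])
    show "smooth_on S (\<lambda>x. det (\<chi> r s. if s = i then axis j 1 $ r else f x $ r $ s) / det (f x))"
    proof (intro smooth_on_divide[OF assms(1) smooth_on_det[OF assms(1)] smooth_on_det[OF assms(1,2)]] smooth_on_vecI assms(1,3))
      fix r s
      show "smooth_on S (\<lambda>x. (\<chi> r s. if s = i then axis j 1 $ r else f x $ r $ s) $ r $ s)"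
        by (cases "s = i") (auto intro!: smooth_on_const smooth_on_vec_nth assms)
    qed
  qed
qed

lemma smooth_on_Pair:
  assumes "open S" "smooth_on S f" "smooth_on S g"
  shows "smooth_on S (\<lambda>x. (f x, g x))"
proof -
  have "smooth_on S (\<lambda>x. (f x, 0) + (0, g x))"
    by (intro smooth_on_add assms smooth_on_bounded_linear[OF bounded_linear_Pair[OF bounded_linear_ident bounded_linear_zero]]
       smooth_on_bounded_linear[OF bounded_linear_Pair[OF bounded_linear_zero bounded_linear_ident]])
  then show ?thesis by simp
qed

lemma smooth_on_diff: "open S \<Longrightarrow> smooth_on S f \<Longrightarrow> smooth_on S g \<Longrightarrow> smooth_on S (\<lambda>x. f x - g x :: _ ::real_normed_vector)"
  using smooth_on_add[OF _ _ smooth_on_minus, of S f g] by simp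

text \<open>The flat function exp(-1/x) is the member \<open>exp_inv 0\<close>. The powers are
  included because the family is then closed under differentiation up to linear combinations, so
  smoothness is one induction for all members.\<close>

definition exp_inv :: "nat \<Rightarrow> real \<Rightarrow> real" where
  "exp_inv k x = (if x > 0 then inverse x ^ k * exp (- inverse x) else 0)"

lemma exp_inv_tendsto_0: "(exp_inv k \<longlongrightarrow> 0) (at 0)"
proof (rule filterlim_split_at)
  show "(exp_inv k \<longlongrightarrow> 0) (at_left 0)"
    by (rule tendsto_eventually) (auto simp: exp_inv_def eventually_at_filter)
  have "((\<lambda>x::real. inverse x ^ k / exp (inverse x)) \<longlongrightarrow> 0) (at_right 0)"
    by (rule filterlim_compose[OF tendsto_power_div_exp_0 filterlim_inverse_at_top_right])
  then show "(exp_inv k \<longlongrightarrow> 0) (at_right 0)"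
    by (rule Lim_transform_eventually)
       (auto simp: exp_inv_def exp_minus divide_inverse eventually_at_filter)
qed

lemma exp_inv_has_derivative:
  "(exp_inv k has_real_derivative (exp_inv (k + 2) x - real k * exp_inv (k + 1) x)) (at x)"
proof -
  consider "x > 0" | "x < 0" | "x = 0" by linarith
  then show ?thesis
  proof cases
    case 1
    have pow: "x ^ j = x * x ^ (j - Suc 0)" if "j > 0" for j
      using that by (cases j) auto
    have "((\<lambda>x. inverse x ^ k * exp (- inverse x)) has_real_derivative
        (exp_inv (k + 2) x - real k * exp_inv (k + 1) x)) (at x)"
      using 1 by (cases k) (auto intro!: derivative_eq_intros simp: exp_inv_def field_simps power2_eq_square, metis pow neq0_conv)
    then show ?thesis
      by (rule has_field_derivative_transform_within_open[of _ _ _ "{0<..}"]) (use 1 in \<open>auto simp: exp_inv_def\<close>)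
  next
    case 2
    have "((\<lambda>x. 0) has_real_derivative (exp_inv (k + 2) x - real k * exp_inv (k + 1) x)) (at x)"
      using 2 by (auto simp: exp_inv_def)
    then show ?thesis
      by (rule has_field_derivative_transform_within_open[of _ _ _ "{..<0}"]) (use 2 in \<open>auto simp: exp_inv_def\<close>)
  next
    case 3
    \<comment> \<open>The difference quotient of \<open>exp_inv k\<close> at 0 is
      \<open>exp_inv (Suc k)\<close>, whose limit is already known.\<close>
    have "((\<lambda>h. (exp_inv k h - exp_inv k 0) / (h - 0)) \<longlongrightarrow> 0) (at 0)"
      by (rule Lim_transform_eventually[OF exp_inv_tendsto_0[of "Suc k"]])
         (auto simp: exp_inv_def divide_inverse eventually_at_filter)
    then show ?thesis
      using 3 by (simp add: has_field_derivative_iff exp_inv_def)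
  qed
qed

lemma Ck_on_exp_inv: "Ck_on j UNIV (exp_inv k)"
proof (induction j arbitrary: k)
  case 0
  then show ?case
    by (auto intro!: continuous_at_imp_continuous_on DERIV_isCont[OF exp_inv_has_derivative])
next
  case (Suc j)
  have d: "(exp_inv k has_derivative (\<lambda>v. v * (exp_inv (k + 2) x + (- real k) * exp_inv (k + 1) x))) (at x)" for x
    using exp_inv_has_derivative[of k x] by (simp add: has_field_derivative_def mult_commute_abs)
  have "Ck_on j UNIV (\<lambda>x. v * (exp_inv (k + 2) x + (- real k) * exp_inv (k + 1) x))" for v
    by (intro Ck_on_bounded_linear[OF open_UNIV bounded_linear_mult_right] Ck_on_add[OF open_UNIV] Suc.IH)
  then show ?case using d by (auto simp: differentiable_def fder_eqI[OF d])
qed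

lemma smooth_bump:
  fixes y0 :: "'a::euclidean_space"
  assumes "r > 0"
  obtains \<phi> :: "'a \<Rightarrow> real" where "smooth_on UNIV \<phi>" "\<And>y. \<phi> y \<ge> 0" "\<phi> y0 > 0" "\<And>y. dist y0 y \<ge> r \<Longrightarrow> \<phi> y = 0"
proof
  \<comment> \<open>The squared distance is polynomial, hence smooth at the centre too; the argument
    is positive exactly inside the ball.\<close>
  let ?p = "\<lambda>y. exp_inv 0 (r\<^sup>2 + (- ((y - y0) \<bullet> (y - y0))))"
  show "smooth_on UNIV ?p"
  proof (rule smooth_on_compose[where T=UNIV and g="exp_inv 0"])
    show "smooth_on UNIV (exp_inv 0)" unfolding smooth_on_def by (simp add: Ck_on_exp_inv)
    show "smooth_on UNIV (\<lambda>y. r\<^sup>2 + (- ((y - y0) \<bullet> (y - y0))))"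
      by (intro smooth_on_add smooth_on_minus smooth_on_inner smooth_on_diff smooth_on_const smooth_on_ident) auto
  qed auto
  show "?p y \<ge> 0" for y by (auto simp: exp_inv_def)
  show "?p y0 > 0" using assms by (auto simp: exp_inv_def)
  show "?p y = 0" if "dist y0 y \<ge> r" for y
  proof -
    have "r\<^sup>2 \<le> (norm (y - y0))\<^sup>2"
      using that assms by (intro power_mono) (auto simp: dist_norm norm_minus_commute)
    then show ?thesis by (auto simp: exp_inv_def power2_norm_eq_inner)
  qed
qed

text \<open>The second difference is symmetric in \<open>v\<close> and \<open>w\<close>, but the
  mixed derivative it equals is taken in a definite order; comparing both orders will give symmetry
  of second derivatives. The mean value theorem is used along \<open>v\<close> for the difference of
  two translates, then along \<open>w\<close>.\<close>

lemma mixed_difference: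
  fixes f :: "'a::real_normed_vector \<Rightarrow> real"
  assumes sm: "smooth_on S f" and h: "h > 0"
    and sub: "\<And>s t. 0 \<le> s \<Longrightarrow> s \<le> h \<Longrightarrow> 0 \<le> t \<Longrightarrow> t \<le> h \<Longrightarrow> y + s *\<^sub>R v + t *\<^sub>R w \<in> S"
  obtains s t where "0 < s" "s < h" "0 < t" "t < h"
    "f (y + h *\<^sub>R v + h *\<^sub>R w) - f (y + h *\<^sub>R v) - f (y + h *\<^sub>R w) + f y
      = h\<^sup>2 * fder (\<lambda>z. fder f z v) (y + s *\<^sub>R v + t *\<^sub>R w) w"
proof -
  have line: "((\<lambda>s. g (a + s *\<^sub>R u)) has_real_derivative fder g (a + s *\<^sub>R u) u) (at s)"
    if "smooth_on S g" "a + s *\<^sub>R u \<in> S" for g :: "'a \<Rightarrow> real" and a u s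
  proof -
    have "((\<lambda>s. a + s *\<^sub>R u) has_derivative (\<lambda>x. x *\<^sub>R u)) (at s)"
      by (auto intro!: derivative_eq_intros)
    then have "((\<lambda>s. g (a + s *\<^sub>R u)) has_derivative (\<lambda>x. fder g (a + s *\<^sub>R u) (x *\<^sub>R u))) (at s)"
      using has_derivative_compose smooth_on_has_derivative[OF that] by fast
    moreover have "(\<lambda>x. fder g (a + s *\<^sub>R u) (x *\<^sub>R u)) = (*) (fder g (a + s *\<^sub>R u) u)"
      using linear_frechet_derivative[OF smooth_on_imp_differentiable[OF that]]
      by (auto simp: linear_scale fun_eq_iff)
    ultimately show ?thesis by (simp add: has_field_derivative_def)
  qed
  let ?p = "\<lambda>s. f ((y + h *\<^sub>R w) + s *\<^sub>R v) - f (y + s *\<^sub>R v)"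
  have "\<exists>s. 0 < s \<and> s < h \<and> ?p h - ?p 0 = (h - 0) * (fder f ((y + h *\<^sub>R w) + s *\<^sub>R v) v - fder f (y + s *\<^sub>R v) v)"
  proof (rule MVT2[OF h])
    fix s assume s: "0 \<le> s" "s \<le> h"
    have "(y + h *\<^sub>R w) + s *\<^sub>R v \<in> S" "y + s *\<^sub>R v \<in> S"
      using sub[of s h] sub[of s 0] s h by (auto simp: algebra_simps)
    then show "(?p has_real_derivative (fder f ((y + h *\<^sub>R w) + s *\<^sub>R v) v - fder f (y + s *\<^sub>R v) v)) (at s)"
      by (intro DERIV_diff line sm)
  qed
  then obtain s where s: "0 < s" "s < h"
    "?p h - ?p 0 = h * (fder f ((y + h *\<^sub>R w) + s *\<^sub>R v) v - fder f (y + s *\<^sub>R v) v)" by auto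
  let ?q = "\<lambda>t. fder f ((y + s *\<^sub>R v) + t *\<^sub>R w) v"
  have "\<exists>t. 0 < t \<and> t < h \<and> ?q h - ?q 0 = (h - 0) * fder (\<lambda>z. fder f z v) ((y + s *\<^sub>R v) + t *\<^sub>R w) w"
  proof (rule MVT2[OF h])
    fix t assume "0 \<le> t" "t \<le> h"
    then show "(?q has_real_derivative fder (\<lambda>z. fder f z v) ((y + s *\<^sub>R v) + t *\<^sub>R w) w) (at t)"
      using sub[of s t] s by (intro line smooth_on_fder sm) auto
  qed
  then obtain t where t: "0 < t" "t < h"
    "?q h - ?q 0 = h * fder (\<lambda>z. fder f z v) ((y + s *\<^sub>R v) + t *\<^sub>R w) w" by auto
  have "f (y + h *\<^sub>R v + h *\<^sub>R w) - f (y + h *\<^sub>R v) - f (y + h *\<^sub>R w) + f y = ?p h - ?p 0"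
    by (simp add: algebra_simps)
  also have "\<dots> = h * (?q h - ?q 0)" unfolding s(3) by (simp add: algebra_simps)
  also have "\<dots> = h\<^sup>2 * fder (\<lambda>z. fder f z v) ((y + s *\<^sub>R v) + t *\<^sub>R w) w"
    unfolding t(3) by (simp add: power2_eq_square)
  finally show thesis using that s t by blast
qed

lemma fder_symmetric_real:
  fixes f :: "'a::real_normed_vector \<Rightarrow> real"
  assumes "open S" "y \<in> S" and sm: "smooth_on S f"
  shows "fder (\<lambda>z. fder f z v) y w = fder (\<lambda>z. fder f z w) y v"
proof (rule ccontr)
  let ?P = "\<lambda>z. fder (\<lambda>z. fder f z v) z w" and ?Q = "\<lambda>z. fder (\<lambda>z. fder f z w) z v"
  assume ne: "?P y \<noteq> ?Q y"
  \<comment> \<open>Half the gap: numbers closer than \<open>e\<close> to \<open>?P y\<close> and to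
    \<open>?Q y\<close> cannot coincide.\<close>
  define e where "e = \<bar>?P y - ?Q y\<bar> / 2"
  have e: "e > 0" using ne by (simp add: e_def)
  have "isCont ?P y" "isCont ?Q y"
    using smooth_on_continuous[OF smooth_on_fder[OF smooth_on_fder[OF sm]]] assms(1,2)
    by (auto simp: continuous_on_eq_continuous_at)
  then obtain d1 d2 where d: "d1 > 0" "d2 > 0" "\<And>z. dist z y < d1 \<Longrightarrow> dist (?P z) (?P y) < e"
     "\<And>z. dist z y < d2 \<Longrightarrow> dist (?Q z) (?Q y) < e"
    using e unfolding continuous_at_eps_delta by metis
  obtain d3 where d3: "d3 > 0" "ball y d3 \<subseteq> S" using assms openE by blast
  define d where "d = min d1 (min d2 d3)"
  \<comment> \<open>Keeps the parallelogram spanned by \<open>h *\<^sub>R v\<close> and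
    \<open>h *\<^sub>R w\<close> within distance d/2 of \<open>y\<close>; the summand 1 covers the
    case that both vectors are zero.\<close>
  define h where "h = d / (2 * (norm v + norm w + 1))"
  have nn: "norm v + norm w + 1 > 0" by (simp add: add_nonneg_pos)
  have dp: "d > 0" using d d3 by (simp add: d_def)
  have h: "h > 0" using dp nn by (simp add: h_def)
  have near: "dist (y + s *\<^sub>R v + t *\<^sub>R w) y < d" if "0 \<le> s" "s \<le> h" "0 \<le> t" "t \<le> h" for s t
  proof -
    have "norm (s *\<^sub>R v + t *\<^sub>R w) \<le> s * norm v + t * norm w"
      using norm_triangle_ineq[of "s *\<^sub>R v" "t *\<^sub>R w"] that by simp
    also have "\<dots> \<le> h * norm v + h * norm w" using that by (intro add_mono mult_right_mono) auto
    also have "\<dots> \<le> h * (norm v + norm w + 1)" using h by (simp add: algebra_simps)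
    also have "\<dots> = d / 2" using nn by (simp add: h_def field_simps)
    also have "\<dots> < d" using dp by simp
    finally show ?thesis by (simp add: dist_norm add.assoc)
  qed
  have near': "dist (y + t *\<^sub>R w + s *\<^sub>R v) y < d" if "0 \<le> s" "s \<le> h" "0 \<le> t" "t \<le> h" for s t
    using near[OF that] by (simp add: add_ac)
  have sub: "z \<in> S" if "dist z y < d" for z using that d3 by (auto simp: d_def dist_commute)
  obtain s t where st: "0 < s" "s < h" "0 < t" "t < h"
    "f (y + h *\<^sub>R v + h *\<^sub>R w) - f (y + h *\<^sub>R v) - f (y + h *\<^sub>R w) + f y = h\<^sup>2 * ?P (y + s *\<^sub>R v + t *\<^sub>R w)"
    by (rule mixed_difference[OF sm h sub[OF near]])
  obtain s' t' where st': "0 < s'" "s' < h" "0 < t'" "t' < h"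
    "f (y + h *\<^sub>R w + h *\<^sub>R v) - f (y + h *\<^sub>R w) - f (y + h *\<^sub>R v) + f y = h\<^sup>2 * ?Q (y + s' *\<^sub>R w + t' *\<^sub>R v)"
    by (rule mixed_difference[OF sm h sub[OF near']])
  have "h\<^sup>2 * ?P (y + s *\<^sub>R v + t *\<^sub>R w) = h\<^sup>2 * ?Q (y + s' *\<^sub>R w + t' *\<^sub>R v)"
  proof -
    have "y + h *\<^sub>R v + h *\<^sub>R w = y + h *\<^sub>R w + h *\<^sub>R v" by (simp add: add_ac)
    then have "f (y + h *\<^sub>R v + h *\<^sub>R w) = f (y + h *\<^sub>R w + h *\<^sub>R v)" by (rule arg_cong)
    then show ?thesis using st(5) st'(5) by linarith
  qed
  then have "?P (y + s *\<^sub>R v + t *\<^sub>R w) = ?Q (y + s' *\<^sub>R w + t' *\<^sub>R v)" using h by simp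
  moreover have "dist (?P (y + s *\<^sub>R v + t *\<^sub>R w)) (?P y) < e"
    using near[of s t] st d by (simp add: d_def)
  moreover have "dist (?Q (y + s' *\<^sub>R w + t' *\<^sub>R v)) (?Q y) < e"
    using near'[of t' s'] st' d by (simp add: d_def)
  moreover have False if "a = b" "dist a p < \<bar>p - q\<bar> / 2" "dist b q < \<bar>p - q\<bar> / 2" for a b p q :: real
    using that unfolding dist_real_def by (simp add: abs_if split: if_splits)
  ultimately show False unfolding e_def by blast
qed

lemma fder_symmetric:
  fixes f :: "'a::real_normed_vector \<Rightarrow> 'b::euclidean_space"
  assumes "open S" "y \<in> S" and sm: "smooth_on S f"
  shows "fder (\<lambda>z. fder f z v) y w = fder (\<lambda>z. fder f z w) y v"
proof (rule euclidean_eqI)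
  fix b :: 'b assume "b \<in> Basis"
  have comp: "fder (\<lambda>z. g z \<bullet> b) z v = fder g z v \<bullet> b" if "z \<in> S" "smooth_on S g" for g :: "'a \<Rightarrow> 'b" and z v
    using fder_eqI[OF bounded_linear.has_derivative[OF bounded_linear_inner_left smooth_on_has_derivative[OF that(2,1)]]] by metis
  have "fder (\<lambda>z. fder f z v) y w \<bullet> b = fder (\<lambda>z. fder (\<lambda>z. f z \<bullet> b) z v) y w" for v w
  proof -
    have "fder (\<lambda>z. fder f z v) y w \<bullet> b = fder (\<lambda>z. fder f z v \<bullet> b) y w"
      using comp[OF assms(2) smooth_on_fder[OF sm]] by simp
    also have "\<dots> = fder (\<lambda>z. fder (\<lambda>z. f z \<bullet> b) z v) y w"
      using fder_cong_open[OF assms(1,2), of "\<lambda>z. fder f z v \<bullet> b"] comp[OF _ sm] by metis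
    finally show ?thesis .
  qed
  moreover have "smooth_on S (\<lambda>z. f z \<bullet> b)"
    by (rule smooth_on_bounded_linear[OF bounded_linear_inner_left assms(1) sm])
  ultimately show "fder (\<lambda>z. fder f z v) y w \<bullet> b = fder (\<lambda>z. fder f z w) y v \<bullet> b"
    using fder_symmetric_real[OF assms(1,2)] by simp
qed

section \<open>Determinants and Christoffel symbols\<close>

lemma det_has_derivative:
  fixes X :: "real^'n^'n::finite"
  shows "(det has_derivative (\<lambda>H. \<Sum>k\<in>UNIV. det (\<chi> i. if i = k then H $ i else X $ i))) (at X)"
proof -
  have nth: "((\<lambda>A::real^'n^'n. A $ i $ j) has_derivative (\<lambda>H. H $ i $ j)) (at X)" for i j
    by (intro bounded_linear.has_derivative[OF bounded_linear_vec_nth] has_derivative_ident)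
  have "(det has_derivative (\<lambda>H. \<Sum>p | p permutes UNIV. of_int (sign p) *
      (\<Sum>k\<in>UNIV. H $ k $ p k * (\<Prod>j\<in>UNIV - {k}. X $ j $ p j)))) (at X)"
    unfolding det_def[abs_def]
    by (intro has_derivative_sum has_derivative_mult_right has_derivative_prod nth)
  moreover have "H $ k $ p k * (\<Prod>j\<in>UNIV - {k}. X $ j $ p j)
      = (\<Prod>i\<in>UNIV. (\<chi> i. if i = k then H $ i else X $ i) $ i $ p i)" for H :: "real^'n^'n" and k p
    by (subst prod.remove[of UNIV k]) (auto intro!: prod.cong)
  ultimately show ?thesis
    unfolding det_def by (simp add: sum_distrib_left sum.swap[of _ _ UNIV])
qed

lemma det_fder: "(det has_derivative fder det X) (at (X :: real^'n^'n::finite))"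
  using det_has_derivative by (intro fder_works) (auto simp: differentiable_def)

text \<open>Jacobi's formula. Row \<open>k\<close> of \<open>C ** X\<close> is a combination of the
  rows of \<open>X\<close>; substituted for row \<open>k\<close> of \<open>X\<close>, only the
  multiple of row \<open>k\<close> itself survives in the determinant.\<close>

lemma fder_det_mult_left:
  fixes X :: "real^'n^'n::finite"
  shows "fder det X (C ** X) = trace C * det X"
proof -
  have "det (\<chi> i. if i = k then (C ** X) $ i else X $ i) = C $ k $ k * det X" for k
  proof -
    have "(C ** X) $ k = (\<Sum>i\<in>UNIV. (C $ k) $ i *s row i X)"
      by (simp add: vec_eq_iff matrix_matrix_mult_def row_def sum_component)
    then have "(\<chi> i. if i = k then (C ** X) $ i else X $ i)
        = (\<chi> i. if i = k then (\<Sum>i\<in>UNIV. (C $ k) $ i *s row i X) else row i X)"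
      by (auto simp: vec_eq_iff row_def)
    then show ?thesis using cramer_lemma_transpose[of k "C $ k" X] by simp
  qed
  then show ?thesis
    by (simp add: fder_eqI[OF det_has_derivative] trace_def sum_distrib_right)
qed

lemma trace_transpose: "trace (transpose A) = trace A"
  by (simp add: trace_def transpose_def)

lemma det_eq_0_imp_kernel:
  fixes A :: "real^'n^'n::finite"
  assumes "det A = 0"
  shows "\<exists>v. v \<noteq> 0 \<and> A *v v = 0"
proof -
  have "\<not> (\<exists>B. B ** A = mat 1)"
    using assms invertible_det_nz[of A] invertible_left_inverse[of A] by simp
  then show ?thesis unfolding matrix_left_invertible_ker by blast
qed

lemma fder_det_mult_right:
  fixes X :: "real^'n^'n::finite"
  shows "fder det X (X ** B) = trace B * det X"
proof -
  have lin: "bounded_linear (transpose :: real^'n^'n \<Rightarrow> real^'n^'n)"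
    by (intro linear_conv_bounded_linear[THEN iffD1] linearI) (auto simp: transpose_def vec_eq_iff)
  have "((\<lambda>A. det (transpose A)) has_derivative (\<lambda>H. fder det (transpose X) (transpose H))) (at X)"
    by (rule has_derivative_compose[OF bounded_linear.has_derivative[OF lin has_derivative_ident] det_fder])
  then have "fder det X = (\<lambda>H. fder det (transpose X) (transpose H))"
    by (intro fder_eqI) simp
  then show ?thesis
    by (simp add: matrix_transpose_mul fder_det_mult_left trace_transpose)
qed

text \<open>The left side is the derivative of \<open>det\<close> in the direction in which
  \<open>B\<close> is applied to every row at once. It later distributes the trace of a Christoffel
  matrix over the slots of a volume form.\<close>

lemma sum_det_replace_row:
  fixes a :: "'n::finite \<Rightarrow> real^'n"
  shows "(\<Sum>k\<in>UNIV. det (\<chi> i. if i = k then B *v a i else a i)) = trace B * det (\<chi> i. a i)"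
proof -
  let ?X = "\<chi> i. a i"
  have "(?X ** transpose B) $ i = B *v a i" for i
    by (simp add: vec_eq_iff matrix_matrix_mult_def transpose_def matrix_vector_mult_def mult.commute)
  then have "(\<Sum>k\<in>UNIV. det (\<chi> i. if i = k then B *v a i else a i)) = fder det ?X (?X ** transpose B)"
    unfolding fder_eqI[OF det_has_derivative] by (intro sum.cong arg_cong[of _ _ det]) (auto simp: vec_eq_iff)
  then show ?thesis by (simp add: fder_det_mult_right trace_transpose)
qed

lemma bounded_bilinear_matrix_vector_mult:
  "bounded_bilinear (\<lambda>(A::real^'n::finite^'m::finite) x. A *v x)"
  by (intro bilinear_conv_bounded_bilinear[THEN iffD1])
     (auto simp: bilinear_def matrix_vector_mult_add_rdistrib matrix_vector_right_distrib
        scaleR_matrix_vector_assoc[symmetric] matrix_vector_mult_scaleR intro!: linearI)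

lemma linear_axis_expansion:
  fixes L :: "real^'n::finite \<Rightarrow> 'w::real_vector"
  assumes "linear L"
  shows "L z = (\<Sum>l\<in>UNIV. z $ l *\<^sub>R L (axis l 1))"
proof -
  have "(\<Sum>l\<in>UNIV. z $ l *\<^sub>R axis l 1) = z"
    using basis_expansion[of z] by (simp add: scalar_mult_eq_scaleR)
  then have "L z = L (\<Sum>l\<in>UNIV. z $ l *\<^sub>R axis l 1)" by simp
  then show ?thesis by (simp add: linear_sum[OF assms] linear_scale[OF assms])
qed

lemma inner_transpose_matrix: "(transpose A *v x) \<bullet> y = x \<bullet> (A *v (y :: real^'n::finite))"
  by (simp add: dot_lmul_matrix)

text \<open>The segment from the identity to \<open>A\<close> stays positive definite, so the
  determinant cannot vanish on it and keeps the sign it has at the identity.\<close>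

lemma det_pos_def:
  fixes A :: "real^'n^'n::finite"
  assumes "\<And>v. v \<noteq> 0 \<Longrightarrow> v \<bullet> (A *v v) > 0"
  shows "det A > 0"
proof (rule ccontr)
  assume "\<not> det A > 0"
  let ?p = "\<lambda>t. det ((1 - t) *\<^sub>R mat 1 + t *\<^sub>R A)"
  have nz: "?p t \<noteq> 0" if "0 \<le> t" "t \<le> 1" for t
  proof
    assume "?p t = 0"
    then obtain v where v: "v \<noteq> 0" "((1 - t) *\<^sub>R mat 1 + t *\<^sub>R A) *v v = 0"
      using det_eq_0_imp_kernel by blast
    then have "(1 - t) *\<^sub>R v + t *\<^sub>R (A *v v) = 0"
      by (simp add: matrix_vector_mult_add_rdistrib scaleR_matrix_vector_assoc[symmetric])
    then have "v \<bullet> ((1 - t) *\<^sub>R v + t *\<^sub>R (A *v v)) = 0" by simp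
    then have "(1 - t) * (v \<bullet> v) + t * (v \<bullet> (A *v v)) = 0"
      by (simp only: inner_add_right inner_scaleR_right)
    moreover have "(1 - t) * (v \<bullet> v) + t * (v \<bullet> (A *v v)) > 0"
    proof (cases "t = 1")
      case False
      then have "(1 - t) * (v \<bullet> v) > 0" using v that by simp
      moreover have "t * (v \<bullet> (A *v v)) \<ge> 0" using assms[OF v(1)] that by simp
      ultimately show ?thesis by linarith
    qed (use assms[OF v(1)] in simp)
    ultimately show False by simp
  qed
  have "continuous_on {0..1} ?p"
    unfolding det_def by (intro continuous_intros)
  moreover have "?p 0 = 1" "?p 1 \<le> 0" using \<open>\<not> det A > 0\<close> by auto
  ultimately obtain t where "0 \<le> t" "t \<le> 1" "?p t = 0"
    using IVT2'[of ?p 1 0 0] by auto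
  then show False using nz by blast
qed

text \<open>A copy of \<open>christoffel\<close> for a bare matrix field without chart or manifold,
  so that one local theory serves source and target.\<close>

definition chr :: "(real^'m \<Rightarrow> real^'m^'m::finite) \<Rightarrow> real^'m \<Rightarrow> real^'m \<Rightarrow> real^'m \<Rightarrow> real^'m" where
  "chr g y v w = (1/2) *\<^sub>R (matrix_inv (g y) *v
     (\<chi> l. fder (\<lambda>z. w \<bullet> (g z *v axis l 1)) y v
         + fder (\<lambda>z. v \<bullet> (g z *v axis l 1)) y w
         - fder (\<lambda>z. v \<bullet> (g z *v w)) y (axis l 1)))"

lemma christoffel_eq_chr: "christoffel M c = chr (gram M c)"
  unfolding christoffel_def chr_def ginner_def by (intro ext) simp

section \<open>The Levi-Civita connection of a metric in coordinates\<close>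

locale metric_field =
  fixes D :: "(real^'m::finite) set" and g :: "real^'m \<Rightarrow> real^'m^'m"
  assumes open_D: "open D" and smooth_g: "smooth_on D g"
    and sym_g: "y \<in> D \<Longrightarrow> transpose (g y) = g y"
    and pos_g: "y \<in> D \<Longrightarrow> v \<noteq> 0 \<Longrightarrow> v \<bullet> (g y *v v) > 0"
begin

lemma g_commute: "y \<in> D \<Longrightarrow> v \<bullet> (g y *v w) = w \<bullet> (g y *v v)"
  using inner_transpose_matrix[of "g y" v w] sym_g[of y] by (simp add: inner_commute)

lemma det_g: "y \<in> D \<Longrightarrow> det (g y) > 0"
  using det_pos_def pos_g by blast

lemma g_inv: "y \<in> D \<Longrightarrow> g y ** matrix_inv (g y) = mat 1" "y \<in> D \<Longrightarrow> matrix_inv (g y) ** g y = mat 1"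
  using matrix_inv_det_nz[of "g y"] det_g[of y] by auto

lemma g_inv_mv: "y \<in> D \<Longrightarrow> g y *v (matrix_inv (g y) *v v) = v"
  "y \<in> D \<Longrightarrow> matrix_inv (g y) *v (g y *v v) = v"
  by (auto simp: matrix_vector_mul_assoc g_inv)

lemma g_eqI: "y \<in> D \<Longrightarrow> (\<And>v. v \<bullet> (g y *v x) = v \<bullet> (g y *v x')) \<Longrightarrow> x = x'"
proof -
  assume y: "y \<in> D" and eq: "\<And>v. v \<bullet> (g y *v x) = v \<bullet> (g y *v x')"
  have "g y *v x = g y *v x'"
    using eq vector_eq_ldot[of "g y *v x" "g y *v x'"] by blast
  then have "matrix_inv (g y) *v (g y *v x) = matrix_inv (g y) *v (g y *v x')" by simp
  then show "x = x'" by (simp add: g_inv_mv y)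
qed

lemma smooth_inv_g: "smooth_on D (\<lambda>y. matrix_inv (g y))"
  using det_g by (intro smooth_on_matrix_inv open_D smooth_g) (simp add: less_imp_neq[symmetric])

lemma sym_inv_g: "y \<in> D \<Longrightarrow> transpose (matrix_inv (g y)) = matrix_inv (g y)"
proof -
  assume y: "y \<in> D"
  have "transpose (matrix_inv (g y)) = (matrix_inv (g y) ** g y) ** transpose (matrix_inv (g y))"
    by (simp add: g_inv y)
  also have "\<dots> = matrix_inv (g y) ** transpose (matrix_inv (g y) ** g y)"
    by (simp add: matrix_transpose_mul sym_g y matrix_mul_assoc)
  finally show ?thesis by (simp add: g_inv y transpose_mat)
qed

abbreviation dg where "dg \<equiv> fder g"

lemma g_has_derivative: "y \<in> D \<Longrightarrow> (g has_derivative dg y) (at y)"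
  using smooth_on_has_derivative smooth_g by blast

lemma dg_linear: "y \<in> D \<Longrightarrow> linear (dg y)"
  using smooth_on_imp_differentiable[OF smooth_g] linear_frechet_derivative by blast

lemma inner_g_has_derivative:
  "y \<in> D \<Longrightarrow> ((\<lambda>z. v \<bullet> (g z *v w)) has_derivative (\<lambda>x. v \<bullet> (dg y x *v w))) (at y)"
  using bounded_linear.has_derivative[OF bounded_linear_inner_right
    bounded_linear.has_derivative[OF bounded_bilinear.bounded_linear_left[OF bounded_bilinear_matrix_vector_mult] g_has_derivative]] .

lemma fder_inner_g: "y \<in> D \<Longrightarrow> fder (\<lambda>z. v \<bullet> (g z *v w)) y x = v \<bullet> (dg y x *v w)"
  by (simp add: fder_eqI[OF inner_g_has_derivative])

lemma dg_commute: "y \<in> D \<Longrightarrow> v \<bullet> (dg y x *v w) = w \<bullet> (dg y x *v v)"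
proof -
  assume y: "y \<in> D"
  have "fder (\<lambda>z. v \<bullet> (g z *v w)) y x = fder (\<lambda>z. w \<bullet> (g z *v v)) y x"
    using fder_cong_open[OF open_D y, of "\<lambda>z. v \<bullet> (g z *v w)" "\<lambda>z. w \<bullet> (g z *v v)"] g_commute by simp
  then show ?thesis by (simp add: fder_inner_g y)
qed

lemma dg_sum_axis: "y \<in> D \<Longrightarrow> (\<Sum>l\<in>UNIV. z $ l * (v \<bullet> (dg y (axis l 1) *v w))) = v \<bullet> (dg y z *v w)"
proof -
  assume y: "y \<in> D"
  have "linear (\<lambda>z. v \<bullet> (dg y z *v w))"
    using bounded_linear.linear[OF has_derivative_bounded_linear[OF inner_g_has_derivative[OF y]]] .
  from linear_axis_expansion[OF this, of z] show ?thesis by simp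
qed

text \<open>Koszul's formula for coordinate fields: pairing with \<open>g\<close> removes the
  inverse matrix. Symmetry, linearity and metric compatibility are read off from it, with
  \<open>g_eqI\<close> to conclude.\<close>

lemma chr_inner:
  assumes y: "y \<in> D"
  shows "z \<bullet> (g y *v chr g y v w) = (w \<bullet> (dg y v *v z) + v \<bullet> (dg y w *v z) - v \<bullet> (dg y z *v w)) / 2"
proof -
  have ax: "(\<Sum>l\<in>UNIV. z $ l * (a \<bullet> (B *v axis l 1))) = a \<bullet> (B *v z)" for a :: "real^'m" and B :: "real^'m^'m"
  proof -
    have "linear (\<lambda>z. a \<bullet> (B *v z))"
      by (rule linearI) (simp_all add: matrix_vector_right_distrib inner_add_right matrix_vector_mult_scaleR)
    from linear_axis_expansion[OF this, of z] show ?thesis by simp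
  qed
  have "z \<bullet> (g y *v chr g y v w) = (\<Sum>l\<in>UNIV. z $ l * (w \<bullet> (dg y v *v axis l 1) + v \<bullet> (dg y w *v axis l 1) - v \<bullet> (dg y (axis l 1) *v w))) / 2"
    by (simp add: chr_def matrix_vector_mult_scaleR g_inv_mv y fder_inner_g inner_vec_def[of z])
  also have "\<dots> = (w \<bullet> (dg y v *v z) + v \<bullet> (dg y w *v z) - v \<bullet> (dg y z *v w)) / 2"
    by (simp add: algebra_simps sum.distrib sum_subtractf ax dg_sum_axis y)
  finally show ?thesis .
qed

lemma chr_commute: "y \<in> D \<Longrightarrow> chr g y v w = chr g y w v"
  by (rule g_eqI) (auto simp: chr_inner dg_commute[of y w _ v])

lemma chr_linear: "y \<in> D \<Longrightarrow> linear (chr g y v)"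
proof (rule linearI)
  fix a b :: "real^'m" and r :: real
  assume y: "y \<in> D"
  note lin = linear_add[OF dg_linear[OF y]] linear_scale[OF dg_linear[OF y]]
  show "chr g y v (a + b) = chr g y v a + chr g y v b"
    by (rule g_eqI[OF y]) (auto simp: chr_inner[OF y] lin inner_add_left inner_add_right
      matrix_vector_mult_add_rdistrib matrix_vector_right_distrib field_simps)
  show "chr g y v (r *\<^sub>R a) = r *\<^sub>R chr g y v a"
    by (rule g_eqI[OF y]) (auto simp: chr_inner[OF y] lin
      matrix_vector_mult_scaleR scaleR_matrix_vector_assoc[symmetric] field_simps)
qed

lemma chr_linear_left: "y \<in> D \<Longrightarrow> linear (\<lambda>v. chr g y v w)"
proof -
  assume y: "y \<in> D"
  have "(\<lambda>v. chr g y v w) = chr g y w" by (rule ext) (rule chr_commute[OF y])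
  then show ?thesis using chr_linear[OF y] by metis
qed

text \<open>In the sum of the two Koszul formulas all derivatives of \<open>g\<close> cancel except
  the one along \<open>x\<close>.\<close>

lemma metric_compatible:
  "y \<in> D \<Longrightarrow> v \<bullet> (dg y x *v w) = chr g y x v \<bullet> (g y *v w) + v \<bullet> (g y *v chr g y x w)"
  using chr_inner[of y w x v] chr_inner[of y v x w] dg_commute[of y w x v] dg_commute[of y w v x]
    dg_commute[of y v w x] g_commute[of y "chr g y x v" w]
  by (simp add: field_simps)

lemma trace_chr: "y \<in> D \<Longrightarrow> trace (matrix (chr g y v)) = (\<Sum>i\<in>UNIV. chr g y (axis i 1) v $ i)"
  by (simp add: trace_def matrix_def chr_commute[of y v "axis _ _"])

lemma dg_matrix:
  assumes y: "y \<in> D"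
  shows "dg y x = transpose (matrix (chr g y x)) ** g y + g y ** matrix (chr g y x)"
proof -
  let ?C = "matrix (chr g y x)"
  have C: "?C *v v = chr g y x v" for v
    by (rule fun_cong[OF matrix_vector_mul(2)[OF chr_linear[OF y]]])
  have "v \<bullet> (dg y x *v w) = v \<bullet> ((transpose ?C ** g y + g y ** ?C) *v w)" for v w
  proof -
    have "v \<bullet> (transpose ?C *v (g y *v w)) = chr g y x v \<bullet> (g y *v w)"
      using inner_transpose_matrix[of ?C "g y *v w" v] C by (simp add: inner_commute)
    then show ?thesis
      by (simp add: metric_compatible y matrix_vector_mult_add_rdistrib inner_add_right
        matrix_vector_mul_assoc[symmetric] C del: transpose_matrix_vector)
  qed
  then have "dg y x *v w = (transpose ?C ** g y + g y ** ?C) *v w" for w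
    using vector_eq_ldot[of "dg y x *v w"] by auto
  then show ?thesis by (simp add: matrix_eq)
qed

text \<open>By \<open>dg_matrix\<close> the derivative of \<open>g\<close> splits into a left and a
  right multiple of \<open>g\<close>. Jacobi's formula gives the same trace for both, and the factor
  2 is absorbed by the square root.\<close>

lemma sqrt_det_has_derivative:
  assumes y: "y \<in> D"
  shows "((\<lambda>z. sqrt (det (g z))) has_derivative (\<lambda>x. trace (matrix (chr g y x)) * sqrt (det (g y)))) (at y)"
proof -
  have "((\<lambda>z. det (g z)) has_derivative (\<lambda>x. fder det (g y) (dg y x))) (at y)"
    by (rule has_derivative_compose[OF g_has_derivative[OF y] det_fder])
  moreover have "fder det (g y) (dg y x) = 2 * trace (matrix (chr g y x)) * det (g y)" for x
  proof -
    have "linear (fder det (g y))"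
      using det_has_derivative by (intro linear_frechet_derivative) (auto simp: differentiable_def)
    then show ?thesis
      by (simp add: dg_matrix[OF y] linear_add fder_det_mult_left fder_det_mult_right trace_transpose)
  qed
  ultimately have "((\<lambda>z. det (g z)) has_derivative (\<lambda>x. 2 * trace (matrix (chr g y x)) * det (g y))) (at y)"
    by simp
  from has_derivative_real_sqrt[OF det_g[OF y] this]
  show ?thesis
    by (rule has_derivative_eq_rhs) (use det_g[OF y] in \<open>auto simp: fun_eq_iff field_simps\<close>)
qed

end

section \<open>Maps between coordinate domains\<close>

locale local_map = S: metric_field D g + T: metric_field E h
  for D :: "(real^'m::finite) set" and g and E :: "(real^'n::finite) set" and h +
  fixes f :: "real^'m \<Rightarrow> real^'n"
  assumes smooth_f: "smooth_on D f" and f_mem: "y \<in> D \<Longrightarrow> f y \<in> E"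
    and surj_f: "y \<in> D \<Longrightarrow> surj (fder f y)"
begin

lemma f_has_derivative: "y \<in> D \<Longrightarrow> (f has_derivative fder f y) (at y)"
  using smooth_on_has_derivative smooth_f by blast

lemma df_linear: "y \<in> D \<Longrightarrow> linear (fder f y)"
  using smooth_on_imp_differentiable[OF smooth_f] linear_frechet_derivative by blast

abbreviation hess :: "real^'m \<Rightarrow> real^'m \<Rightarrow> real^'m \<Rightarrow> real^'n" where
  "hess y w v \<equiv> fder (\<lambda>z. fder f z v) y w"

lemma df_has_derivative: "y \<in> D \<Longrightarrow> ((\<lambda>z. fder f z v) has_derivative (\<lambda>w. hess y w v)) (at y)"
  using smooth_on_has_derivative[OF smooth_on_fder[OF smooth_f]] by auto

lemma hess_commute: "y \<in> D \<Longrightarrow> hess y w v = hess y v w"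
  using fder_symmetric[OF S.open_D _ smooth_f] by blast

lemma hess_linear_left: "y \<in> D \<Longrightarrow> linear (\<lambda>w. hess y w v)"
  using df_has_derivative has_derivative_linear by blast

lemma hess_linear: "y \<in> D \<Longrightarrow> linear (hess y w)"
proof -
  assume y: "y \<in> D"
  have "hess y w = (\<lambda>v. hess y v w)" by (rule ext) (rule hess_commute[OF y])
  then show ?thesis using hess_linear_left[OF y, of w] by simp
qed

text \<open>Point and vector both vary; along the axes the derivative of \<open>f\<close> is taken
  in fixed directions and the product rule applies.\<close>

lemma df_apply_has_derivative:
  assumes y: "y \<in> D" and X: "(X has_derivative X') (at y)"
  shows "((\<lambda>z. fder f z (X z)) has_derivative (\<lambda>w. hess y w (X y) + fder f y (X' w))) (at y)"
proof -
  have "((\<lambda>z. \<Sum>i\<in>UNIV. X z $ i *\<^sub>R fder f z (axis i 1)) has_derivative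
      (\<lambda>w. \<Sum>i\<in>UNIV. X y $ i *\<^sub>R hess y w (axis i 1) + X' w $ i *\<^sub>R fder f y (axis i 1))) (at y)"
    by (intro has_derivative_sum has_derivative_scaleR df_has_derivative y
        bounded_linear.has_derivative[OF bounded_linear_vec_nth] X)
  moreover have "(\<Sum>i\<in>UNIV. X y $ i *\<^sub>R hess y w (axis i 1) + X' w $ i *\<^sub>R fder f y (axis i 1))
      = hess y w (X y) + fder f y (X' w)" for w
    unfolding linear_axis_expansion[where L="hess y w" and z="X y", OF hess_linear[OF y]]
      linear_axis_expansion[OF df_linear[OF y], of "X' w"] by (simp add: sum.distrib)
  ultimately have "((\<lambda>z. \<Sum>i\<in>UNIV. X z $ i *\<^sub>R fder f z (axis i 1)) has_derivative
      (\<lambda>w. hess y w (X y) + fder f y (X' w))) (at y)" by simp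
  then show ?thesis
    by (rule has_derivative_transform_within_open[OF _ S.open_D y])
       (rule linear_axis_expansion[OF df_linear, symmetric])
qed

text \<open>The metric dual of the covector \<open>a \<circ> df\<close>; these vectors are exactly the horizontal ones.\<close>

definition hv :: "real^'m \<Rightarrow> real^'n \<Rightarrow> real^'m" where
  "hv y a = matrix_inv (g y) *v (transpose (matrix (fder f y)) *v a)"

lemma inner_hv: "y \<in> D \<Longrightarrow> v \<bullet> (g y *v hv y a) = fder f y v \<bullet> a"
proof -
  assume y: "y \<in> D"
  have "v \<bullet> (g y *v hv y a) = a \<bullet> (matrix (fder f y) *v v)"
    using inner_transpose_matrix[of "matrix (fder f y)" a v]
    by (simp add: hv_def S.g_inv_mv y inner_commute del: transpose_matrix_vector)
  then show ?thesis
    using fun_cong[OF matrix_vector_mul(2)[OF df_linear[OF y]], of v] by (simp add: inner_commute)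
qed

lemma hv_linear: "linear (hv y)"
  unfolding hv_def by (rule linearI)
    (simp_all add: matrix_vector_right_distrib matrix_vector_mult_scaleR del: transpose_matrix_vector)

lemma smooth_hv:
  assumes "open W" "W \<subseteq> D" "smooth_on W b"
  shows "smooth_on W (\<lambda>z. hv z (b z))"
  unfolding hv_def
proof (intro smooth_on_matrix_vector_mult assms(1,3))
  show "smooth_on W (\<lambda>z. matrix_inv (g z))" using smooth_on_subset[OF S.smooth_inv_g assms(2)] .
  show "smooth_on W (\<lambda>z. transpose (matrix (fder f z)))"
    by (intro smooth_on_vecI assms(1))
       (auto simp: transpose_def matrix_def intro!: smooth_on_vec_nth assms smooth_on_fder smooth_on_subset[OF smooth_f assms(2)])
qed

definition hor :: "real^'m \<Rightarrow> (real^'m) set" where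
  "hor y = {X. \<forall>v. fder f y v = 0 \<longrightarrow> X \<bullet> (g y *v v) = 0}"

lemma hv_hor: "y \<in> D \<Longrightarrow> hv y a \<in> hor y"
  unfolding hor_def using inner_hv S.g_commute by (auto simp: S.g_commute[of y "hv y a"])

lemma df_hv_inner: "y \<in> D \<Longrightarrow> fder f y (hv y a) \<bullet> b = hv y a \<bullet> (g y *v hv y b)"
  using inner_hv by simp

text \<open>This map is the differential composed with its metric adjoint. If it sends
  \<open>a\<close> to 0, then \<open>hv y a\<close> has length 0, so \<open>a\<close> is orthogonal
  to the image of the differential, which is everything.\<close>

lemma bij_df_hv: "y \<in> D \<Longrightarrow> bij (\<lambda>a. fder f y (hv y a))"
proof -
  assume y: "y \<in> D"
  have lin: "linear (\<lambda>a. fder f y (hv y a))"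
    using linear_compose[OF hv_linear df_linear[OF y]] by (simp add: o_def)
  have "a = 0" if "fder f y (hv y a) = 0" for a
  proof -
    have "hv y a \<bullet> (g y *v hv y a) = 0" using df_hv_inner[OF y, of a a] that by simp
    then have "hv y a = 0" using S.pos_g[OF y, of "hv y a"] by (metis less_irrefl)
    then have "fder f y v \<bullet> a = 0" for v using inner_hv[OF y, of v a] by simp
    then have "a \<bullet> a = 0" using surj_f[OF y] by (metis surjD)
    then show ?thesis by simp
  qed
  then have "inj (\<lambda>a. fder f y (hv y a))" using linear_injective_0[OF lin] by blast
  then show ?thesis using linear_injective_imp_surjective[OF lin] by (simp add: bij_def)
qed

lemma hor_decomp: "y \<in> D \<Longrightarrow> \<exists>a v. X = hv y a + v \<and> fder f y v = 0"
proof -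
  assume y: "y \<in> D"
  obtain a where "fder f y X = fder f y (hv y a)"
    using bij_is_surj[OF bij_df_hv[OF y]] by (metis surjD)
  then have "fder f y (X - hv y a) = 0" by (simp add: linear_diff[OF df_linear[OF y]])
  then show ?thesis by (intro exI[of _ a] exI[of _ "X - hv y a"]) simp
qed

text \<open>The vertical remainder in \<open>hor_decomp\<close> is here also horizontal, hence
  orthogonal to itself.\<close>

lemma hor_imp_hv: "y \<in> D \<Longrightarrow> X \<in> hor y \<Longrightarrow> \<exists>a. X = hv y a"
proof -
  assume y: "y \<in> D" and X: "X \<in> hor y"
  obtain a v where a: "X = hv y a + v" "fder f y v = 0" using hor_decomp[OF y] by blast
  have "v \<bullet> (g y *v v) = X \<bullet> (g y *v v) - hv y a \<bullet> (g y *v v)"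
    by (simp add: a(1) inner_add_left)
  also have "\<dots> = 0" using X hv_hor[OF y, of a] a(2) by (simp add: hor_def)
  finally have "v = 0" using S.pos_g[OF y, of v] by (metis less_irrefl)
  then show ?thesis using a by auto
qed

text \<open>\<open>sff\<close> is the second fundamental form \<open>\<nabla>df\<close>.\<close>

definition sff :: "real^'m \<Rightarrow> real^'m \<Rightarrow> real^'m \<Rightarrow> real^'n" where
  "sff y w v = hess y w v - fder f y (chr g y w v) + chr h (f y) (fder f y w) (fder f y v)"

definition tension :: "real^'m \<Rightarrow> real^'n" where
  "tension y = (\<Sum>i\<in>UNIV. \<Sum>j\<in>UNIV. matrix_inv (g y) $ i $ j *\<^sub>R sff y (axis i 1) (axis j 1))"

lemma sff_commute: "y \<in> D \<Longrightarrow> sff y w v = sff y v w"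
  unfolding sff_def using hess_commute S.chr_commute T.chr_commute[OF f_mem] by metis

lemma sff_linear: "y \<in> D \<Longrightarrow> linear (sff y w)"
proof -
  assume y: "y \<in> D"
  have "linear (\<lambda>v. fder f y (chr g y w v))"
    using linear_compose[OF S.chr_linear[OF y] df_linear[OF y]] by (simp add: o_def)
  moreover have "linear (\<lambda>v. chr h (f y) (fder f y w) (fder f y v))"
    using linear_compose[OF df_linear[OF y] T.chr_linear[OF f_mem[OF y]]] by (simp add: o_def)
  ultimately show ?thesis
    unfolding sff_def[abs_def] by (intro linear_compose_add linear_compose_sub hess_linear[OF y])
qed

text \<open>Obtained by differentiating \<open>inner_hv\<close> along \<open>w\<close> with
  \<open>v\<close> held constant; metric compatibility absorbs the derivative of \<open>g\<close>.
  It expresses the covariant derivative of a horizontal field through the second derivatives of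
  \<open>f\<close>.\<close>

lemma covariant_deriv_hv:
  assumes W: "open W" "W \<subseteq> D" "y \<in> W" and sm: "smooth_on W Y" "smooth_on W b"
    and Y: "\<And>z. z \<in> W \<Longrightarrow> Y z = hv z (b z)"
  shows "v \<bullet> (g y *v (fder Y y w + chr g y w (Y y)))
    = (hess y w v - fder f y (chr g y w v)) \<bullet> b y + fder f y v \<bullet> fder b y w"
proof -
  have y: "y \<in> D" using W by blast
  have "((\<lambda>z. v \<bullet> (g z *v Y z)) has_derivative (\<lambda>w. v \<bullet> (g y *v fder Y y w + S.dg y w *v Y y))) (at y)"
    by (rule bounded_linear.has_derivative[OF bounded_linear_inner_right
        bounded_bilinear.FDERIV[OF bounded_bilinear_matrix_vector_mult S.g_has_derivative[OF y]
        smooth_on_has_derivative[OF sm(1) W(3)]]])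
  moreover have "((\<lambda>z. v \<bullet> (g z *v Y z)) has_derivative (\<lambda>w. fder f y v \<bullet> fder b y w + hess y w v \<bullet> b y)) (at y)"
    by (rule has_derivative_transform_within_open[OF bounded_bilinear.FDERIV[OF bounded_bilinear_inner
        df_has_derivative[OF y] smooth_on_has_derivative[OF sm(2) W(3)]] W(1,3)])
       (use Y inner_hv W in \<open>auto\<close>)
  ultimately have "v \<bullet> (g y *v fder Y y w + S.dg y w *v Y y) = fder f y v \<bullet> fder b y w + hess y w v \<bullet> b y"
    by (rule has_derivative_unique[THEN fun_cong])
  moreover have "chr g y w v \<bullet> (g y *v Y y) = fder f y (chr g y w v) \<bullet> b y"
    using inner_hv[OF y] Y[OF W(3)] by simp
  ultimately show ?thesis
    using S.metric_compatible[OF y, of v w "Y y"]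
    by (simp add: inner_add_right inner_diff_left matrix_vector_right_distrib)
qed

text \<open>The connection is torsion free, so the bracket is a difference of covariant derivatives.
  For vertical \<open>v\<close> the term with the derivative of the covector drops out of
  \<open>covariant_deriv_hv\<close>, and so does the target connection in
  \<open>sff\<close>.\<close>

lemma inner_bracket:
  assumes W: "open W" "W \<subseteq> D" "y \<in> W"
    and sm: "smooth_on W X" "smooth_on W Y" "smooth_on W a" "smooth_on W b"
    and X: "\<And>z. z \<in> W \<Longrightarrow> X z = hv z (a z)" and Y: "\<And>z. z \<in> W \<Longrightarrow> Y z = hv z (b z)"
    and v: "fder f y v = 0"
  shows "v \<bullet> (g y *v lie_bracket X Y y) = b y \<bullet> sff y (X y) v - a y \<bullet> sff y (Y y) v"
proof -
  have y: "y \<in> D" using W by blast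
  have "chr h (f y) w 0 = 0" for w
    using linear_0[OF T.chr_linear[OF f_mem[OF y]]] .
  then have sff: "sff y w v = hess y w v - fder f y (chr g y w v)" for w
    by (simp add: sff_def v)
  have "v \<bullet> (g y *v (fder Y y (X y) + chr g y (X y) (Y y))) = b y \<bullet> sff y (X y) v"
    using covariant_deriv_hv[OF W sm(2,4) Y, of v "X y"] by (simp add: v sff inner_commute)
  moreover have "v \<bullet> (g y *v (fder X y (Y y) + chr g y (Y y) (X y))) = a y \<bullet> sff y (Y y) v"
    using covariant_deriv_hv[OF W sm(1,3) X, of v "Y y"] by (simp add: v sff inner_commute)
  moreover have "chr g y (Y y) (X y) = chr g y (X y) (Y y)" by (rule S.chr_commute[OF y])
  ultimately show ?thesis
    by (simp add: lie_bracket_def matrix_vector_right_distrib inner_add_right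
        matrix_vector_mult_diff_distrib inner_diff_right)
qed

text \<open>The pointwise condition through which the two sides of the final equivalence are
  compared: brackets are linked to it by \<open>inner_bracket\<close>, the codifferential by
  \<open>vcodiff_eq\<close>.\<close>

definition sff_symmetric :: "real^'m \<Rightarrow> bool" where
  "sff_symmetric y \<longleftrightarrow> (\<forall>v a b. fder f y v = 0 \<longrightarrow> b \<bullet> sff y (hv y a) v = a \<bullet> sff y (hv y b) v)"

text \<open>The fields \<open>hv z a\<close> with constant \<open>a\<close> suffice as tests: they
  are smooth and horizontal, and their values at \<open>y\<close> exhaust the horizontal
  space.\<close>

lemma involutive_imp_sff_symmetric:
  assumes y: "y \<in> D"
    and inv: "\<And>X Y. smooth_on D X \<Longrightarrow> smooth_on D Y \<Longrightarrow> (\<And>z. z \<in> D \<Longrightarrow> X z \<in> hor z \<and> Y z \<in> hor z)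
      \<Longrightarrow> lie_bracket X Y y \<in> hor y"
  shows "sff_symmetric y"
  unfolding sff_symmetric_def
proof (intro allI impI)
  fix v a b assume v: "fder f y v = 0"
  let ?X = "\<lambda>z. hv z a" and ?Y = "\<lambda>z. hv z b"
  have sm: "smooth_on D ?X" "smooth_on D ?Y"
    by (auto intro!: smooth_hv[OF S.open_D] smooth_on_const)
  have "lie_bracket ?X ?Y y \<in> hor y" using inv[OF sm] hv_hor by blast
  then have "v \<bullet> (g y *v lie_bracket ?X ?Y y) = 0"
    using v S.g_commute[OF y, of v] by (simp add: hor_def)
  then show "b \<bullet> sff y (hv y a) v = a \<bullet> sff y (hv y b) v"
    using inner_bracket[OF S.open_D order_refl y sm smooth_on_const smooth_on_const _ _ v, of a b] by simp
qed

text \<open>Turns a divergence written with components into a contraction with the inverse metric,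
  the form in which \<open>tension\<close> is defined.\<close>

lemma trace_covariant:
  assumes y: "y \<in> D"
  shows "(\<Sum>i\<in>UNIV. N i $ i) = (\<Sum>i\<in>UNIV. \<Sum>j\<in>UNIV. matrix_inv (g y) $ i $ j * (axis j 1 \<bullet> (g y *v N i)))"
proof -
  have "N i $ i = (\<Sum>j\<in>UNIV. matrix_inv (g y) $ i $ j * (axis j 1 \<bullet> (g y *v N i)))" for i
  proof -
    have "N i $ i = (matrix_inv (g y) *v (g y *v N i)) $ i" by (simp add: S.g_inv_mv y)
    then show ?thesis by (simp add: matrix_vector_mult_def[of "matrix_inv (g y)"] inner_axis')
  qed
  then show ?thesis by simp
qed

lemma inv_g_sym: "y \<in> D \<Longrightarrow> matrix_inv (g y) $ i $ j = matrix_inv (g y) $ j $ i"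
  using arg_cong[OF S.sym_inv_g[of y], of "\<lambda>M. M $ i $ j"] by (simp add: transpose_def)

lemma sum_inv_g_commute:
  assumes y: "y \<in> D"
  shows "(\<Sum>i\<in>UNIV. \<Sum>j\<in>UNIV. matrix_inv (g y) $ i $ j * P i j) = (\<Sum>i\<in>UNIV. \<Sum>j\<in>UNIV. matrix_inv (g y) $ i $ j * P j i)"
  by (subst sum.swap) (intro sum.cong refl arg_cong2[of _ _ _ _ "(*)"] inv_g_sym[OF y])

text \<open>
  The left-hand side is the Euler--Lagrange expression of the \<open>F\<close>-energy, tested against the constant
  vector \<open>w\<close>; \<open>P\<close> plays the role of \<open>F' (|df|\<^sup>2 / 2)\<close>.
\<close>

lemma euler_lagrange_tension:
  assumes y: "y \<in> D" and P: "(P has_derivative P') (at y)" and hor: "\<And>a. P' (hv y a) = 0"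
  shows "(\<Sum>i\<in>UNIV. fder (\<lambda>z. P z * sqrt (det (g z)) * hv z (h (f z) *v w) $ i) y (axis i 1))
     - P y * sqrt (det (g y)) * ((\<Sum>i\<in>UNIV. \<Sum>j\<in>UNIV. matrix_inv (g y) $ i $ j *
          (fder f y (axis i 1) \<bullet> (T.dg (f y) w *v fder f y (axis j 1)))) / 2)
   = P y * sqrt (det (g y)) * (tension y \<bullet> (h (f y) *v w))"
proof -
  let ?G = "\<lambda>i j. matrix_inv (g y) $ i $ j" and ?A = "\<lambda>i. fder f y (axis i 1)" and ?s = "sqrt (det (g y))"
  define b where "b z = h (f z) *v w" for z
  define Y where "Y z = hv z (b z)" for z
  have smb: "smooth_on D b" unfolding b_def
    by (intro smooth_on_matrix_vector_mult S.open_D smooth_on_const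
        smooth_on_compose[OF S.open_D T.open_D T.smooth_g smooth_f]) (auto intro: f_mem)
  have smY: "smooth_on D Y" unfolding Y_def by (intro smooth_hv S.open_D smb) auto
  have db: "(b has_derivative (\<lambda>v. T.dg (f y) (fder f y v) *v w)) (at y)"
    unfolding b_def
    by (intro bounded_linear.has_derivative[OF bounded_bilinear.bounded_linear_left[OF bounded_bilinear_matrix_vector_mult]]
       has_derivative_compose[OF f_has_derivative[OF y] T.g_has_derivative[OF f_mem[OF y]]])
  have dY: "(Y has_derivative fder Y y) (at y)" using smooth_on_has_derivative[OF smY y] .
  have der: "((\<lambda>z. P z * sqrt (det (g z)) * Y z $ i) has_derivative
      (\<lambda>v. P y * ?s * fder Y y v $ i + (P y * (trace (matrix (chr g y v)) * ?s) + P' v * ?s) * Y y $ i)) (at y)" for i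
    by (intro has_derivative_mult P S.sqrt_det_has_derivative[OF y]
        bounded_linear.has_derivative[OF bounded_linear_vec_nth dY])
  \<comment> \<open>The only place where \<open>P\<close> is differentiated along \<open>Y\<close>;
    \<open>Y\<close> is horizontal and \<open>P\<close> is constant in horizontal
    directions.\<close>
  have P'Y: "(\<Sum>i\<in>UNIV. P' (axis i 1) * Y y $ i) = 0"
    using linear_axis_expansion[OF has_derivative_linear[OF P], of "Y y"] hor
    by (simp add: Y_def mult.commute)
  \<comment> \<open>The derivative of the volume density supplies the Christoffel term that
    completes the coordinate divergence of \<open>Y\<close> to the covariant one.\<close>
  have trY: "(\<Sum>i\<in>UNIV. trace (matrix (chr g y (axis i 1))) * Y y $ i) = (\<Sum>i\<in>UNIV. chr g y (axis i 1) (Y y) $ i)"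
  proof -
    have lin: "linear (\<lambda>v. trace (matrix (chr g y v)))"
      unfolding trace_def matrix_def using S.chr_linear_left[OF y]
      by (intro linearI) (simp_all add: linear_add[OF S.chr_linear_left[OF y]]
          linear_scale[OF S.chr_linear_left[OF y]] sum.distrib sum_distrib_left)
    show ?thesis
      using linear_axis_expansion[OF lin, of "Y y"] S.trace_chr[OF y, of "Y y"] by (simp add: mult.commute)
  qed
  have N: "axis j 1 \<bullet> (g y *v (fder Y y (axis i 1) + chr g y (axis i 1) (Y y)))
      = sff y (axis i 1) (axis j 1) \<bullet> b y + ?A j \<bullet> (h (f y) *v chr h (f y) (?A i) w)" for i j
  proof -
    have "fder b y (axis i 1) = T.dg (f y) (?A i) *v w" using fder_eqI[OF db] by simp
    then show ?thesis
      using covariant_deriv_hv[OF S.open_D order_refl y smY smb, of "axis j 1" "axis i 1"]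
        T.metric_compatible[OF f_mem[OF y], of "?A j" "?A i" w]
      by (simp add: Y_def sff_def b_def inner_add_left inner_diff_left)
  qed
  have "(\<Sum>i\<in>UNIV. fder (\<lambda>z. P z * sqrt (det (g z)) * Y z $ i) y (axis i 1))
      = (\<Sum>i\<in>UNIV. P y * ?s * fder Y y (axis i 1) $ i) + P y * ?s * (\<Sum>i\<in>UNIV. trace (matrix (chr g y (axis i 1))) * Y y $ i)
       + ?s * (\<Sum>i\<in>UNIV. P' (axis i 1) * Y y $ i)"
    unfolding fder_eqI[OF der] by (simp add: sum.distrib sum_distrib_left algebra_simps)
  also have "\<dots> = P y * ?s * (\<Sum>i\<in>UNIV. (fder Y y (axis i 1) + chr g y (axis i 1) (Y y)) $ i)"
    unfolding P'Y trY by (simp add: sum.distrib sum_distrib_left algebra_simps)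
  also have "(\<Sum>i\<in>UNIV. (fder Y y (axis i 1) + chr g y (axis i 1) (Y y)) $ i)
      = (\<Sum>i\<in>UNIV. \<Sum>j\<in>UNIV. ?G i j * (sff y (axis i 1) (axis j 1) \<bullet> b y + ?A j \<bullet> (h (f y) *v chr h (f y) (?A i) w)))"
    unfolding trace_covariant[OF y] N ..
  also have "\<dots> = tension y \<bullet> b y + (\<Sum>i\<in>UNIV. \<Sum>j\<in>UNIV. ?G i j * (?A j \<bullet> (h (f y) *v chr h (f y) (?A i) w)))"
    by (simp add: tension_def inner_sum_left distrib_left sum.distrib)
  finally have 1: "(\<Sum>i\<in>UNIV. fder (\<lambda>z. P z * sqrt (det (g z)) * Y z $ i) y (axis i 1))
    = P y * ?s * (tension y \<bullet> b y + (\<Sum>i\<in>UNIV. \<Sum>j\<in>UNIV. ?G i j * (?A j \<bullet> (h (f y) *v chr h (f y) (?A i) w))))" .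
  \<comment> \<open>Metric compatibility in the target gives two Christoffel terms that agree after
    contraction with the symmetric inverse metric; hence the factor 1/2 in the statement.\<close>
  have "?A i \<bullet> (T.dg (f y) w *v ?A j) = ?A j \<bullet> (h (f y) *v chr h (f y) (?A i) w) + ?A i \<bullet> (h (f y) *v chr h (f y) (?A j) w)" for i j
    using T.metric_compatible[OF f_mem[OF y], of "?A i" w "?A j"]
      T.g_commute[OF f_mem[OF y], of "chr h (f y) w (?A i)" "?A j"]
    by (simp add: T.chr_commute[OF f_mem[OF y], of w])
  then have "(\<Sum>i\<in>UNIV. \<Sum>j\<in>UNIV. ?G i j * (?A i \<bullet> (T.dg (f y) w *v ?A j)))
     = (\<Sum>i\<in>UNIV. \<Sum>j\<in>UNIV. ?G i j * (?A j \<bullet> (h (f y) *v chr h (f y) (?A i) w)))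
      + (\<Sum>i\<in>UNIV. \<Sum>j\<in>UNIV. ?G i j * (?A i \<bullet> (h (f y) *v chr h (f y) (?A j) w)))"
    by (simp add: distrib_left sum.distrib)
  also have "\<dots> = 2 * (\<Sum>i\<in>UNIV. \<Sum>j\<in>UNIV. ?G i j * (?A j \<bullet> (h (f y) *v chr h (f y) (?A i) w)))"
    unfolding sum_inv_g_commute[OF y, of "\<lambda>i j. ?A i \<bullet> (h (f y) *v chr h (f y) (?A j) w)"] by simp
  finally show ?thesis using 1 unfolding Y_def b_def by (simp add: algebra_simps)
qed

end

text \<open>\<open>l\<close> is the square of the dilation.\<close>

locale conformal_map = local_map D g E h f
  for D :: "(real^'m::finite) set" and g and E :: "(real^'n::finite) set" and h f +
  fixes l :: "real^'m \<Rightarrow> real"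
  assumes smooth_l: "smooth_on D l" and l_pos: "y \<in> D \<Longrightarrow> l y > 0"
    and conformal: "y \<in> D \<Longrightarrow> X \<in> hor y \<Longrightarrow> Y \<in> hor y \<Longrightarrow>
      fder f y X \<bullet> (h (f y) *v fder f y Y) = l y * (X \<bullet> (g y *v Y))"
begin

text \<open>Conformality tested against vectors \<open>hv y a\<close>, whose images fill the target.
  In other words, the differential times its metric adjoint is \<open>l\<close> times the inverse
  target metric.\<close>

lemma h_df_hv: "y \<in> D \<Longrightarrow> h (f y) *v fder f y (hv y b) = l y *\<^sub>R b"
proof -
  assume y: "y \<in> D"
  have "p \<bullet> (h (f y) *v fder f y (hv y b)) = p \<bullet> (l y *\<^sub>R b)" for p
  proof -
    obtain a where p: "p = fder f y (hv y a)" using bij_is_surj[OF bij_df_hv[OF y]] by (metis surjD)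
    show ?thesis
      using conformal[OF y hv_hor[OF y] hv_hor[OF y], of a b] by (simp add: p df_hv_inner[OF y])
  qed
  then show ?thesis using vector_eq_ldot by blast
qed

text \<open>The derivative of \<open>h_df_hv\<close> along an arbitrary \<open>w\<close>. The
  derivative of \<open>h\<close> becomes target Christoffel terms by metric compatibility, the
  derivative of \<open>hv z b\<close> is rewritten by \<open>covariant_deriv_hv\<close>, and the
  pieces assemble into two values of \<open>sff\<close>.\<close>

lemma deriv_conformal:
  assumes y: "y \<in> D"
  shows "l y * (a \<bullet> sff y w (hv y b) + b \<bullet> sff y w (hv y a)) = fder l y w * (fder f y (hv y a) \<bullet> b)"
proof -
  let ?X = "\<lambda>z. hv z b" and ?Y = "hv y a"
  let ?p = "fder f y ?Y" and ?q = "fder f y (hv y b)"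
  have smX: "smooth_on D ?X" by (intro smooth_hv S.open_D smooth_on_const) auto
  \<comment> \<open>\<open>?p\<close> is frozen at \<open>y\<close>; only the metric and the second
    vector are differentiated. By \<open>h_df_hv\<close> the same function is a constant multiple of
    \<open>l\<close>.\<close>
  have "((\<lambda>z. ?p \<bullet> (h (f z) *v fder f z (?X z))) has_derivative
     (\<lambda>w. ?p \<bullet> (h (f y) *v (hess y w (?X y) + fder f y (fder ?X y w)) + T.dg (f y) (fder f y w) *v fder f y (?X y)))) (at y)"
    by (rule bounded_linear.has_derivative[OF bounded_linear_inner_right
        bounded_bilinear.FDERIV[OF bounded_bilinear_matrix_vector_mult
        has_derivative_compose[OF f_has_derivative[OF y] T.g_has_derivative[OF f_mem[OF y]]]
        df_apply_has_derivative[OF y smooth_on_has_derivative[OF smX y]]]])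
  moreover have "((\<lambda>z. ?p \<bullet> (h (f z) *v fder f z (?X z))) has_derivative (\<lambda>w. fder l y w * (?p \<bullet> b))) (at y)"
    by (rule has_derivative_transform_within_open[OF
        bounded_linear.has_derivative[OF bounded_linear_mult_left smooth_on_has_derivative[OF smooth_l y]] S.open_D y])
      (simp add: h_df_hv)
  ultimately have "?p \<bullet> (h (f y) *v (hess y w (?X y) + fder f y (fder ?X y w)) + T.dg (f y) (fder f y w) *v fder f y (?X y))
      = fder l y w * (?p \<bullet> b)"
    by (rule has_derivative_unique[THEN fun_cong])
  then have 1: "?p \<bullet> (h (f y) *v (hess y w (?X y) + fder f y (fder ?X y w))) + ?p \<bullet> (T.dg (f y) (fder f y w) *v ?q)
      = fder l y w * (?p \<bullet> b)"
    by (simp add: inner_add_right)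
  have 2: "?p \<bullet> (h (f y) *v x) = l y * (a \<bullet> x)" for x
    using T.g_commute[OF f_mem[OF y], of ?p x] h_df_hv[OF y, of a] by (simp add: inner_commute)
  have 3: "x \<bullet> (h (f y) *v ?q) = l y * (b \<bullet> x)" for x
    using h_df_hv[OF y, of b] by (simp add: inner_commute)
  have 4: "?p \<bullet> (T.dg (f y) (fder f y w) *v ?q)
     = l y * (b \<bullet> chr h (f y) (fder f y w) ?p + a \<bullet> chr h (f y) (fder f y w) ?q)"
    using T.metric_compatible[OF f_mem[OF y], of ?p "fder f y w" ?q] 2 3 by (simp add: distrib_left)
  have "fder f y (fder ?X y w) \<bullet> a + fder f y (chr g y w (?X y)) \<bullet> a = ?Y \<bullet> (g y *v (fder ?X y w + chr g y w (?X y)))"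
    using inner_hv[OF y, of "fder ?X y w + chr g y w (?X y)" a] S.g_commute[OF y, of _ ?Y]
    by (simp add: linear_add[OF df_linear[OF y]] inner_add_left)
  also have "\<dots> = (hess y w ?Y - fder f y (chr g y w ?Y)) \<bullet> b"
    using covariant_deriv_hv[OF S.open_D order_refl y smX smooth_on_const, of b ?Y w] by simp
  finally have 5: "a \<bullet> fder f y (fder ?X y w) = b \<bullet> (hess y w ?Y - fder f y (chr g y w ?Y)) - a \<bullet> fder f y (chr g y w (?X y))"
    by (simp add: inner_commute)
  show ?thesis
    using 1 unfolding 2 4 unfolding sff_def by (simp add: inner_add_right inner_diff_right 5 algebra_simps)
qed

text \<open>
  \<open>a \<bullet> sff y (hv y b) (hv y c)\<close> is symmetric in \<open>b\<close>, \<open>c\<close> and skew in \<open>a\<close>, \<open>c\<close>, hence zero.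
\<close>

lemma sff_hor_hor:
  assumes y: "y \<in> D" and dl: "\<And>c. fder l y (hv y c) = 0"
  shows "sff y (hv y b) (hv y c) = 0"
proof -
  define T where "T a b c = a \<bullet> sff y (hv y b) (hv y c)" for a b c
  have sym: "T a b c = T a c b" for a b c unfolding T_def using sff_commute[OF y] by metis
  have skew: "T a b c = - T c b a" for a b c
    using deriv_conformal[OF y, of a "hv y b" c] dl l_pos[OF y] by (simp add: T_def)
  \<comment> \<open>Alternating three skew exchanges with three symmetric ones returns to
    \<open>T a b c\<close> with the opposite sign.\<close>
  have "T a b c = 0" for a
    using skew[of a b c] sym[of c b a] skew[of c a b] sym[of b a c] skew[of b c a] sym[of a c b] by linarith
  then show ?thesis unfolding T_def using vector_eq_ldot[of "sff y (hv y b) (hv y c)" 0] by simp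
qed

lemma sff_symmetric_imp_involutive:
  assumes W: "open W" "W \<subseteq> D" "y \<in> W" and sm: "smooth_on W X" "smooth_on W Y"
    and hor: "\<And>z. z \<in> W \<Longrightarrow> X z \<in> hor z \<and> Y z \<in> hor z" and sff: "sff_symmetric y"
  shows "lie_bracket X Y y \<in> hor y"
proof -
  have y: "y \<in> D" using W by blast
  \<comment> \<open>By \<open>h_df_hv\<close> this formula recovers the covector behind a horizontal
    vector. Being explicit, it is smooth in the point, as \<open>inner_bracket\<close>
    requires.\<close>
  let ?c = "\<lambda>X z. inverse (l z) *\<^sub>R (h (f z) *v fder f z (X z))"
  have c: "X z = hv z (?c X z)" if zW: "z \<in> W" and Xz: "X z \<in> hor z" for X z
  proof -
    have z: "z \<in> D" using zW W by blast
    obtain a where "X z = hv z a" using hor_imp_hv[OF z Xz] by blast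
    then show ?thesis using h_df_hv[OF z, of a] l_pos[OF z] by simp
  qed
  have smc: "smooth_on W (?c X)" if "smooth_on W X" for X
  proof (intro smooth_on_scaleR smooth_on_matrix_vector_mult W(1) smooth_on_inverse)
    show "smooth_on W l" using smooth_on_subset[OF smooth_l W(2)] .
    show "l z \<noteq> 0" if "z \<in> W" for z using l_pos[of z] that W by auto
    show "smooth_on W (\<lambda>z. h (f z))"
      using W f_mem by (intro smooth_on_compose[OF W(1) T.open_D T.smooth_g] smooth_on_subset[OF smooth_f]) auto
    have "smooth_on W (\<lambda>z. \<Sum>i\<in>UNIV. X z $ i *\<^sub>R fder f z (axis i 1))"
      using W by (intro smooth_on_sum smooth_on_scaleR smooth_on_vec_nth that smooth_on_fder smooth_on_subset[OF smooth_f])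
    then show "smooth_on W (\<lambda>z. fder f z (X z))"
      by (rule smooth_on_cong[OF W(1), rotated]) (use W in \<open>auto intro!: linear_axis_expansion df_linear\<close>)
  qed
  have "v \<bullet> (g y *v lie_bracket X Y y) = 0" if v: "fder f y v = 0" for v
    using inner_bracket[OF W sm smc[OF sm(1)] smc[OF sm(2)] _ _ v] c hor W(3) sff v
    unfolding sff_symmetric_def by (metis cancel_comm_monoid_add_class.diff_cancel)
  then show ?thesis unfolding hor_def using S.g_commute[OF y] by auto
qed

end

section \<open>The pulled back volume form in coordinates\<close>

definition detl :: "(real^'n::finite) list \<Rightarrow> real" where
  "detl as = det (\<chi> i. as ! coord_index i)"

lemma coord_index_bij: "bij_betw (coord_index :: 'n::finite \<Rightarrow> nat) UNIV {..<CARD('n)}"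
proof -
  have "\<exists>b :: 'n \<Rightarrow> nat. bij_betw b UNIV {..<CARD('n)}"
    using ex_bij_betw_finite_nat[of "UNIV :: 'n set"] by (simp add: lessThan_atLeast0)
  then show ?thesis unfolding coord_index_def by (rule someI_ex)
qed

lemma coord_index_less: "coord_index (i :: 'n::finite) < CARD('n)"
  using coord_index_bij bij_betwE by blast

lemma coord_index_eq_iff: "coord_index i = coord_index j \<longleftrightarrow> i = (j :: 'n::finite)"
  using coord_index_bij by (metis bij_betw_imp_inj_on inj_eq)

lemma coord_index_surj: "j < CARD('n) \<Longrightarrow> \<exists>i :: 'n::finite. coord_index i = j"
  using coord_index_bij by (metis bij_betw_imp_surj_on imageE lessThan_iff)

lemma sum_coord_index: "(\<Sum>j<CARD('n). Q j) = (\<Sum>i\<in>UNIV. Q (coord_index (i :: 'n::finite)))"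
  by (rule sum.reindex_bij_betw[OF coord_index_bij, symmetric])

lemma detl_update:
  fixes as :: "(real^'n::finite) list"
  assumes "length as = CARD('n)"
  shows "detl (as[coord_index k := x]) = det (\<chi> i. if i = k then x else as ! coord_index i)"
  unfolding detl_def using assms
  by (intro arg_cong[of _ _ det]) (auto simp: vec_eq_iff nth_list_update coord_index_less coord_index_eq_iff)

lemma detl_linear:
  fixes as :: "(real^'n::finite) list"
  assumes "length as = CARD('n)" "j < CARD('n)"
  shows "linear (\<lambda>v. detl (as[j := v]))"
proof -
  obtain k :: 'n where "coord_index k = j" using coord_index_surj[OF assms(2)] by blast
  then have "detl (as[j := v]) = det (\<chi> i. if i = k then v else as ! coord_index i)" for v
    using detl_update[OF assms(1), of k v] by simp
  then show ?thesis
    using det_row_mul[of k _ "\<lambda>i. _" "\<lambda>i. as ! coord_index i"]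
    by (intro linearI) (simp_all add: det_row_add scalar_mult_eq_scaleR[symmetric])
qed

lemma detl_alternating:
  fixes as :: "(real^'n::finite) list"
  assumes "i \<noteq> j" "i < CARD('n)" "j < CARD('n)" "as ! i = as ! j"
  shows "detl as = 0"
proof -
  obtain k l :: 'n where "coord_index k = i" "coord_index l = j" using coord_index_surj assms by metis
  then show ?thesis unfolding detl_def using assms
    by (intro det_identical_rows[of k l]) (auto simp: row_def)
qed

lemma detl_zero:
  fixes as :: "(real^'n::finite) list"
  assumes "length as = CARD('n)" "j < CARD('n)" "as ! j = 0"
  shows "detl as = 0"
  using linear_0[OF detl_linear[OF assms(1,2)]] assms(3) list_update_id[of as j] by simp

text \<open>Polarisation: expand the vanishing determinant with x + y in both slots.\<close>

lemma detl_swap: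
  fixes as :: "(real^'n::finite) list"
  assumes "length as = CARD('n)" "i < CARD('n)" "j < CARD('n)" "i \<noteq> j"
  shows "detl (as[i := x, j := y]) = - detl (as[i := y, j := x])"
proof -
  have z: "detl (as[i := v, j := v]) = 0" for v
    using assms by (intro detl_alternating[of i j]) auto
  have add_j: "detl (bs[j := v + w]) = detl (bs[j := v]) + detl (bs[j := w])"
    if "length bs = CARD('n)" for bs :: "(real^'n) list" and v w
    using linear_add[OF detl_linear[OF that assms(3)]] .
  have add_i: "detl (as[i := v + w, j := u]) = detl (as[i := v, j := u]) + detl (as[i := w, j := u])" for v w u
    using linear_add[OF detl_linear[of "as[j := u]" i]] assms
    by (simp add: list_update_swap[of i j])
  have "detl (as[i := x + y, j := x + y]) = (detl (as[i := x, j := x]) + detl (as[i := x, j := y]))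
      + (detl (as[i := y, j := x]) + detl (as[i := y, j := y]))"
    unfolding add_i using assms by (simp add: add_j)
  then show ?thesis by (simp add: z)
qed

lemma detl_move:
  fixes xs :: "(real^'n::finite) list"
  assumes "length (xs @ x # ys @ zs) = CARD('n)"
  shows "detl (xs @ x # ys @ zs) = (-1) ^ length ys * detl (xs @ ys @ x # zs)"
  using assms
proof (induction ys arbitrary: xs)
  case (Cons y ys)
  have "detl (xs @ x # (y # ys) @ zs) = detl ((xs @ x # y # ys @ zs)[length xs := x, Suc (length xs) := y])"
    by (simp add: list_update_append)
  also have "\<dots> = - detl ((xs @ x # y # ys @ zs)[length xs := y, Suc (length xs) := x])"
    by (rule detl_swap) (use Cons.prems in auto)
  also have "\<dots> = - detl ((xs @ [y]) @ x # ys @ zs)"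
    by (simp add: list_update_append)
  also have "\<dots> = - ((-1) ^ length ys * detl ((xs @ [y]) @ ys @ x # zs))"
    using Cons.IH[of "xs @ [y]"] Cons.prems by simp
  finally show ?case by simp
qed simp

lemma sum_detl_update:
  fixes as :: "(real^'n::finite) list"
  assumes "length as = CARD('n)"
  shows "(\<Sum>j<CARD('n). detl (as[j := B *v (as ! j)])) = trace B * detl as"
  unfolding sum_coord_index detl_update[OF assms]
  using sum_det_replace_row[of B "\<lambda>i. as ! coord_index i"] by (simp add: detl_def cong: if_cong)

lemma detl_basis:
  fixes \<pi> :: "nat \<Rightarrow> 'n::finite"
  assumes "bij_betw \<pi> {..<CARD('n)} UNIV"
  shows "detl (map (\<lambda>k. axis (\<pi> k) 1) [0..<CARD('n)]) \<noteq> 0"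
proof -
  let ?p = "\<pi> \<circ> (coord_index :: 'n \<Rightarrow> nat)"
  have "bij ?p" by (rule bij_betw_trans[OF coord_index_bij assms])
  then have p: "?p permutes UNIV" by (intro bij_imp_permutes) auto
  have "detl (map (\<lambda>k. axis (\<pi> k) 1) [0..<CARD('n)]) = det (\<chi> i. (mat 1 :: real^'n^'n) $ ?p i)"
    unfolding detl_def
    by (intro arg_cong[of _ _ det]) (auto simp: vec_eq_iff coord_index_less mat_def axis_def)
  also have "\<dots> = of_int (sign ?p)" using det_permute_rows[OF p, of "mat 1"] by simp
  finally show ?thesis by (simp add: sign_def)
qed

lemma sum_symmetric_alternating:
  fixes S T :: "'i::finite \<Rightarrow> 'i \<Rightarrow> real"
  assumes "\<And>i j. S i j = S j i" "\<And>i j. T i j = - T j i"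
  shows "(\<Sum>i\<in>UNIV. \<Sum>j\<in>UNIV. S i j * T i j) = 0"
proof -
  have "(\<Sum>i\<in>UNIV. \<Sum>j\<in>UNIV. S i j * T i j) = (\<Sum>i\<in>UNIV. \<Sum>j\<in>UNIV. S j i * T j i)"
    by (rule sum.swap)
  also have "\<dots> = - (\<Sum>i\<in>UNIV. \<Sum>j\<in>UNIV. S i j * T i j)"
    unfolding sum_negf[symmetric]
  proof (intro sum.cong refl)
    fix i j show "S j i * T j i = - (S i j * T i j)" using assms[of j i] by simp
  qed
  finally show ?thesis by linarith
qed

text \<open>The cancellation behind closedness. \<open>T i j\<close> stands for a term in which
  entry \<open>i\<close> of a list is removed and entry \<open>j\<close> of the remaining list is
  modified. The pairs (i, j) with i \<le> j and (Suc j, i) concern the same two entries of the full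
  list in exchanged roles, and their signs are opposite.\<close>

lemma alternating_sum_removed_zero:
  fixes T :: "nat \<Rightarrow> nat \<Rightarrow> real"
  assumes "\<And>i j. i \<le> j \<Longrightarrow> j < n \<Longrightarrow> T i j = (-1) ^ (j - i) * T (Suc j) i"
  shows "(\<Sum>i<Suc n. (-1) ^ i * (\<Sum>j<n. T i j)) = 0"
proof -
  let ?F = "\<lambda>(i, j). (-1) ^ i * T i j"
  let ?P = "{..<Suc n} \<times> {..<n}" and ?U = "{(i, j). j < i \<and> i \<le> n}" and ?V = "{(i, j). i \<le> j \<and> j < n}"
  have fin: "finite ?U" "finite ?V"
    by (rule finite_subset[of _ "{..n} \<times> {..n}"]; auto)+
  have "(\<Sum>i<Suc n. (-1) ^ i * (\<Sum>j<n. T i j)) = sum ?F ?P"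
    by (simp add: sum_distrib_left sum.cartesian_product del: sum.lessThan_Suc)
  also have "?P = ?U \<union> ?V" by auto
  also have "sum ?F (?U \<union> ?V) = sum ?F ?U + sum ?F ?V"
    using fin by (intro sum.union_disjoint) auto
  \<comment> \<open>An entry behind the removed one has moved down by one place, hence
    \<open>a - 1\<close>.\<close>
  also have "sum ?F ?V = (\<Sum>(a, b)\<in>?U. ?F (b, a - 1))"
    by (rule sum.reindex_bij_witness[of _ "\<lambda>(a, b). (b, a - 1)" "\<lambda>(i, j). (Suc j, i)"]) auto
  also have "\<dots> = (\<Sum>p\<in>?U. - ?F p)"
  proof (rule sum.cong[OF refl])
    fix p assume "p \<in> ?U"
    then obtain a b where p: "p = (Suc a, b)" "b \<le> a" "a < n" by (cases p; cases "fst p") auto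
    have "(-1) ^ b * ((-1) ^ (a - b) * T (Suc a) b) = (-1) ^ a * T (Suc a) b"
      using p(2) by (simp add: mult.assoc[symmetric] power_add[symmetric])
    then show "(case p of (a, b) \<Rightarrow> ?F (b, a - 1)) = - ?F p"
      using assms[OF p(2,3)] p(1) by simp
  qed
  finally show ?thesis by (simp add: sum_negf)
qed

section \<open>Closedness of the pulled back volume form\<close>

context local_map
begin

text \<open>\<open>\<sigma>\<close> is the sign that the orientation of the target gives to its coordinate frame.\<close>

definition vpull :: "real \<Rightarrow> real^'m \<Rightarrow> (real^'m) list \<Rightarrow> real" where
  "vpull \<sigma> y vs = \<sigma> * sqrt (det (h (f y))) * detl (map (fder f y) vs)"

text \<open>The second fundamental form without the source connection. This is what plain coordinate
  derivatives of the pulled back form produce, and it is still symmetric.\<close>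

definition sff_target :: "real^'m \<Rightarrow> real^'m \<Rightarrow> real^'m \<Rightarrow> real^'n" where
  "sff_target y w v = hess y w v + chr h (f y) (fder f y w) (fder f y v)"

lemma sff_target_commute: "y \<in> D \<Longrightarrow> sff_target y w v = sff_target y v w"
  unfolding sff_target_def using hess_commute T.chr_commute[OF f_mem] by metis

text \<open>Differentiating the density gives the trace of a target Christoffel matrix times the
  determinant; \<open>sum_detl_update\<close> distributes this trace over the slots, where it joins
  the second derivatives of \<open>f\<close>.\<close>

lemma vpull_has_derivative:
  assumes y: "y \<in> D" and len: "length vs = CARD('n)"
  shows "((\<lambda>z. vpull \<sigma> z vs) has_derivative
     (\<lambda>w. \<sigma> * sqrt (det (h (f y))) * (\<Sum>j<CARD('n). detl ((map (fder f y) vs)[j := sff_target y w (vs ! j)])))) (at y)"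
proof -
  let ?as = "map (fder f y) vs" and ?s = "sqrt (det (h (f y)))"
  let ?M = "\<lambda>z. \<chi> i. fder f z (vs ! coord_index i) :: real^'n^'n"
  have las: "length ?as = CARD('n)" using len by simp
  have nth: "map (fder f z) vs ! coord_index i = fder f z (vs ! coord_index i)" for z and i :: 'n
    using len coord_index_less[of i] by simp
  have M: "detl (map (fder f z) vs) = det (?M z)" for z
    unfolding detl_def nth ..
  have dM: "(?M has_derivative (\<lambda>w. \<chi> i. hess y w (vs ! coord_index i))) (at y)"
    unfolding has_derivative_componentwise_within[of ?M]
  proof
    fix b :: "real^'n^'n" assume "b \<in> Basis"
    then obtain i c where b: "b = axis i c" "c \<in> Basis" unfolding Basis_vec_def by blast
    show "((\<lambda>z. ?M z \<bullet> b) has_derivative (\<lambda>w. (\<chi> i. hess y w (vs ! coord_index i)) \<bullet> b)) (at y)"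
      by (simp add: b(1) inner_axis) (intro has_derivative_inner_left df_has_derivative y)
  qed
  have ddet: "((\<lambda>z. detl (map (fder f z) vs)) has_derivative
      (\<lambda>w. \<Sum>j<CARD('n). detl (?as[j := hess y w (vs ! j)]))) (at y)"
    unfolding M sum_coord_index detl_update[OF las] nth
    by (rule has_derivative_eq_rhs[OF has_derivative_compose[OF dM det_has_derivative]])
       (auto intro!: ext sum.cong arg_cong[of _ _ det] simp: vec_eq_iff)
  have ds: "((\<lambda>z. sqrt (det (h (f z)))) has_derivative
      (\<lambda>w. trace (matrix (chr h (f y) (fder f y w))) * ?s)) (at y)"
    using has_derivative_compose[OF f_has_derivative[OF y] T.sqrt_det_has_derivative[OF f_mem[OF y]]] .
  have "((\<lambda>z. vpull \<sigma> z vs) has_derivative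
     (\<lambda>w. \<sigma> * ?s * (\<Sum>j<CARD('n). detl (?as[j := hess y w (vs ! j)]))
        + \<sigma> * (trace (matrix (chr h (f y) (fder f y w))) * ?s) * detl ?as)) (at y)"
    unfolding vpull_def by (intro has_derivative_mult has_derivative_mult_right ds ddet)
  moreover have "trace (matrix (chr h (f y) (fder f y w))) * detl ?as
      = (\<Sum>j<CARD('n). detl (?as[j := chr h (f y) (fder f y w) (fder f y (vs ! j))]))" for w
  proof -
    have "matrix (chr h (f y) (fder f y w)) *v x = chr h (f y) (fder f y w) x" for x
      by (rule fun_cong[OF matrix_vector_mul(2)[OF T.chr_linear[OF f_mem[OF y]]]])
    then show ?thesis
      unfolding sum_detl_update[OF las, symmetric] using len by (intro sum.cong refl) simp
  qed
  moreover have "detl (?as[j := sff_target y w (vs ! j)]) = detl (?as[j := hess y w (vs ! j)])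
      + detl (?as[j := chr h (f y) (fder f y w) (fder f y (vs ! j))])" if "j < CARD('n)" for j w
    unfolding sff_target_def using linear_add[OF detl_linear[OF las that]] .
  ultimately show "((\<lambda>z. vpull \<sigma> z vs) has_derivative
     (\<lambda>w. \<sigma> * ?s * (\<Sum>j<CARD('n). detl (?as[j := sff_target y w (vs ! j)])))) (at y)"
    by (simp add: sum.distrib algebra_simps)
qed

text \<open>Each term of the exterior derivative carries \<open>sff_target\<close> of the removed
  vector and one remaining vector. By its symmetry, exchanging the two roles changes only the
  position in the determinant, which \<open>detl_move\<close> accounts for.\<close>

lemma vpull_closed:
  assumes y: "y \<in> D" and len: "length vs = Suc CARD('n)"
  shows "(\<Sum>i<length vs. (-1) ^ i * fder (\<lambda>z. vpull \<sigma> z (take i vs @ drop (Suc i) vs)) y (vs ! i)) = 0"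
proof -
  let ?r = "\<lambda>i. take i vs @ drop (Suc i) vs"
  define T where "T i j = detl ((map (fder f y) (?r i))[j := sff_target y (vs ! i) (?r i ! j)])" for i j
  have "fder (\<lambda>z. vpull \<sigma> z (?r i)) y (vs ! i) = \<sigma> * sqrt (det (h (f y))) * (\<Sum>j<CARD('n). T i j)"
    if "i < length vs" for i
  proof -
    have "length (?r i) = CARD('n)" using that len by simp
    from fun_cong[OF fder_eqI[OF vpull_has_derivative[OF y this]], of \<sigma> "vs ! i"] show ?thesis by (simp add: T_def)
  qed
  then have "(\<Sum>i<length vs. (-1) ^ i * fder (\<lambda>z. vpull \<sigma> z (?r i)) y (vs ! i))
     = \<sigma> * sqrt (det (h (f y))) * (\<Sum>i<length vs. (-1) ^ i * (\<Sum>j<CARD('n). T i j))"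
    by (subst sum_distrib_left) (intro sum.cong refl, simp)
  also have "(\<Sum>i<length vs. (-1) ^ i * (\<Sum>j<CARD('n). T i j)) = 0"
    unfolding len
  proof (rule alternating_sum_removed_zero)
    fix i j assume ij: "i \<le> j" "j < CARD('n)"
    \<comment> \<open>Since i \<le> j, position \<open>j\<close> after removal of entry
      \<open>i\<close> is position \<open>Suc j\<close> of \<open>vs\<close>.\<close>
    define xs p ys q zs where d: "xs = take i vs" "p = vs ! i" "ys = take (j - i) (drop (Suc i) vs)"
      "q = vs ! Suc j" "zs = drop (Suc (Suc j)) vs"
    have "drop (Suc i) vs = take (j - i) (drop (Suc i) vs) @ drop (Suc i) vs ! (j - i) # drop (Suc (j - i)) (drop (Suc i) vs)"
      using ij len by (intro id_take_nth_drop) simp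
    then have "drop (Suc i) vs = ys @ q # zs"
      using ij len by (simp add: d)
    moreover have "vs = xs @ p # drop (Suc i) vs"
      unfolding d using ij len by (intro id_take_nth_drop) simp
    ultimately have vs: "vs = xs @ p # ys @ q # zs" by simp
    have l: "length xs = i" "length ys = j - i" "length (xs @ ys @ zs) = CARD('n) - 1"
      using ij len by (auto simp: d)
    have ri: "?r i = xs @ ys @ q # zs" "?r i ! j = q" "vs ! i = p"
      unfolding vs using l ij by (auto simp: nth_append)
    have rj: "?r (Suc j) = xs @ p # ys @ zs" "?r (Suc j) ! i = p" "vs ! Suc j = q"
      unfolding vs using l ij by (auto simp: nth_append Suc_diff_le)
    let ?x = "sff_target y p q" and ?A = "map (fder f y)"
    have "T i j = detl (?A xs @ ?A ys @ ?x # ?A zs)"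
      unfolding T_def ri using l ij by (simp add: list_update_append nth_append)
    moreover have "T (Suc j) i = detl (?A xs @ ?x # ?A ys @ ?A zs)"
      unfolding T_def rj using l ij by (simp add: list_update_append nth_append sff_target_commute[OF y, of q p])
    moreover have "detl (?A xs @ ?x # ?A ys @ ?A zs) = (-1) ^ length (?A ys) * detl (?A xs @ ?A ys @ ?x # ?A zs)"
      using l(3) by (intro detl_move) simp
    ultimately show "T i j = (-1) ^ (j - i) * T (Suc j) i"
      using l(2) by (simp add: mult.assoc[symmetric] power_add[symmetric])
  qed
  finally show ?thesis by simp
qed

section \<open>The codifferential of the pulled back volume form\<close>

definition vcov :: "real \<Rightarrow> real^'m \<Rightarrow> real^'m \<Rightarrow> (real^'m) list \<Rightarrow> real" where
  "vcov \<sigma> y w vs = fder (\<lambda>z. vpull \<sigma> z vs) y w - (\<Sum>j<length vs. vpull \<sigma> y (vs[j := chr g y w (vs ! j)]))"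

definition vcodiff :: "real \<Rightarrow> real^'m \<Rightarrow> (real^'m) list \<Rightarrow> real" where
  "vcodiff \<sigma> y vs = - (\<Sum>i\<in>UNIV. \<Sum>j\<in>UNIV. matrix_inv (g y) $ i $ j * vcov \<sigma> y (axis i 1) (axis j 1 # vs))"

text \<open>The Christoffel corrections on the source complete \<open>sff_target\<close> to
  \<open>sff\<close> in every slot.\<close>

lemma vcov_eq:
  assumes y: "y \<in> D" and len: "length vs = CARD('n)"
  shows "vcov \<sigma> y w vs = \<sigma> * sqrt (det (h (f y))) * (\<Sum>j<CARD('n). detl ((map (fder f y) vs)[j := sff y w (vs ! j)]))"
proof -
  have "detl ((map (fder f y) vs)[j := sff y w (vs ! j)]) = detl ((map (fder f y) vs)[j := sff_target y w (vs ! j)])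
      - detl (map (fder f y) (vs[j := chr g y w (vs ! j)]))" if "j < CARD('n)" for j
  proof -
    have "sff y w (vs ! j) = sff_target y w (vs ! j) - fder f y (chr g y w (vs ! j))"
      by (simp add: sff_def sff_target_def)
    then show ?thesis
      using linear_diff[OF detl_linear[of "map (fder f y) vs" j]] len that by (simp add: map_update)
  qed
  then show ?thesis
    unfolding vcov_def using fun_cong[OF fder_eqI[OF vpull_has_derivative[OF y len]], of \<sigma> w]
    by (simp add: len vpull_def sum_distrib_left sum_subtractf right_diff_distrib)
qed

lemma detl_Cons_linear:
  assumes "Suc (length bs) = CARD('n)"
  shows "linear (\<lambda>v. detl (v # bs :: (real^'n) list))"
  using detl_linear[of "0 # bs" 0] assms by simp

lemma sff_linear_left: "y \<in> D \<Longrightarrow> linear (\<lambda>w. sff y w v)"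
  using sff_linear[of y v] sff_commute[of y v] by (simp add: linear_iff)

lemma hv_component: "hv y a $ i = (\<Sum>j\<in>UNIV. matrix_inv (g y) $ i $ j * (fder f y (axis j 1) \<bullet> a))"
proof -
  have "(transpose (matrix (fder f y)) *v a) $ j = fder f y (axis j 1) \<bullet> a" for j
    by (simp add: matrix_vector_mult_def transpose_def matrix_def inner_vec_def del: transpose_matrix_vector)
  then show ?thesis
    by (simp add: hv_def matrix_vector_mult_def[of "matrix_inv (g y)"] del: transpose_matrix_vector)
qed

text \<open>By \<open>hv_component\<close>, contracting a source index with the differential in the
  first slot gives the sum over alpha of \<open>hv y (axis \<alpha> 1)\<close> paired with
  \<open>axis \<alpha> 1\<close>. The trace over all source directions thus runs over horizontal
  ones only.\<close>

lemma contract_detl: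
  assumes y: "y \<in> D" and len: "Suc (length bs) = CARD('n)" and k: "k < length bs"
  shows "(\<Sum>i\<in>UNIV. \<Sum>j\<in>UNIV. matrix_inv (g y) $ i $ j * detl (fder f y (axis j 1) # bs[k := sff y (axis i 1) x]))
     = (\<Sum>\<alpha>\<in>UNIV. detl (axis \<alpha> 1 # bs[k := sff y (hv y (axis \<alpha> 1)) x]))"
proof -
  define L where "L \<alpha> w = detl (axis \<alpha> 1 # bs[k := sff y w x])" for \<alpha> w
  have lin: "linear (L \<alpha>)" for \<alpha>
  proof -
    have "linear (\<lambda>v. detl ((axis \<alpha> 1 # bs)[Suc k := v]))"
      using len k by (intro detl_linear) auto
    from linear_compose[OF sff_linear_left[OF y] this] show ?thesis
      unfolding L_def by (simp add: o_def)
  qed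
  have "detl (fder f y (axis j 1) # bs[k := sff y w x]) = (\<Sum>\<alpha>\<in>UNIV. (fder f y (axis j 1) \<bullet> axis \<alpha> 1) * L \<alpha> w)" for j w
    using linear_axis_expansion[OF detl_Cons_linear[of "bs[k := sff y w x]"], of "fder f y (axis j 1)"] len
    by (simp add: L_def inner_axis)
  then have "(\<Sum>i\<in>UNIV. \<Sum>j\<in>UNIV. matrix_inv (g y) $ i $ j * detl (fder f y (axis j 1) # bs[k := sff y (axis i 1) x]))
     = (\<Sum>i\<in>UNIV. \<Sum>\<alpha>\<in>UNIV. \<Sum>j\<in>UNIV. matrix_inv (g y) $ i $ j * (fder f y (axis j 1) \<bullet> axis \<alpha> 1) * L \<alpha> (axis i 1))"
    by (simp add: sum_distrib_left mult.assoc) (intro sum.cong refl sum.swap)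
  also have "\<dots> = (\<Sum>\<alpha>\<in>UNIV. \<Sum>i\<in>UNIV. hv y (axis \<alpha> 1) $ i * L \<alpha> (axis i 1))"
    by (subst sum.swap) (simp add: hv_component sum_distrib_right)
  also have "\<dots> = (\<Sum>\<alpha>\<in>UNIV. L \<alpha> (hv y (axis \<alpha> 1)))"
  proof (rule sum.cong[OF refl])
    fix \<alpha> show "(\<Sum>i\<in>UNIV. hv y (axis \<alpha> 1) $ i * L \<alpha> (axis i 1)) = L \<alpha> (hv y (axis \<alpha> 1))"
      using linear_axis_expansion[OF lin[of \<alpha>], of "hv y (axis \<alpha> 1)"] by simp
  qed
  finally show ?thesis unfolding L_def .
qed

text \<open>The contracted first slot is treated apart: where it receives \<open>sff\<close>, the
  contraction is the tension; where another slot does, \<open>contract_detl\<close> applies.\<close>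

lemma vcodiff_eq:
  assumes y: "y \<in> D" and len: "Suc (length vs) = CARD('n)"
  shows "vcodiff \<sigma> y vs = - (\<sigma> * sqrt (det (h (f y))) * (detl (tension y # map (fder f y) vs)
     + (\<Sum>k<length vs. \<Sum>\<alpha>\<in>UNIV. detl (axis \<alpha> 1 # (map (fder f y) vs)[k := sff y (hv y (axis \<alpha> 1)) (vs ! k)]))))"
proof -
  let ?as = "map (fder f y) vs" and ?G = "\<lambda>i j. matrix_inv (g y) $ i $ j" and ?c = "\<sigma> * sqrt (det (h (f y)))"
  let ?P = "\<lambda>i j. detl (sff y (axis i 1) (axis j 1) # ?as)"
  let ?Q = "\<lambda>i j k. detl (fder f y (axis j 1) # ?as[k := sff y (axis i 1) (vs ! k)])"
  have "vcov \<sigma> y (axis i 1) (axis j 1 # vs) = ?c * (?P i j + (\<Sum>k<length vs. ?Q i j k))" for i j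
  proof -
    have "vcov \<sigma> y (axis i 1) (axis j 1 # vs) = ?c * (\<Sum>k<Suc (length vs).
        detl ((map (fder f y) (axis j 1 # vs))[k := sff y (axis i 1) ((axis j 1 # vs) ! k)]))"
      using vcov_eq[OF y, of "axis j 1 # vs" \<sigma> "axis i 1"] len by simp
    then show ?thesis by (simp only: sum.lessThan_Suc_shift) simp
  qed
  then have "vcodiff \<sigma> y vs = - (?c * ((\<Sum>i\<in>UNIV. \<Sum>j\<in>UNIV. ?G i j * ?P i j)
      + (\<Sum>i\<in>UNIV. \<Sum>j\<in>UNIV. \<Sum>k<length vs. ?G i j * ?Q i j k)))"
    by (simp add: vcodiff_def sum.distrib sum_distrib_left algebra_simps)
  moreover have "(\<Sum>i\<in>UNIV. \<Sum>j\<in>UNIV. ?G i j * ?P i j) = detl (tension y # ?as)"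
  proof -
    define L where "L v = detl (v # ?as)" for v
    have L: "linear L" unfolding L_def using len by (intro detl_Cons_linear) simp
    have "(\<Sum>i\<in>UNIV. \<Sum>j\<in>UNIV. ?G i j * L (sff y (axis i 1) (axis j 1))) = L (tension y)"
      by (simp add: tension_def linear_sum[OF L] linear_scale[OF L])
    then show ?thesis unfolding L_def .
  qed
  moreover have "(\<Sum>i\<in>UNIV. \<Sum>j\<in>UNIV. \<Sum>k<length vs. ?G i j * ?Q i j k) = (\<Sum>k<length vs. \<Sum>i\<in>UNIV. \<Sum>j\<in>UNIV. ?G i j * ?Q i j k)"
    by (subst sum.swap[of _ "{..<length vs}"]) (simp add: sum.swap[of _ "{..<length vs}"])
  ultimately show ?thesis using contract_detl[OF y, of ?as] len by simp
qed

lemma sff_vertical_coeffs: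
  assumes "sff_symmetric y" "fder f y v = 0"
  shows "sff y (hv y (axis \<alpha> 1)) v $ \<gamma> = sff y (hv y (axis \<gamma> 1)) v $ \<alpha>"
  using assms unfolding sff_symmetric_def by (metis inner_axis' inner_real_def mult_1)

text \<open>Only the vertical part of each argument contributes, since \<open>sff\<close> vanishes
  on horizontal pairs. Its coefficients are symmetric, while the determinant alternates in the two
  inserted basis vectors.\<close>

lemma vcodiff_zero:
  assumes y: "y \<in> D" and len: "Suc (length vs) = CARD('n)"
    and "tension y = 0" and hh: "\<And>a b. sff y (hv y a) (hv y b) = 0" and sym: "sff_symmetric y"
  shows "vcodiff \<sigma> y vs = 0"
proof -
  let ?as = "map (fder f y) vs"
  have "(\<Sum>\<alpha>\<in>UNIV. detl (axis \<alpha> 1 # ?as[k := sff y (hv y (axis \<alpha> 1)) (vs ! k)])) = 0" if k: "k < length vs" for k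
  proof -
    obtain a v where v: "vs ! k = hv y a + v" "fder f y v = 0" using hor_decomp[OF y] by blast
    let ?S = "\<lambda>\<alpha> \<gamma>. sff y (hv y (axis \<alpha> 1)) v $ \<gamma>"
    let ?T = "\<lambda>\<alpha> \<gamma>. detl (axis \<alpha> 1 # ?as[k := axis \<gamma> 1])"
    have "sff y w (vs ! k) = sff y w (hv y a) + sff y w v" for w
      unfolding v(1) by (rule linear_add[OF sff_linear[OF y]])
    then have s: "sff y (hv y b) (vs ! k) = sff y (hv y b) v" for b by (simp add: hh)
    have "detl (axis \<alpha> 1 # ?as[k := sff y (hv y (axis \<alpha> 1)) (vs ! k)]) = (\<Sum>\<gamma>\<in>UNIV. ?S \<alpha> \<gamma> * ?T \<alpha> \<gamma>)" for \<alpha>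
    proof -
      have "linear (\<lambda>x. detl ((axis \<alpha> 1 # ?as)[Suc k := x]))"
        using k len by (intro detl_linear) auto
      from linear_axis_expansion[OF this, of "sff y (hv y (axis \<alpha> 1)) v"] show ?thesis
        unfolding s by simp
    qed
    moreover have "(\<Sum>\<alpha>\<in>UNIV. \<Sum>\<gamma>\<in>UNIV. ?S \<alpha> \<gamma> * ?T \<alpha> \<gamma>) = 0"
    proof (rule sum_symmetric_alternating)
      show "?S \<alpha> \<gamma> = ?S \<gamma> \<alpha>" for \<alpha> \<gamma> by (rule sff_vertical_coeffs[OF sym v(2)])
      show "?T \<alpha> \<gamma> = - ?T \<gamma> \<alpha>" for \<alpha> \<gamma>
        using detl_swap[of "0 # ?as" 0 "Suc k" "axis \<alpha> 1" "axis \<gamma> 1"] k len by simp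
    qed
    ultimately show ?thesis by simp
  qed
  moreover have "detl (tension y # ?as) = 0"
    using assms(3) len by (intro detl_zero[of _ 0]) auto
  ultimately show ?thesis unfolding vcodiff_eq[OF y len] by simp
qed

text \<open>The arguments are \<open>v\<close> and preimages of all basis vectors except those of
  \<open>p\<close> and \<open>q\<close>. As the differential kills \<open>v\<close>, only the term
  that replaces the slot of \<open>v\<close> survives. The two basis vectors then inserted must be
  those of \<open>p\<close> and \<open>q\<close> in either order, with opposite signs.\<close>

lemma vcodiff_zero_imp_symmetric_basis:
  assumes y: "y \<in> D" and \<sigma>: "\<sigma> \<noteq> 0" and z: "\<And>vs. Suc (length vs) = CARD('n) \<Longrightarrow> vcodiff \<sigma> y vs = 0"
    and v: "fder f y v = 0" and pq: "p \<noteq> q"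
  shows "sff y (hv y (axis p 1)) v $ q = sff y (hv y (axis q 1)) v $ p"
proof -
  let ?n = "CARD('n)"
  have n2: "?n \<ge> 2" using card_mono[of "UNIV :: 'n set" "{p, q}"] pq by simp
  obtain \<pi> :: "nat \<Rightarrow> 'n" where \<pi>: "bij_betw \<pi> {..<?n} UNIV" "\<pi> 0 = p" "\<pi> 1 = q"
  proof -
    have "card {2..<?n} = card (UNIV - {p, q})"
      using pq by (simp add: card_Diff_subset numeral_2_eq_2)
    \<comment> \<open>The remaining indices are enumerated from 2 on, so that \<open>p\<close> and
      \<open>q\<close> can occupy the first two positions.\<close>
    then obtain b where b: "bij_betw b {2..<?n} (UNIV - {p, q})"
      using finite_same_card_bij[of "{2..<?n}" "UNIV - {p, q}"] by auto
    let ?\<pi> = "b(0 := p, 1 := q)"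
    have "bij_betw ?\<pi> {2..<?n} (UNIV - {p, q})"
      using b by (rule bij_betw_cong[THEN iffD1, rotated]) auto
    moreover have "bij_betw ?\<pi> {0, 1} {p, q}" using pq by (auto simp: bij_betw_def)
    ultimately have "bij_betw ?\<pi> ({2..<?n} \<union> {0, 1}) (UNIV - {p, q} \<union> {p, q})"
      by (rule bij_betw_combine) auto
    moreover have "{2..<?n} \<union> {0, 1} = {..<?n}" using n2 by auto
    moreover have "UNIV - {p, q} \<union> {p, q} = (UNIV :: 'n set)" by auto
    ultimately show ?thesis using that[of ?\<pi>] by simp
  qed
  have surj: "\<exists>k<?n. \<pi> k = \<alpha>" for \<alpha> using bij_betw_imp_surj_on[OF \<pi>(1)] by (metis UNIV_I imageE lessThan_iff)
  have "\<exists>x. fder f y x = axis \<alpha> 1" for \<alpha> using surj_f[OF y] by (metis surjD)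
  then obtain X where X: "fder f y (X \<alpha>) = axis \<alpha> 1" for \<alpha> by metis
  define cs where "cs = map (\<lambda>k. axis (\<pi> k) 1 :: real^'n) [2..<?n]"
  define vs where "vs = v # map (\<lambda>k. X (\<pi> k)) [2..<?n]"
  have len: "Suc (length vs) = ?n" using n2 by (simp add: vs_def)
  have as: "map (fder f y) vs = 0 # cs" by (simp add: vs_def cs_def v X)
  have lcs: "Suc (Suc (length cs)) = ?n" using n2 by (simp add: cs_def)
  have "detl (tension y # 0 # cs) = 0" using lcs by (intro detl_zero[of _ 1]) auto
  \<comment> \<open>Replacing a slot other than that of \<open>v\<close> leaves the zero vector at
    position 1 of the list.\<close>
  moreover have z': "detl (axis \<alpha> 1 # (0 # cs)[Suc k := x]) = 0" for \<alpha> k x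
    using lcs by (intro detl_zero[of _ 1]) auto
  moreover have lv: "length vs = Suc (length cs)" using len lcs by simp
  ultimately have "(\<Sum>k<Suc (length cs). \<Sum>\<alpha>\<in>UNIV. detl (axis \<alpha> 1 # (0 # cs)[k := sff y (hv y (axis \<alpha> 1)) (vs ! k)])) = 0"
    using z[OF len] \<sigma> T.det_g[OF f_mem[OF y]] unfolding vcodiff_eq[OF y len] as lv
    by (simp del: sum.lessThan_Suc)
  then have sum0: "(\<Sum>\<alpha>\<in>UNIV. detl (axis \<alpha> 1 # sff y (hv y (axis \<alpha> 1)) v # cs)) = 0"
    unfolding sum.lessThan_Suc_shift z' by (simp add: vs_def)
  let ?S = "\<lambda>\<alpha> \<gamma>. sff y (hv y (axis \<alpha> 1)) v $ \<gamma>"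
  let ?R = "\<lambda>\<alpha> \<gamma>. detl (axis \<alpha> 1 # axis \<gamma> 1 # cs)"
  \<comment> \<open>Every basis vector other than those of \<open>p\<close> and \<open>q\<close>
    already occurs in \<open>cs\<close>, so two entries coincide; the same happens for equal
    indices.\<close>
  have R0: "?R \<alpha> \<gamma> = 0" if ne: "\<not> (\<alpha> = p \<and> \<gamma> = q)" "\<not> (\<alpha> = q \<and> \<gamma> = p)" for \<alpha> \<gamma>
  proof -
    have cs_nth: "cs ! (k - 2) = axis (\<pi> k) 1" if "2 \<le> k" "k < ?n" for k
    proof -
      have "[2..<?n] ! (k - 2) = k" using that nth_upt[of 2 "k - 2" ?n] by simp
      moreover have "cs ! (k - 2) = axis (\<pi> ([2..<?n] ! (k - 2))) 1"
        using that unfolding cs_def by (intro nth_map) simp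
      ultimately show ?thesis by (simp only:)
    qed
    consider "\<alpha> = \<gamma>" | "\<alpha> \<notin> {p, q}" | "\<gamma> \<notin> {p, q}" using ne by auto
    then show ?thesis
    proof cases
      case 1
      then show ?thesis using n2 by (intro detl_alternating[of 0 1]) auto
    next
      case 2
      obtain k where k: "k < ?n" "\<pi> k = \<alpha>" using surj by blast
      have "k \<noteq> 0" by (intro notI) (use k 2 \<pi>(2) in simp)
      moreover have "k \<noteq> 1" by (intro notI) (use k 2 \<pi>(3) in simp)
      ultimately have "2 \<le> k" by simp
      then show ?thesis using k cs_nth[of k] n2
        by (intro detl_alternating[of 0 k]) (auto simp: nth_Cons' numeral_2_eq_2)
    next
      case 3
      obtain k where k: "k < ?n" "\<pi> k = \<gamma>" using surj by blast
      have "k \<noteq> 0" by (intro notI) (use k 3 \<pi>(2) in simp)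
      moreover have "k \<noteq> 1" by (intro notI) (use k 3 \<pi>(3) in simp)
      ultimately have "2 \<le> k" by simp
      then show ?thesis using k cs_nth[of k] n2
        by (intro detl_alternating[of 1 k]) (auto simp: nth_Cons' numeral_2_eq_2)
    qed
  qed
  have Rqp: "?R q p = - ?R p q"
    using detl_swap[of "0 # 0 # cs" 0 1 "axis q 1" "axis p 1"] lcs n2 by simp
  have "[0..<?n] = 0 # 1 # [2..<?n]" using n2 by (simp add: upt_conv_Cons numeral_2_eq_2)
  then have "?R p q = detl (map (\<lambda>k. axis (\<pi> k) 1) [0..<?n])"
    using \<pi>(2,3) by (simp add: cs_def)
  then have Rpq: "?R p q \<noteq> 0" using detl_basis[OF \<pi>(1)] by simp
  have "detl (axis \<alpha> 1 # sff y (hv y (axis \<alpha> 1)) v # cs) = (\<Sum>\<gamma>\<in>UNIV. ?S \<alpha> \<gamma> * ?R \<alpha> \<gamma>)" for \<alpha>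
  proof -
    have "linear (\<lambda>x. detl ((axis \<alpha> 1 # 0 # cs)[1 := x]))"
      using lcs n2 by (intro detl_linear) auto
    from linear_axis_expansion[OF this, of "sff y (hv y (axis \<alpha> 1)) v"] show ?thesis by simp
  qed
  then have "0 = (\<Sum>\<alpha>\<in>UNIV. \<Sum>\<gamma>\<in>UNIV. ?S \<alpha> \<gamma> * ?R \<alpha> \<gamma>)" using sum0 by simp
  also have "\<dots> = (\<Sum>\<alpha>\<in>UNIV. \<Sum>\<gamma>\<in>UNIV. (if \<alpha> = p then if \<gamma> = q then ?S p q * ?R p q else 0 else 0)
      + (if \<alpha> = q then if \<gamma> = p then ?S q p * ?R q p else 0 else 0))"
    using pq R0 by (intro sum.cong refl) auto
  also have "\<dots> = ?S p q * ?R p q + ?S q p * ?R q p"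
  proof -
    have "(\<Sum>\<gamma>\<in>UNIV. if \<alpha> = p' then if \<gamma> = q' then x else 0 else 0) = (if \<alpha> = p' then x else 0)"
      for \<alpha> p' q' :: 'n and x :: real by (cases "\<alpha> = p'") auto
    then show ?thesis by (simp add: sum.distrib)
  qed
  also have "\<dots> = (?S p q - ?S q p) * ?R p q" unfolding Rqp by (simp add: algebra_simps)
  finally show ?thesis using Rpq by simp
qed

text \<open>Bilinearity in \<open>a\<close> and \<open>b\<close> extends the symmetry from basis
  covectors to all covectors.\<close>

lemma vcodiff_zero_imp_symmetric:
  assumes y: "y \<in> D" and \<sigma>: "\<sigma> \<noteq> 0" and z: "\<And>vs. Suc (length vs) = CARD('n) \<Longrightarrow> vcodiff \<sigma> y vs = 0"
  shows "sff_symmetric y"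
  unfolding sff_symmetric_def
proof (intro allI impI)
  fix v a b assume v: "fder f y v = 0"
  let ?S = "\<lambda>\<alpha> \<gamma>. sff y (hv y (axis \<alpha> 1)) v $ \<gamma>"
  have "?S p q = ?S q p" for p q
    using vcodiff_zero_imp_symmetric_basis[OF assms v] by (cases "p = q") auto
  then have sym: "?S p q = ?S q p" for p q .
  have lin: "linear (\<lambda>a. sff y (hv y a) v)"
    using linear_compose[OF hv_linear sff_linear_left[OF y]] by (simp add: o_def)
  have ex: "b \<bullet> sff y (hv y a) v = (\<Sum>p\<in>UNIV. \<Sum>q\<in>UNIV. a $ p * b $ q * ?S p q)" for a b
    unfolding linear_axis_expansion[OF lin, of a]
    by (simp add: inner_sum_right inner_vec_def[of b] sum_distrib_left algebra_simps)
  have "b \<bullet> sff y (hv y a) v = (\<Sum>p\<in>UNIV. \<Sum>q\<in>UNIV. a $ q * b $ p * ?S q p)"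
    unfolding ex by (rule sum.swap)
  also have "\<dots> = a \<bullet> sff y (hv y b) v"
    unfolding ex by (intro sum.cong refl) (subst sym, simp add: mult_ac)
  finally show "b \<bullet> sff y (hv y a) v = a \<bullet> sff y (hv y b) v" .
qed

end

section \<open>Charts\<close>

locale riem_manifold =
  fixes M :: "('a, 'm::finite) riemannian"
  assumes atlas: "smooth_atlas M" and metric: "riemannian_metric M"
begin

lemma chart_facts:
  assumes "c \<in> atlas M"
  shows openin_cdom: "openin (mtop M) (cdom c)" and open_cimg: "open (cimg c)"
    and homeo: "homeomorphic_map (subtopology (mtop M) (cdom c)) (top_of_set (cimg c)) (cmap c)"
  using atlas assms unfolding smooth_atlas_def by auto

lemma topspace_cdom: "c \<in> atlas M \<Longrightarrow> topspace (subtopology (mtop M) (cdom c)) = cdom c"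
  using openin_subset[OF openin_cdom, of c] by (simp add: Int_absorb1)

lemma cdom_subset: "c \<in> atlas M \<Longrightarrow> cdom c \<subseteq> topspace (mtop M)"
  by (rule openin_subset[OF openin_cdom])

lemma inj_cmap: "c \<in> atlas M \<Longrightarrow> inj_on (cmap c) (cdom c)"
  using homeomorphic_imp_injective_map[OF homeo] topspace_cdom by metis

lemma cmap_in [simp]: "x \<in> cdom c \<Longrightarrow> cmap c x \<in> cimg c"
  by (simp add: cimg_def)

lemma cinv_in [simp]: "y \<in> cimg c \<Longrightarrow> cinv c y \<in> cdom c"
  unfolding cinv_def cimg_def by (rule inv_into_into)

lemma cmap_cinv [simp]: "y \<in> cimg c \<Longrightarrow> cmap c (cinv c y) = y"
  unfolding cinv_def cimg_def by (rule f_inv_into_f)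

lemma cinv_cmap: "c \<in> atlas M \<Longrightarrow> x \<in> cdom c \<Longrightarrow> cinv c (cmap c x) = x"
  unfolding cinv_def using inj_cmap by (rule inv_into_f_f)

lemma chart_at_spec:
  assumes "x \<in> topspace (mtop M)"
  shows "chart_at M x \<in> atlas M" "x \<in> cdom (chart_at M x)"
proof -
  have "\<exists>c. c \<in> atlas M \<and> x \<in> cdom c" using atlas assms unfolding smooth_atlas_def by blast
  then have "chart_at M x \<in> atlas M \<and> x \<in> cdom (chart_at M x)"
    unfolding chart_at_def by (rule someI_ex)
  then show "chart_at M x \<in> atlas M" "x \<in> cdom (chart_at M x)" by auto
qed

lemma image_cmap: "c \<in> atlas M \<Longrightarrow> A \<subseteq> cdom c \<Longrightarrow> cmap c ` A = {y \<in> cimg c. cinv c y \<in> A}"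
  by (force simp: cinv_cmap cimg_def)

text \<open>Chart maps are homeomorphisms onto their images for the subspace topologies; openness of
  domain and image turns relatively open sets into open ones.\<close>

lemma open_preimage_cinv:
  assumes c: "c \<in> atlas M" and U: "openin (mtop M) U"
  shows "open {y \<in> cimg c. cinv c y \<in> U}"
proof -
  have "openin (subtopology (mtop M) (cdom c)) (U \<inter> cdom c)"
    using U by (auto simp: openin_subtopology)
  then have "openin (top_of_set (cimg c)) (cmap c ` (U \<inter> cdom c))"
    using homeomorphic_imp_open_map[OF homeo[OF c]] by (auto simp: open_map_def)
  then have "open (cmap c ` (U \<inter> cdom c))" using open_cimg[OF c] openin_open_eq by blast
  moreover have "cmap c ` (U \<inter> cdom c) = {y \<in> cimg c. cinv c y \<in> U}"
    by (subst image_cmap[OF c]) auto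
  ultimately show ?thesis by simp
qed

lemma openin_preimage_cmap:
  assumes c: "c \<in> atlas M" and W: "open W"
  shows "openin (mtop M) {x \<in> cdom c. cmap c x \<in> W}"
proof -
  have "openin (top_of_set (cimg c)) (cimg c \<inter> W)" using W by (simp add: openin_open_Int)
  then have "openin (subtopology (mtop M) (cdom c)) {x \<in> topspace (subtopology (mtop M) (cdom c)). cmap c x \<in> cimg c \<inter> W}"
    by (rule openin_continuous_map_preimage[OF homeomorphic_imp_continuous_map[OF homeo[OF c]]])
  moreover have "{x \<in> topspace (subtopology (mtop M) (cdom c)). cmap c x \<in> cimg c \<inter> W} = {x \<in> cdom c. cmap c x \<in> W}"
    unfolding topspace_cdom[OF c] by auto
  ultimately show ?thesis using openin_open_subtopology[OF openin_cdom[OF c]] by auto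
qed

definition overlap :: "('a, 'm) chart \<Rightarrow> ('a, 'm) chart \<Rightarrow> (real^'m) set" where
  "overlap c d = {y \<in> cimg c. cinv c y \<in> cdom d}"

lemma open_overlap: "c \<in> atlas M \<Longrightarrow> d \<in> atlas M \<Longrightarrow> open (overlap c d)"
  unfolding overlap_def using open_preimage_cinv openin_cdom by blast

lemma transition_eq: "transition c d y = cmap d (cinv c y)"
  by (simp add: transition_def)

lemma transition_in: "c \<in> atlas M \<Longrightarrow> d \<in> atlas M \<Longrightarrow> y \<in> overlap c d \<Longrightarrow> transition c d y \<in> overlap d c"
  unfolding overlap_def transition_eq by (auto simp: cinv_cmap)

lemma transition_transition:
  "c \<in> atlas M \<Longrightarrow> d \<in> atlas M \<Longrightarrow> y \<in> overlap c d \<Longrightarrow> transition d c (transition c d y) = y"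
  unfolding overlap_def transition_eq by (auto simp: cinv_cmap)

lemma smooth_transition: "c \<in> atlas M \<Longrightarrow> d \<in> atlas M \<Longrightarrow> smooth_on (overlap c d) (transition c d)"
proof -
  assume c: "c \<in> atlas M" "d \<in> atlas M"
  have "cmap c ` (cdom c \<inter> cdom d) = overlap c d"
    unfolding overlap_def by (subst image_cmap[OF c(1)]) auto
  then show ?thesis using atlas c unfolding smooth_atlas_def by metis
qed

lemma transition_has_derivative:
  "c \<in> atlas M \<Longrightarrow> d \<in> atlas M \<Longrightarrow> y \<in> overlap c d \<Longrightarrow>
    (transition c d has_derivative fder (transition c d) y) (at y)"
  using smooth_on_has_derivative[OF smooth_transition] by blast

lemma fder_transition_inverse:
  assumes c: "c \<in> atlas M" "d \<in> atlas M" and y: "y \<in> overlap c d"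
  shows "fder (transition d c) (transition c d y) (fder (transition c d) y v) = v"
proof -
  have "((\<lambda>z. transition d c (transition c d z)) has_derivative
      (\<lambda>v. fder (transition d c) (transition c d y) (fder (transition c d) y v))) (at y)"
    by (intro has_derivative_compose[OF transition_has_derivative[OF c y]]
        transition_has_derivative c transition_in y)
  moreover have "((\<lambda>z. transition d c (transition c d z)) has_derivative (\<lambda>v. v)) (at y)"
    by (rule has_derivative_transform_within_open[OF has_derivative_ident open_overlap[OF c] y])
       (simp add: transition_transition c)
  ultimately show ?thesis by (rule has_derivative_unique[THEN fun_cong])
qed

lemma transition_linear:
  "c \<in> atlas M \<Longrightarrow> d \<in> atlas M \<Longrightarrow> y \<in> overlap c d \<Longrightarrow> linear (fder (transition c d) y)"
  using has_derivative_linear[OF transition_has_derivative] by blast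

lemma bij_fder_transition:
  assumes c: "c \<in> atlas M" "d \<in> atlas M" and y: "y \<in> overlap c d"
  shows "bij (fder (transition c d) y)"
proof -
  have "inj (fder (transition c d) y)"
    using fder_transition_inverse[OF assms] by (metis injI)
  then show ?thesis using linear_injective_imp_surjective[OF transition_linear[OF assms]] by (simp add: bij_def)
qed

lemma metric_field_chart: "c \<in> atlas M \<Longrightarrow> metric_field (cimg c) (gram M c)"
  using metric open_cimg unfolding riemannian_metric_def metric_field_def ginner_def by blast

lemma ginner_transition:
  assumes "c \<in> atlas M" "d \<in> atlas M" "y \<in> overlap c d"
  shows "ginner M d (transition c d y) (fder (transition c d) y v) (fder (transition c d) y w) = ginner M c y v w"
proof -
  have "y \<in> cimg c" "cinv c y \<in> cdom d" using assms(3) by (auto simp: overlap_def)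
  then have "\<forall>v w. ginner M c y v w = ginner M d (transition c d y)
      (fder (transition c d) y v) (fder (transition c d) y w)"
    using metric assms(1,2) unfolding riemannian_metric_def by blast
  then show ?thesis by simp
qed

lemma gram_transition:
  assumes "c \<in> atlas M" "d \<in> atlas M" "y \<in> overlap c d"
  shows "gram M c y = transpose (matrix (fder (transition c d) y)) ** gram M d (transition c d y)
      ** matrix (fder (transition c d) y)"
proof -
  let ?J = "matrix (fder (transition c d) y)"
  have J: "?J *v v = fder (transition c d) y v" for v
    by (rule fun_cong[OF matrix_vector_mul(2)[OF transition_linear[OF assms]]])
  have "v \<bullet> (gram M c y *v w) = v \<bullet> ((transpose ?J ** gram M d (transition c d y) ** ?J) *v w)" for v w
    using ginner_transition[OF assms, of v w] inner_transpose_matrix[of ?J "gram M d (transition c d y) *v (?J *v w)" v]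
    by (simp add: ginner_def J matrix_vector_mul_assoc[symmetric] inner_commute del: transpose_matrix_vector)
  then have "gram M c y *v w = (transpose ?J ** gram M d (transition c d y) ** ?J) *v w" for w
    using vector_eq_ldot[of "gram M c y *v w"] by blast
  then show ?thesis by (simp add: matrix_eq)
qed

lemma det_transition:
  assumes "c \<in> atlas M" "d \<in> atlas M" "y \<in> overlap c d"
  shows "det (matrix (fder (transition c d) y)) \<noteq> 0"
  using bij_fder_transition[OF assms] det_nz_iff_inj[OF transition_linear[OF assms]]
  by (simp add: bij_def)

lemma sqrt_det_gram_transition:
  assumes "c \<in> atlas M" "d \<in> atlas M" "y \<in> overlap c d"
  shows "sqrt (det (gram M c y)) = \<bar>det (matrix (fder (transition c d) y))\<bar> * sqrt (det (gram M d (transition c d y)))"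
proof -
  have "det (gram M c y) = (det (matrix (fder (transition c d) y)))\<^sup>2 * det (gram M d (transition c d y))"
    by (subst gram_transition[OF assms]) (simp add: det_mul power2_eq_square)
  then show ?thesis by (simp add: real_sqrt_mult)
qed

end

section \<open>Smooth maps in a fixed pair of charts\<close>

locale riem_smooth_map = A: riem_manifold M + B: riem_manifold N
  for M :: "('a, 'm::finite) riemannian" and N :: "('b, 'n::finite) riemannian" +
  fixes u :: "'a \<Rightarrow> 'b"
  assumes smooth_u: "smooth_map M N u"
begin

lemma u_in: "x \<in> topspace (mtop M) \<Longrightarrow> u x \<in> topspace (mtop N)"
  using smooth_u unfolding smooth_map_def continuous_map_def by auto

text \<open>The open set on which the target chart \<open>d\<close> may be kept while the point
  moves, which makes derivatives of local expressions meaningful.\<close>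

definition reg :: "('a, 'm) chart \<Rightarrow> ('b, 'n) chart \<Rightarrow> (real^'m) set" where
  "reg c d = {y \<in> cimg c. u (cinv c y) \<in> cdom d}"

lemma open_reg:
  assumes c: "c \<in> atlas M" and d: "d \<in> atlas N"
  shows "open (reg c d)"
proof -
  have "openin (mtop M) {x \<in> topspace (mtop M). u x \<in> cdom d}"
    using smooth_u B.openin_cdom[OF d] unfolding smooth_map_def
    by (auto intro: openin_continuous_map_preimage)
  from A.open_preimage_cinv[OF c this]
  have "open {y \<in> cimg c. cinv c y \<in> {x \<in> topspace (mtop M). u x \<in> cdom d}}" .
  moreover have "{y \<in> cimg c. cinv c y \<in> {x \<in> topspace (mtop M). u x \<in> cdom d}} = reg c d"
    unfolding reg_def using A.cdom_subset[OF c] A.cinv_in[of _ c] by blast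
  ultimately show ?thesis by simp
qed

lemma smooth_local_rep: "c \<in> atlas M \<Longrightarrow> d \<in> atlas N \<Longrightarrow> smooth_on (reg c d) (local_rep c d u)"
  using smooth_u unfolding smooth_map_def reg_def by blast

lemma local_rep_eq: "local_rep c d u y = cmap d (u (cinv c y))"
  by (simp add: local_rep_def)

lemma local_rep_in: "y \<in> reg c d \<Longrightarrow> local_rep c d u y \<in> cimg d"
  by (simp add: local_rep_eq reg_def B.cmap_in)

lemma local_rep_has_derivative:
  "c \<in> atlas M \<Longrightarrow> d \<in> atlas N \<Longrightarrow> y \<in> reg c d \<Longrightarrow> (local_rep c d u has_derivative fder (local_rep c d u) y) (at y)"
  using smooth_on_has_derivative[OF smooth_local_rep] by blast

lemma local_rep_overlap:
  "d \<in> atlas N \<Longrightarrow> y \<in> reg c d \<Longrightarrow> y \<in> reg c e \<Longrightarrow> local_rep c d u y \<in> B.overlap d e"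
  by (simp add: local_rep_eq reg_def B.overlap_def B.cinv_cmap)

lemma fder_local_rep_target:
  assumes c: "c \<in> atlas M" and d: "d \<in> atlas N" "e \<in> atlas N" and y: "y \<in> reg c d" "y \<in> reg c e"
  shows "fder (local_rep c e u) y v = fder (transition d e) (local_rep c d u y) (fder (local_rep c d u) y v)"
proof -
  have "((\<lambda>z. transition d e (local_rep c d u z)) has_derivative
     (\<lambda>v. fder (transition d e) (local_rep c d u y) (fder (local_rep c d u) y v))) (at y)"
    by (intro has_derivative_compose[OF local_rep_has_derivative[OF c d(1) y(1)]]
        B.transition_has_derivative d local_rep_overlap y)
  then have "(local_rep c e u has_derivative
     (\<lambda>v. fder (transition d e) (local_rep c d u y) (fder (local_rep c d u) y v))) (at y)"
    by (rule has_derivative_transform_within_open[OF _ open_reg[OF c d(1)] y(1)])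
       (simp add: local_rep_eq B.transition_eq reg_def B.cinv_cmap d)
  then show ?thesis by (simp add: fder_eqI)
qed

lemma fder_local_rep_source:
  assumes c: "c \<in> atlas M" "c' \<in> atlas M" and d: "d \<in> atlas N" and y: "y \<in> A.overlap c c'" "y \<in> reg c d"
  shows "transition c c' y \<in> reg c' d"
    "local_rep c' d u (transition c c' y) = local_rep c d u y"
    "fder (local_rep c d u) y v = fder (local_rep c' d u) (transition c c' y) (fder (transition c c') y v)"
proof -
  have eq: "local_rep c' d u (transition c c' z) = local_rep c d u z" if "z \<in> A.overlap c c'" for z
    using that by (simp add: local_rep_eq A.transition_eq A.cinv_cmap c A.overlap_def)
  show *: "transition c c' y \<in> reg c' d"
    using y by (simp add: reg_def A.transition_eq A.cinv_cmap c A.overlap_def A.cmap_in)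
  show "local_rep c' d u (transition c c' y) = local_rep c d u y" using eq y by simp
  have "((\<lambda>z. local_rep c' d u (transition c c' z)) has_derivative
     (\<lambda>v. fder (local_rep c' d u) (transition c c' y) (fder (transition c c') y v))) (at y)"
    by (intro has_derivative_compose[OF A.transition_has_derivative[OF c y(1)]] local_rep_has_derivative c d *)
  then have "(local_rep c d u has_derivative
     (\<lambda>v. fder (local_rep c' d u) (transition c c' y) (fder (transition c c') y v))) (at y)"
    by (rule has_derivative_transform_within_open[OF _ A.open_overlap[OF c] y(1)]) (simp add: eq)
  then show "fder (local_rep c d u) y v = fder (local_rep c' d u) (transition c c' y) (fder (transition c c') y v)"
    by (simp add: fder_eqI)
qed

lemma chart_at_image:
  assumes c: "c \<in> atlas M" and y: "y \<in> cimg c"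
  shows "chart_at N (u (cinv c y)) \<in> atlas N" "y \<in> reg c (chart_at N (u (cinv c y)))"
proof -
  have "u (cinv c y) \<in> topspace (mtop N)"
    using A.cdom_subset[OF c] A.cinv_in[OF y] by (intro u_in) auto
  from B.chart_at_spec[OF this] show "chart_at N (u (cinv c y)) \<in> atlas N" "y \<in> reg c (chart_at N (u (cinv c y)))"
    using y by (auto simp: reg_def)
qed

text \<open>The Jacobian of the change from the fixed chart \<open>d\<close> to the one that
  \<open>chart_at\<close> selects at the image point. All notions defined by \<open>chart_at\<close>
  are compared with chart \<open>d\<close> through it.\<close>

definition jac :: "('a, 'm) chart \<Rightarrow> ('b, 'n) chart \<Rightarrow> real^'m \<Rightarrow> real^'n \<Rightarrow> real^'n" where
  "jac c d y = fder (transition d (chart_at N (u (cinv c y)))) (local_rep c d u y)"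

context
  fixes c d y assumes c: "c \<in> atlas M" and d: "d \<in> atlas N" and y: "y \<in> reg c d"
begin

lemma y_cimg: "y \<in> cimg c"
  using y by (simp add: reg_def)

lemma jac_overlap: "local_rep c d u y \<in> B.overlap d (chart_at N (u (cinv c y)))"
  using local_rep_overlap[OF d y chart_at_image(2)[OF c y_cimg]] .

lemma bij_jac: "bij (jac c d y)" and jac_linear: "linear (jac c d y)"
  unfolding jac_def
  using B.bij_fder_transition[OF d chart_at_image(1)[OF c y_cimg] jac_overlap]
    B.transition_linear[OF d chart_at_image(1)[OF c y_cimg] jac_overlap] by auto

lemma jac_zero_iff: "jac c d y a = 0 \<longleftrightarrow> a = 0"
  using linear_injective_0[OF jac_linear] bij_is_inj[OF bij_jac] linear_0[OF jac_linear] by auto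

lemma differential_eq: "differential M N u c y v = jac c d y (fder (local_rep c d u) y v)"
  unfolding differential_def jac_def
  using fder_local_rep_target[OF c d chart_at_image(1)[OF c y_cimg] y chart_at_image(2)[OF c y_cimg]] .

lemma transition_local_rep: "transition d e (local_rep c d u y) = cmap e (u (cinv c y))"
  using y by (simp add: B.transition_eq local_rep_eq reg_def B.cinv_cmap d)

lemma target_inner_eq:
  "target_inner M N u c y (jac c d y a) (jac c d y b) = a \<bullet> (gram N d (local_rep c d u y) *v b)"
  using B.ginner_transition[OF d chart_at_image(1)[OF c y_cimg] jac_overlap, of a b]
  by (simp add: target_inner_def Let_def jac_def transition_local_rep ginner_def)

end

end

locale riem_map = riem_smooth_map M N u
  for M :: "('a, 'm::finite) riemannian" and N :: "('b, 'n::finite) riemannian" and u +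
  assumes subm: "submersion M N u"
begin

lemma surj_fder_local_rep:
  assumes c: "c \<in> atlas M" and d: "d \<in> atlas N" and y: "y \<in> reg c d"
  shows "surj (fder (local_rep c d u) y)"
proof -
  have "surj (differential M N u c y)" using subm c y_cimg[OF assms] unfolding submersion_def by blast
  then have s: "\<exists>v. differential M N u c y v = z" for z by (metis surjD)
  have "\<exists>v. fder (local_rep c d u) y v = a" for a
  proof -
    obtain v where "differential M N u c y v = jac c d y a" using s by blast
    then show ?thesis unfolding differential_eq[OF assms] using bij_is_inj[OF bij_jac[OF assms]] by (auto dest: injD)
  qed
  then show ?thesis by (metis surjI)
qed

lemma local_map: "c \<in> atlas M \<Longrightarrow> d \<in> atlas N \<Longrightarrow>
   local_map (reg c d) (gram M c) (cimg d) (gram N d) (local_rep c d u)"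
proof -
  assume c: "c \<in> atlas M" and d: "d \<in> atlas N"
  interpret S: metric_field "cimg c" "gram M c" by (rule A.metric_field_chart[OF c])
  interpret T: metric_field "cimg d" "gram N d" by (rule B.metric_field_chart[OF d])
  have sub: "reg c d \<subseteq> cimg c" by (auto simp: reg_def)
  show ?thesis
  proof
    show "smooth_on (reg c d) (gram M c)" using smooth_on_subset[OF S.smooth_g sub] .
  qed (use open_reg[OF c d] S.sym_g S.pos_g smooth_local_rep[OF c d] local_rep_in
      surj_fder_local_rep[OF c d] sub in auto)
qed

lemma vertical_eq: "c \<in> atlas M \<Longrightarrow> d \<in> atlas N \<Longrightarrow> y \<in> reg c d \<Longrightarrow>
   vertical M N u c y = {v. fder (local_rep c d u) y v = 0}"
  unfolding vertical_def by (simp add: differential_eq jac_zero_iff)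

lemma horizontal_eq:
  assumes "c \<in> atlas M" "d \<in> atlas N" "y \<in> reg c d"
  shows "horizontal M N u c y = local_map.hor (gram M c) (local_rep c d u) y"
proof -
  interpret local_map "reg c d" "gram M c" "cimg d" "gram N d" "local_rep c d u" by (rule local_map[OF assms(1,2)])
  show ?thesis unfolding horizontal_def hor_def vertical_eq[OF assms] ginner_def by auto
qed

end

section \<open>Conformality and the pullback in charts\<close>

context riem_map
begin

text \<open>\<open>vertical_part\<close> is a definite description, so unique existence is required:
  \<open>hor_decomp\<close> gives a candidate, and the difference of two candidates is both vertical
  and horizontal, hence of length 0.\<close>

lemma vertical_part_in:
  assumes c: "c \<in> atlas M" and y: "y \<in> cimg c"
  shows "vertical_part M N u c y X \<in> vertical M N u c y"
proof -
  define d where "d = chart_at N (u (cinv c y))"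
  have d: "d \<in> atlas N" "y \<in> reg c d" unfolding d_def using chart_at_image[OF c y] by auto
  interpret local_map "reg c d" "gram M c" "cimg d" "gram N d" "local_rep c d u" by (rule local_map[OF c d(1)])
  have V: "v \<in> vertical M N u c y \<longleftrightarrow> fder (local_rep c d u) y v = 0" for v
    unfolding vertical_eq[OF c d] by simp
  have H: "horizontal M N u c y = hor y" by (rule horizontal_eq[OF c d])
  obtain a v where v: "X = hv y a + v" "fder (local_rep c d u) y v = 0" using hor_decomp[OF d(2)] by blast
  have "\<exists>!v. v \<in> vertical M N u c y \<and> X - v \<in> horizontal M N u c y"
  proof (rule ex1I)
    show "v \<in> vertical M N u c y \<and> X - v \<in> horizontal M N u c y"
      using v hv_hor[OF d(2), of a] by (simp add: V H)
    fix w assume w: "w \<in> vertical M N u c y \<and> X - w \<in> horizontal M N u c y"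
    have 1: "fder (local_rep c d u) y (v - w) = 0"
      using v(2) w by (simp add: V linear_diff[OF df_linear[OF d(2)]])
    have "hv y a \<bullet> (gram M c y *v (v - w)) = 0" "(X - w) \<bullet> (gram M c y *v (v - w)) = 0"
      using hv_hor[OF d(2), of a] w 1 unfolding H hor_def by auto
    moreover have "v - w = (X - w) - hv y a" using v(1) by simp
    ultimately have "(v - w) \<bullet> (gram M c y *v (v - w)) = 0" by (metis inner_diff_left diff_zero)
    then show "w = v" using S.pos_g[OF d(2), of "v - w"] by (metis less_irrefl right_minus_eq)
  qed
  from theI'[OF this] show ?thesis unfolding vertical_part_def by simp
qed

lemma subspace_vertical: "c \<in> atlas M \<Longrightarrow> y \<in> cimg c \<Longrightarrow> subspace (vertical M N u c y)"
proof -
  assume c: "c \<in> atlas M" and y: "y \<in> cimg c"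
  define d where "d = chart_at N (u (cinv c y))"
  have d: "d \<in> atlas N" "y \<in> reg c d" unfolding d_def using chart_at_image[OF c y] by auto
  interpret local_map "reg c d" "gram M c" "cimg d" "gram N d" "local_rep c d u" by (rule local_map[OF c d(1)])
  show ?thesis unfolding vertical_eq[OF c d] by (rule linear_subspace_kernel[OF df_linear[OF d(2)]])
qed

text \<open>Whatever frame the definition supplies, the vector is a linear combination of vertical
  parts.\<close>

lemma mean_curvature_vertical:
  assumes "horizontal_mean_curvature M N u Z" and c: "c \<in> atlas M" and y: "y \<in> cimg c"
  shows "Z c y \<in> vertical M N u c y"
proof -
  obtain e :: "'n \<Rightarrow> real^'m \<Rightarrow> real^'m" where "Z c y = (1 / real CARD('n)) *\<^sub>R
          (\<Sum>i\<in>UNIV. vertical_part M N u c y (levi_civita M c (e i) (e i) y))"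
    using assms unfolding horizontal_mean_curvature_def by blast
  moreover have "\<dots> \<in> vertical M N u c y"
    by (intro subspace_scale subspace_sum subspace_vertical vertical_part_in c y)
  ultimately show ?thesis by simp
qed

lemma conformal_map:
  assumes hc: "horizontally_conformal M N u lam" and c: "c \<in> atlas M" and d: "d \<in> atlas N"
  shows "conformal_map (reg c d) (gram M c) (cimg d) (gram N d) (local_rep c d u) (\<lambda>y. (lam (cinv c y))\<^sup>2)"
proof -
  interpret local_map "reg c d" "gram M c" "cimg d" "gram N d" "local_rep c d u" by (rule local_map[OF c d])
  show ?thesis
  proof
    have "smooth_on (cimg c) (\<lambda>y. lam (cinv c y))"
      using hc c unfolding horizontally_conformal_def smooth_fun_def by (simp add: o_def)
    then have "smooth_on (cimg c) (\<lambda>y. lam (cinv c y) * lam (cinv c y))"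
      using A.open_cimg[OF c] by (intro smooth_on_mult)
    then show "smooth_on (reg c d) (\<lambda>y. (lam (cinv c y))\<^sup>2)"
      unfolding power2_eq_square by (rule smooth_on_subset) (auto simp: reg_def)
    fix y assume y: "y \<in> reg c d"
    then have yc: "y \<in> cimg c" by (simp add: reg_def)
    have "lam (cinv c y) > 0"
      using hc A.cdom_subset[OF c] A.cinv_in[OF yc] unfolding horizontally_conformal_def by blast
    then show "(lam (cinv c y))\<^sup>2 > 0" by simp
    fix X Y assume XY: "X \<in> hor y" "Y \<in> hor y"
    then have "target_inner M N u c y (differential M N u c y X) (differential M N u c y Y)
        = (lam (cinv c y))\<^sup>2 * ginner M c y X Y"
      using hc c yc horizontal_eq[OF c d y] unfolding horizontally_conformal_def by blast
    then show "fder (local_rep c d u) y X \<bullet> (gram N d (local_rep c d u y) *v fder (local_rep c d u) y Y)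
        = (lam (cinv c y))\<^sup>2 * (X \<bullet> (gram M c y *v Y))"
      by (simp add: differential_eq[OF c d y] target_inner_eq[OF c d y] ginner_def)
  qed
qed

lemma grad_inner:
  assumes c: "c \<in> atlas M" and y: "y \<in> cimg c" and diff: "(\<lambda>y. f (cinv c y)) differentiable (at y)"
  shows "v \<bullet> (gram M c y *v grad M f c y) = fder (\<lambda>y. f (cinv c y)) y v"
proof -
  interpret metric_field "cimg c" "gram M c" by (rule A.metric_field_chart[OF c])
  have "v \<bullet> (gram M c y *v grad M f c y) = (\<Sum>i\<in>UNIV. v $ i * fder (\<lambda>y. f (cinv c y)) y (axis i 1))"
    by (simp add: grad_def g_inv_mv[OF y] inner_vec_def o_def)
  then show ?thesis
    using linear_axis_expansion[OF linear_frechet_derivative[OF diff], of v] by simp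
qed

lemma dilation_horizontal:
  assumes hc: "horizontally_conformal M N u lam"
    and mc: "horizontal_mean_curvature M N u
           (\<lambda>c y. (1 / (2 * (lam (cinv c y))\<^sup>2)) *\<^sub>R grad M (\<lambda>x. (lam x)\<^sup>2) c y)"
    and c: "c \<in> atlas M" and d: "d \<in> atlas N" and y: "y \<in> reg c d"
  shows "fder (\<lambda>y. (lam (cinv c y))\<^sup>2) y (local_map.hv (gram M c) (local_rep c d u) y a) = 0"
proof -
  interpret conformal_map "reg c d" "gram M c" "cimg d" "gram N d" "local_rep c d u" "\<lambda>y. (lam (cinv c y))\<^sup>2"
    by (rule conformal_map[OF hc c d])
  have yc: "y \<in> cimg c" using y by (simp add: reg_def)
  let ?k = "1 / (2 * (lam (cinv c y))\<^sup>2)" and ?g = "grad M (\<lambda>x. (lam x)\<^sup>2) c y"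
  have k: "?k \<noteq> 0" using l_pos[OF y] by simp
  have "?k *\<^sub>R ?g \<in> vertical M N u c y" by (rule mean_curvature_vertical[OF mc c yc])
  then have "(1 / ?k) *\<^sub>R (?k *\<^sub>R ?g) \<in> vertical M N u c y"
    by (rule subspace_scale[OF subspace_vertical[OF c yc]])
  then have "?g \<in> vertical M N u c y" using k by simp
  then have "fder (local_rep c d u) y ?g = 0" unfolding vertical_eq[OF c d y] by simp
  then have "hv y a \<bullet> (gram M c y *v ?g) = 0"
    using hv_hor[OF y, of a] unfolding hor_def by blast
  then show ?thesis
    using grad_inner[OF c yc smooth_on_imp_differentiable[OF smooth_l y], of "hv y a"] by simp
qed

section \<open>The pulled back volume form in charts\<close>

lemma orientation_sgn:
  assumes "orientation N sg" and c: "c \<in> atlas M" and d: "d \<in> atlas N" "e \<in> atlas N" and y: "y \<in> reg c d" "y \<in> reg c e"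
  shows "sg d (local_rep c d u y) = sgn (det (matrix (fder (transition d e) (local_rep c d u y)))) * sg e (local_rep c e u y)"
    "sg d (local_rep c d u y) \<in> {1, -1}"
proof -
  have "local_rep c d u y \<in> B.overlap d e" by (rule local_rep_overlap[OF d(1) y])
  then have 1: "local_rep c d u y \<in> cimg d" "cinv d (local_rep c d u y) \<in> cdom e" by (auto simp: B.overlap_def)
  have "transition d e (local_rep c d u y) = local_rep c e u y"
    using transition_local_rep[OF c d(1) y(1)] by (simp add: local_rep_eq)
  moreover have "sg d (local_rep c d u y) = sgn (det (matrix (fder (transition d e) (local_rep c d u y))))
       * sg e (transition d e (local_rep c d u y))"
    using assms(1) d 1 unfolding orientation_def by blast
  ultimately show "sg d (local_rep c d u y) = sgn (det (matrix (fder (transition d e) (local_rep c d u y)))) * sg e (local_rep c e u y)"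
    by simp
  show "sg d (local_rep c d u y) \<in> {1, -1}" using assms(1) d 1 unfolding orientation_def by blast
qed

text \<open>Two values in {1, -1} at distance below 1 are equal, so continuity suffices. The sign
  can then be treated as a constant when the form is differentiated.\<close>

lemma orientation_locally_constant:
  assumes o: "orientation N sg" and c: "c \<in> atlas M" and d: "d \<in> atlas N" and y: "y \<in> reg c d"
  obtains T where "open T" "y \<in> T" "T \<subseteq> reg c d"
    "\<And>z. z \<in> T \<Longrightarrow> sg d (local_rep c d u z) = sg d (local_rep c d u y)"
proof
  let ?s = "\<lambda>z. sg d (local_rep c d u z)"
  let ?T = "reg c d \<inter> ?s -` ball (?s y) 1"
  have "continuous_on (cimg d) (sg d)" using o d unfolding orientation_def by blast
  then have "continuous_on (reg c d) ?s"
    by (rule continuous_on_compose2[OF _ smooth_on_continuous[OF smooth_local_rep[OF c d]]]) (auto intro: local_rep_in)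
  then show "open ?T" by (intro continuous_open_preimage open_reg c d) auto
  show "y \<in> ?T" "?T \<subseteq> reg c d" using y by auto
  show "?s z = ?s y" if "z \<in> ?T" for z
    using orientation_sgn(2)[OF o c d d, of z] orientation_sgn(2)[OF o c d d y y] that by (auto simp: dist_real_def)
qed

text \<open>Changing the target chart multiplies the determinant by det J, while density and sign
  absorb \<bar>det J\<bar> and sgn (det J). Hence the value computed with \<open>chart_at\<close> is
  the one computed with \<open>d\<close>.\<close>

lemma pullback_eq:
  assumes o: "orientation N sg" and c: "c \<in> atlas M" and d: "d \<in> atlas N" and y: "y \<in> reg c d"
    and len: "length vs = CARD('n)"
  shows "pullback M N u (volume_form N sg) c y vs
    = local_map.vpull (gram N d) (local_rep c d u) (sg d (local_rep c d u y)) y vs"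
proof -
  interpret local_map "reg c d" "gram M c" "cimg d" "gram N d" "local_rep c d u" by (rule local_map[OF c d])
  define e where "e = chart_at N (u (cinv c y))"
  have yc: "y \<in> cimg c" using y by (simp add: reg_def)
  have e: "e \<in> atlas N" "y \<in> reg c e" unfolding e_def using chart_at_image[OF c yc] by auto
  let ?J = "jac c d y" and ?f = "local_rep c d u"
  have J: "?J = fder (transition d e) (?f y)" unfolding jac_def e_def ..
  have tr: "transition d e (?f y) = cmap e (u (cinv c y))" by (rule transition_local_rep[OF c d y])
  have ov: "?f y \<in> B.overlap d e" by (rule local_rep_overlap[OF d y e(2)])
  have dJ: "det (matrix ?J) \<noteq> 0" unfolding J by (rule B.det_transition[OF d e(1) ov])
  have sq: "sqrt (det (gram N d (?f y))) = \<bar>det (matrix ?J)\<bar> * sqrt (det (gram N e (cmap e (u (cinv c y)))))"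
    unfolding J using B.sqrt_det_gram_transition[OF d e(1) ov] unfolding tr .
  have sg: "sg d (?f y) = sgn (det (matrix ?J)) * sg e (cmap e (u (cinv c y)))"
    unfolding J using orientation_sgn(1)[OF o c d e(1) y e(2)] by (simp add: local_rep_eq)
  have "((\<chi> i. map (differential M N u c y) vs ! coord_index i) :: real^'n^'n)
     = (\<chi> i. map (fder ?f y) vs ! coord_index i) ** transpose (matrix ?J)"
  proof -
    have "matrix ?J *v x = ?J x" for x by (rule fun_cong[OF matrix_vector_mul(2)[OF jac_linear[OF c d y]]])
    then have "?J x $ j = (\<Sum>k\<in>UNIV. x $ k * matrix ?J $ j $ k)" for x j
      by (metis (no_types, lifting) matrix_vector_mult_def mult.commute sum.cong vec_lambda_beta)
    then show ?thesis
      using len coord_index_less[where 'n='n]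
      by (simp add: vec_eq_iff matrix_matrix_mult_def transpose_def differential_eq[OF c d y])
  qed
  then have "det ((\<chi> i. map (differential M N u c y) vs ! coord_index i) :: real^'n^'n) = det (matrix ?J) * detl (map (fder ?f y) vs)"
    by (simp add: det_mul detl_def)
  then have "pullback M N u (volume_form N sg) c y vs = sg e (cmap e (u (cinv c y))) *
      sqrt (det (gram N e (cmap e (u (cinv c y))))) * (det (matrix ?J) * detl (map (fder ?f y) vs))"
    by (simp add: pullback_def Let_def volume_form_def e_def)
  also have "det (matrix ?J) = sgn (det (matrix ?J)) * \<bar>det (matrix ?J)\<bar>" by (simp add: sgn_mult_abs)
  finally show ?thesis unfolding vpull_def sq sg by (simp add: mult_ac)
qed

lemma pullback_local:
  assumes o: "orientation N sg" and c: "c \<in> atlas M" and d: "d \<in> atlas N" and y: "y \<in> reg c d"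
  obtains T where "open T" "y \<in> T" "T \<subseteq> reg c d"
    "\<And>z vs. z \<in> T \<Longrightarrow> length vs = CARD('n) \<Longrightarrow> pullback M N u (volume_form N sg) c z vs
    = local_map.vpull (gram N d) (local_rep c d u) (sg d (local_rep c d u y)) z vs"
proof (rule orientation_locally_constant[OF assms])
  fix T assume T: "open T" "y \<in> T" "T \<subseteq> reg c d"
    and sg: "\<And>z. z \<in> T \<Longrightarrow> sg d (local_rep c d u z) = sg d (local_rep c d u y)"
  show thesis
  proof (rule that[OF T])
    fix z and vs :: "(real^'m) list" assume "z \<in> T" "length vs = CARD('n)"
    then show "pullback M N u (volume_form N sg) c z vs
      = local_map.vpull (gram N d) (local_rep c d u) (sg d (local_rep c d u y)) z vs"
      using pullback_eq[OF o c d, of z vs] sg[of z] T by auto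
  qed
qed

lemma ext_deriv_pullback:
  assumes o: "orientation N sg" and c: "c \<in> atlas M" and y: "y \<in> cimg c" and len: "length vs = CARD('n) + 1"
  shows "ext_deriv (pullback M N u (volume_form N sg)) c y vs = 0"
proof -
  define d where "d = chart_at N (u (cinv c y))"
  have d: "d \<in> atlas N" "y \<in> reg c d" unfolding d_def using chart_at_image[OF c y] by auto
  interpret local_map "reg c d" "gram M c" "cimg d" "gram N d" "local_rep c d u" by (rule local_map[OF c d(1)])
  obtain T where T: "open T" "y \<in> T"
    "\<And>z vs. z \<in> T \<Longrightarrow> length vs = CARD('n) \<Longrightarrow> pullback M N u (volume_form N sg) c z vs
    = vpull (sg d (local_rep c d u y)) z vs"
    by (rule pullback_local[OF o c d]) blast
  have "fder (\<lambda>z. pullback M N u (volume_form N sg) c z (take i vs @ drop (Suc i) vs)) y w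
     = fder (\<lambda>z. vpull (sg d (local_rep c d u y)) z (take i vs @ drop (Suc i) vs)) y w" if "i < length vs" for i w
    using fder_cong_open[OF T(1,2), of "\<lambda>z. pullback M N u (volume_form N sg) c z (take i vs @ drop (Suc i) vs)"
       "\<lambda>z. vpull (sg d (local_rep c d u y)) z (take i vs @ drop (Suc i) vs)"] T(3) len that by simp
  then have "ext_deriv (pullback M N u (volume_form N sg)) c y vs
     = (\<Sum>i<length vs. (-1) ^ i * fder (\<lambda>z. vpull (sg d (local_rep c d u y)) z (take i vs @ drop (Suc i) vs)) y (vs ! i))"
    unfolding ext_deriv_def by (intro sum.cong refl) simp
  then show ?thesis using vpull_closed[OF d(2)] len by simp
qed

lemma codiff_pullback:
  assumes o: "orientation N sg" and c: "c \<in> atlas M" and d: "d \<in> atlas N" and y: "y \<in> reg c d"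
    and len: "Suc (length vs) = CARD('n)"
  shows "codiff M (pullback M N u (volume_form N sg)) c y vs
    = local_map.vcodiff (gram M c) (gram N d) (local_rep c d u) (sg d (local_rep c d u y)) y vs"
proof -
  interpret local_map "reg c d" "gram M c" "cimg d" "gram N d" "local_rep c d u" by (rule local_map[OF c d])
  obtain T where T: "open T" "y \<in> T"
    "\<And>z vs. z \<in> T \<Longrightarrow> length vs = CARD('n) \<Longrightarrow> pullback M N u (volume_form N sg) c z vs
    = vpull (sg d (local_rep c d u y)) z vs"
    by (rule pullback_local[OF o c d y]) blast
  have "fder (\<lambda>z. pullback M N u (volume_form N sg) c z vs) y w
     = fder (\<lambda>z. vpull (sg d (local_rep c d u y)) z vs) y w" if "length vs = CARD('n)" for vs w
    using fder_cong_open[OF T(1,2), of "\<lambda>z. pullback M N u (volume_form N sg) c z vs"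
       "\<lambda>z. vpull (sg d (local_rep c d u y)) z vs"] T(3) that by simp
  then have "cov_deriv M (pullback M N u (volume_form N sg)) c y w vs = vcov (sg d (local_rep c d u y)) y w vs"
    if "length vs = CARD('n)" for w vs
    unfolding cov_deriv_def vcov_def christoffel_eq_chr using T(3)[OF T(2)] that by simp
  then show ?thesis unfolding codiff_def vcodiff_def using len by simp
qed

lemma differential_form_pullback:
  assumes o: "orientation N sg"
  shows "differential_form M CARD('n) (pullback M N u (volume_form N sg))"
  unfolding differential_form_def
proof (intro ballI allI impI conjI)
  let ?w = "pullback M N u (volume_form N sg)"
  fix c and vs :: "(real^'m) list" assume c: "c \<in> atlas M" and len: "length vs = CARD('n)"
  show "smooth_on (cimg c) (\<lambda>y. ?w c y vs)"
  proof (rule smooth_on_local)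
    fix y assume y: "y \<in> cimg c"
    define d where "d = chart_at N (u (cinv c y))"
    have d: "d \<in> atlas N" "y \<in> reg c d" unfolding d_def using chart_at_image[OF c y] by auto
    interpret local_map "reg c d" "gram M c" "cimg d" "gram N d" "local_rep c d u" by (rule local_map[OF c d(1)])
    obtain T where T: "open T" "y \<in> T" "T \<subseteq> reg c d"
      "\<And>z vs. z \<in> T \<Longrightarrow> length vs = CARD('n) \<Longrightarrow> ?w c z vs = vpull (sg d (local_rep c d u y)) z vs"
      by (rule pullback_local[OF o c d]) blast
    have smh: "smooth_on (reg c d) (\<lambda>z. gram N d (local_rep c d u z))"
      by (rule smooth_on_compose[OF S.open_D T.open_D T.smooth_g smooth_f]) (auto intro: f_mem)
    have "smooth_on (reg c d) (\<lambda>z. sg d (local_rep c d u y) * sqrt (det (gram N d (local_rep c d u z)))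
        * det (\<chi> i. fder (local_rep c d u) z (vs ! coord_index i)))"
      using T.det_g[OF f_mem]
      by (intro smooth_on_mult smooth_on_const smooth_on_sqrt smooth_on_det smh smooth_on_vecI S.open_D)
         (auto intro!: smooth_on_vec_nth S.open_D smooth_on_fder smooth_f)
    moreover have "?w c z vs = sg d (local_rep c d u y) * sqrt (det (gram N d (local_rep c d u z)))
        * det (\<chi> i. fder (local_rep c d u) z (vs ! coord_index i))" if "z \<in> T" for z
      using T(4)[OF that len] len coord_index_less[where 'n='n] by (simp add: vpull_def detl_def)
    ultimately show "\<exists>T g. open T \<and> y \<in> T \<and> smooth_on T g \<and> (\<forall>z\<in>T. ?w c z vs = g z)"
      using T(1-3) smooth_on_subset by blast
  qed
  fix y assume y: "y \<in> cimg c"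
  define d where "d = chart_at N (u (cinv c y))"
  have d: "d \<in> atlas N" "y \<in> reg c d" unfolding d_def using chart_at_image[OF c y] by auto
  interpret local_map "reg c d" "gram M c" "cimg d" "gram N d" "local_rep c d u" by (rule local_map[OF c d(1)])
  have eq: "?w c y vs = vpull (sg d (local_rep c d u y)) y vs" if "length vs = CARD('n)" for vs
    by (rule pullback_eq[OF o c d that])
  show "linear (\<lambda>v. ?w c y (vs[i := v]))" if "i < CARD('n)" for i
  proof -
    have "linear (\<lambda>v. detl ((map (fder (local_rep c d u) y) vs)[i := v]))"
      using that len by (intro detl_linear) auto
    from linear_compose[OF df_linear[OF d(2)] this]
    have "linear (\<lambda>v. detl (map (fder (local_rep c d u) y) (vs[i := v])))" by (simp add: o_def map_update)
    from linear_compose_scale_right[OF this] show ?thesis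
      using len by (simp add: eq vpull_def)
  qed
  show "?w c y vs = 0" if "i < j \<and> j < CARD('n) \<and> vs ! i = vs ! j" for i j
  proof -
    have "detl (map (fder (local_rep c d u) y) vs) = 0"
      using that len by (intro detl_alternating[of i j]) auto
    then show ?thesis by (simp add: eq len vpull_def)
  qed
  fix c' assume c': "c' \<in> atlas M" and "cinv c y \<in> cdom c'"
  then have y': "y \<in> A.overlap c c'" using y by (simp add: A.overlap_def)
  note s = fder_local_rep_source[OF c c' d(1) y' d(2)]
  show "?w c y vs = ?w c' (transition c c' y) (map (fder (transition c c') y) vs)"
    unfolding pullback_eq[OF o c d len]
    by (subst pullback_eq[OF o c' d(1) s(1)])
       (simp_all add: len local_map.vpull_def[OF local_map[OF c d(1)]] local_map.vpull_def[OF local_map[OF c' d(1)]]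
         s(2,3)[symmetric] o_def)
qed

lemma harmonic_iff_integrable:
  assumes o: "orientation N sg" and hc: "horizontally_conformal M N u lam"
    and mc: "horizontal_mean_curvature M N u
           (\<lambda>c y. (1 / (2 * (lam (cinv c y))\<^sup>2)) *\<^sub>R grad M (\<lambda>x. (lam x)\<^sup>2) c y)"
    and tension: "\<And>c d y. c \<in> atlas M \<Longrightarrow> d \<in> atlas N \<Longrightarrow> y \<in> reg c d \<Longrightarrow>
       local_map.tension (gram M c) (gram N d) (local_rep c d u) y = 0"
  shows "harmonic_form M CARD('n) (pullback M N u (volume_form N sg)) \<longleftrightarrow> horizontal_completely_integrable M N u"
proof
  assume harm: "harmonic_form M CARD('n) (pullback M N u (volume_form N sg))"
  show "horizontal_completely_integrable M N u"
    unfolding horizontal_completely_integrable_def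
  proof (intro ballI allI impI)
    fix c W X Y y
    assume c: "c \<in> atlas M" and yW: "y \<in> W" and a: "open W \<and> W \<subseteq> cimg c \<and> smooth_on W X \<and> smooth_on W Y \<and>
        (\<forall>y\<in>W. X y \<in> horizontal M N u c y \<and> Y y \<in> horizontal M N u c y)"
    have yc: "y \<in> cimg c" using a yW by blast
    define d where "d = chart_at N (u (cinv c y))"
    have d: "d \<in> atlas N" "y \<in> reg c d" unfolding d_def using chart_at_image[OF c yc] by auto
    interpret conformal_map "reg c d" "gram M c" "cimg d" "gram N d" "local_rep c d u" "\<lambda>y. (lam (cinv c y))\<^sup>2"
      by (rule conformal_map[OF hc c d(1)])
    have "vcodiff (sg d (local_rep c d u y)) y vs = 0" if "Suc (length vs) = CARD('n)" for vs
      using harm c yc that codiff_pullback[OF o c d that] unfolding harmonic_form_def by auto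
    then have "sff_symmetric y"
      using orientation_sgn(2)[OF o c d(1) d(1) d(2) d(2)] by (intro vcodiff_zero_imp_symmetric[OF d(2), of "sg d (local_rep c d u y)"]) auto
    \<comment> \<open>The domain \<open>W\<close> of the fields may leave \<open>reg c d\<close>;
      the bracket at \<open>y\<close> depends only on their values near \<open>y\<close>, so the
      intersection suffices.\<close>
    then have "lie_bracket X Y y \<in> hor y"
      using a yW d(2) S.open_D horizontal_eq[OF c d(1)]
      by (intro sff_symmetric_imp_involutive[of "W \<inter> reg c d"]) (auto intro: smooth_on_subset)
    then show "lie_bracket X Y y \<in> horizontal M N u c y" by (simp add: horizontal_eq[OF c d])
  qed
next
  assume int: "horizontal_completely_integrable M N u"
  have "codiff M (pullback M N u (volume_form N sg)) c y vs = 0"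
    if c: "c \<in> atlas M" and yc: "y \<in> cimg c" and len: "length vs + 1 = CARD('n)" for c y vs
  proof -
    define d where "d = chart_at N (u (cinv c y))"
    have d: "d \<in> atlas N" "y \<in> reg c d" unfolding d_def using chart_at_image[OF c yc] by auto
    interpret conformal_map "reg c d" "gram M c" "cimg d" "gram N d" "local_rep c d u" "\<lambda>y. (lam (cinv c y))\<^sup>2"
      by (rule conformal_map[OF hc c d(1)])
    have sub: "reg c d \<subseteq> cimg c" by (auto simp: reg_def)
    have "sff_symmetric y"
    proof (rule involutive_imp_sff_symmetric[OF d(2)])
      fix X Y assume "smooth_on (reg c d) X" "smooth_on (reg c d) Y"
        "\<And>z. z \<in> reg c d \<Longrightarrow> X z \<in> hor z \<and> Y z \<in> hor z"
      then have "lie_bracket X Y y \<in> horizontal M N u c y"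
        using int c d S.open_D sub horizontal_eq[OF c d(1)] unfolding horizontal_completely_integrable_def by blast
      then show "lie_bracket X Y y \<in> hor y" by (simp add: horizontal_eq[OF c d])
    qed
    then show ?thesis
      unfolding codiff_pullback[OF o c d len[simplified]]
      using len tension[OF c d] sff_hor_hor[OF d(2) dilation_horizontal[OF hc mc c d]]
      by (intro vcodiff_zero[OF d(2)]) auto
  qed
  then show "harmonic_form M CARD('n) (pullback M N u (volume_form N sg))"
    unfolding harmonic_form_def using differential_form_pullback[OF o] ext_deriv_pullback[OF o] by blast
qed

end

section \<open>Change of variables\<close>

text \<open>Passes from extended nonnegative integrals to absolute integrability and the gauge
  integral, the terms in which the change of variables theorem is stated.\<close>

lemma nn_integral_imp_abs_integrable:
  fixes f :: "'a::euclidean_space \<Rightarrow> real"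
  assumes meas: "(\<lambda>x. indicator S x * f x) \<in> borel_measurable borel" and nonneg: "\<And>x. x \<in> S \<Longrightarrow> 0 \<le> f x"
    and fin: "(\<integral>\<^sup>+x\<in>S. ennreal (f x) \<partial>lborel) < \<infinity>"
  shows "f absolutely_integrable_on S" "(\<integral>\<^sup>+x\<in>S. ennreal (f x) \<partial>lborel) = ennreal (integral S f)"
proof -
  have "(\<integral>\<^sup>+x\<in>S. ennreal (f x) \<partial>lborel) = (\<integral>\<^sup>+x. ennreal (indicator S x * f x) \<partial>lborel)"
    by (intro nn_integral_cong) (auto simp: indicator_def)
  then have "(\<lambda>x. indicator S x * f x) integrable_on UNIV"
    using fin nonneg by (intro nn_integral_integrable_on meas) (auto simp: indicator_def)
  then have "(\<lambda>x. if x \<in> S then f x else 0) integrable_on UNIV"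
    by (rule integrable_eq) (auto simp: indicator_def)
  then have i: "f integrable_on S" by (simp add: integrable_restrict_UNIV)
  then show "f absolutely_integrable_on S" using nonneg by (rule nonnegative_absolutely_integrable_1)
  show "(\<integral>\<^sup>+x\<in>S. ennreal (f x) \<partial>lborel) = ennreal (integral S f)"
    using nn_integral_has_integral_lebesgue'[OF nonneg integrable_integral[OF i]] by simp
qed

text \<open>The theorem transfers integrability together with the value of the integral in both
  directions. Hence a finite side determines the other one, and otherwise both are infinite.\<close>

lemma nn_integral_change_of_variables_wellorder:
  fixes f :: "real^'k::{finite,wellorder} \<Rightarrow> real" and g :: "real^'k::_ \<Rightarrow> real^'k::_"
  assumes S: "S \<in> sets borel" and der: "\<And>x. x \<in> S \<Longrightarrow> (g has_derivative g' x) (at x within S)"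
    and inj: "inj_on g S" and nonneg: "\<And>x. 0 \<le> f x"
    and meas: "(\<lambda>x. indicator S x * (\<bar>det (matrix (g' x))\<bar> * f (g x))) \<in> borel_measurable borel"
      "(\<lambda>y. indicator (g ` S) y * f y) \<in> borel_measurable borel"
  shows "(\<integral>\<^sup>+x\<in>S. ennreal (\<bar>det (matrix (g' x))\<bar> * f (g x)) \<partial>lborel) = (\<integral>\<^sup>+y\<in>g ` S. ennreal (f y) \<partial>lborel)"
    (is "?P = ?Q")
proof -
  let ?D = "\<lambda>x. \<bar>det (matrix (g' x))\<bar> * f (g x)"
  have "S \<in> sets lebesgue" using S by (simp add: sets_completionI_sets)
  then have "(\<lambda>x. \<bar>det (matrix (g' x))\<bar> *\<^sub>R vec (f (g x)) :: real ^ 1) absolutely_integrable_on S \<and>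
           integral S (\<lambda>x. \<bar>det (matrix (g' x))\<bar> *\<^sub>R vec (f (g x))) = (vec b :: real ^ 1)
         \<longleftrightarrow> (\<lambda>x. vec (f x) :: real ^ 1) absolutely_integrable_on (g ` S) \<and>
           integral (g ` S) (\<lambda>x. vec (f x)) = (vec b :: real ^ 1)" for b
    by (rule has_absolute_integral_change_of_variables[OF _ der inj])
  then have iff: "?D absolutely_integrable_on S \<and> integral S ?D = b
     \<longleftrightarrow> f absolutely_integrable_on g ` S \<and> integral (g ` S) f = b" for b
    by (simp add: absolutely_integrable_on_1_iff integral_on_1_eq)
  have D0: "0 \<le> ?D x" for x using nonneg by simp
  have conv: "(\<integral>\<^sup>+x\<in>A. ennreal (h x) \<partial>lborel) = ennreal (integral A h)"
    if "h absolutely_integrable_on A" "\<And>x. 0 \<le> h x" for h :: "real^'k::{finite,wellorder} \<Rightarrow> real" and A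
  proof -
    have "h integrable_on A" using that(1) by (simp add: absolutely_integrable_on_def)
    from nn_integral_has_integral_lebesgue'[OF that(2) integrable_integral[OF this]] show ?thesis .
  qed
  consider "?P < \<infinity>" | "?Q < \<infinity>" | "?P = \<infinity>" "?Q = \<infinity>"
    by (cases "?P = \<infinity>"; cases "?Q = \<infinity>") (auto simp: less_top)
  then show ?thesis
  proof cases
    case 1
    note d = nn_integral_imp_abs_integrable[OF meas(1) D0 1]
    have "f absolutely_integrable_on g ` S" "integral (g ` S) f = integral S ?D"
      using iff[of "integral S ?D"] d(1) by blast+
    then show ?thesis using d(2) conv[OF _ nonneg] by simp
  next
    case 2
    note d = nn_integral_imp_abs_integrable[OF meas(2) nonneg 2]
    have "?D absolutely_integrable_on S" "integral S ?D = integral (g ` S) f"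
      using iff[of "integral (g ` S) f"] d(1) by blast+
    then show ?thesis using d(2) conv[OF _ D0] by simp
  qed simp
qed

text \<open>
  The change of variables theorem of the library requires a well-ordered index type, so the
  coordinates are renamed along a bijection to such a type.
\<close>

typedef 'a ranked = "UNIV :: 'a set" ..

instance ranked :: (finite) finite
proof
  have "(UNIV :: 'a ranked set) = Abs_ranked ` UNIV"
    by (auto simp: image_def) (metis Rep_ranked_inverse)
  then show "finite (UNIV :: 'a ranked set)" using finite_imageI[of "UNIV :: 'a set" Abs_ranked] by simp
qed

instantiation ranked :: (finite) wellorder
begin

definition less_eq_ranked :: "'a ranked \<Rightarrow> 'a ranked \<Rightarrow> bool" where
  "less_eq_ranked a b \<longleftrightarrow> coord_index (Rep_ranked a) \<le> coord_index (Rep_ranked b)"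

definition less_ranked :: "'a ranked \<Rightarrow> 'a ranked \<Rightarrow> bool" where
  "less_ranked a b \<longleftrightarrow> coord_index (Rep_ranked a) < coord_index (Rep_ranked b)"

instance
proof
  fix P :: "'a ranked \<Rightarrow> bool" and a
  assume step: "\<And>x. (\<And>y. y < x \<Longrightarrow> P y) \<Longrightarrow> P x"
  show "P a"
  proof (induction a rule: measure_induct_rule[where f = "\<lambda>a. coord_index (Rep_ranked a)"])
    case (less x)
    then show ?case by (intro step[of x]) (auto simp: less_ranked_def)
  qed
qed (auto simp: less_eq_ranked_def less_ranked_def coord_index_eq_iff Rep_ranked_inject)

end

text \<open>Conjugation by the bijection permutes the Leibniz terms and preserves the sign of each
  permutation.\<close>

lemma det_reindex:
  fixes A :: "real^'n::finite^'n" and \<phi> :: "'k::finite \<Rightarrow> 'n"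
  assumes inv: "\<And>k. \<psi> (\<phi> k) = k" "\<And>i. \<phi> (\<psi> i) = i"
  shows "det (\<chi> i j. A $ \<phi> i $ \<phi> j) = det A"
proof -
  have bij: "bij \<phi>" "bij \<psi>"
    using inv by (auto intro!: o_bij[of \<psi> \<phi>] o_bij[of \<phi> \<psi>])
  have invs: "inv \<psi> = \<phi>" by (rule inv_equality) (simp_all add: inv)
  have sgn: "sign (\<psi> \<circ> p \<circ> \<phi>) = sign p" if "p permutes UNIV" for p
  proof -
    have "map_permutation UNIV \<psi> p = \<psi> \<circ> p \<circ> \<phi>"
      using bij by (simp add: map_permutation_def invs bij_is_surj restrict_id_def fun_eq_iff)
    then show ?thesis using sign_map_permutation[OF bij_is_inj[OF bij(2)] that] by simp
  qed
  have prm: "\<psi> \<circ> p \<circ> \<phi> permutes UNIV" if "p permutes UNIV" for p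
    using that bij by (intro bij_imp_permutes) (auto intro: bij_comp permutes_bij)
  have prm': "\<phi> \<circ> p \<circ> \<psi> permutes UNIV" if "p permutes UNIV" for p
    using that bij by (intro bij_imp_permutes) (auto intro: bij_comp permutes_bij)
  have "det A = (\<Sum>p | p permutes UNIV. of_int (sign (\<psi> \<circ> p \<circ> \<phi>)) * (\<Prod>i\<in>UNIV. A $ \<phi> i $ \<phi> ((\<psi> \<circ> p \<circ> \<phi>) i)))"
    unfolding det_def
  proof (intro sum.cong refl)
    fix p :: "'n \<Rightarrow> 'n" assume "p \<in> {p. p permutes UNIV}"
    moreover have "(\<Prod>i\<in>UNIV. A $ \<phi> i $ p (\<phi> i)) = (\<Prod>i\<in>UNIV. A $ i $ p i)"
      by (rule prod.reindex_bij_betw[OF bij(1)])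
    ultimately show "of_int (sign p) * (\<Prod>i\<in>UNIV. A $ i $ p i)
      = of_int (sign (\<psi> \<circ> p \<circ> \<phi>)) * (\<Prod>i\<in>UNIV. A $ \<phi> i $ \<phi> ((\<psi> \<circ> p \<circ> \<phi>) i))"
      by (simp add: sgn inv)
  qed
  also have "\<dots> = (\<Sum>q | q permutes UNIV. of_int (sign q) * (\<Prod>i\<in>UNIV. A $ \<phi> i $ \<phi> (q i)))"
    by (rule sum.reindex_bij_witness[of _ "\<lambda>q. \<phi> \<circ> q \<circ> \<psi>" "\<lambda>p. \<psi> \<circ> p \<circ> \<phi>"])
       (auto simp: prm prm' inv fun_eq_iff)
  finally show ?thesis unfolding det_def by simp
qed

text \<open>Lebesgue measure is determined by boxes, and renaming coordinates maps boxes to boxes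
  with the same side lengths.\<close>

lemma lborel_distr_reindex:
  fixes \<phi> :: "'k::finite \<Rightarrow> 'n::finite"
  assumes inv: "\<And>k. \<psi> (\<phi> k) = k" "\<And>i. \<phi> (\<psi> i) = i"
  shows "lborel = distr lborel borel (\<lambda>x :: real^'n. \<chi> k. x $ \<phi> k)"
proof (rule lborel_eqI)
  let ?r = "\<lambda>x :: real^'n. \<chi> k. x $ \<phi> k"
  have "continuous_on UNIV ?r" by (intro continuous_intros)
  then have meas: "?r \<in> borel_measurable lborel" by (simp add: borel_measurable_continuous_onI)
  have bij: "bij \<phi>" using inv by (auto intro!: o_bij[of \<psi> \<phi>])
  have prod: "(\<Prod>b\<in>Basis. x \<bullet> b) = (\<Prod>i\<in>UNIV. x $ i)" for x :: "real^'j::finite"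
  proof -
    have B: "(Basis :: (real^'j) set) = (\<lambda>i. axis i 1) ` UNIV" by (auto simp: Basis_vec_def)
    show ?thesis unfolding B by (subst prod.reindex) (auto simp: inj_on_def axis_eq_axis inner_axis)
  qed
  fix l w :: "real^'k" assume le: "\<And>b. b \<in> Basis \<Longrightarrow> l \<bullet> b \<le> w \<bullet> b"
  let ?l = "\<chi> i. l $ \<psi> i" and ?w = "\<chi> i. w $ \<psi> i"
  have le': "l $ k \<le> w $ k" for k using le[of "axis k 1"] by (auto simp: Basis_vec_def inner_axis)
  have "?r -` box l w = box ?l ?w"
    by (auto simp: mem_box_cart) (metis inv)+
  then have "emeasure (distr lborel borel ?r) (box l w) = emeasure lborel (box ?l ?w)"
    using meas by (subst emeasure_distr) auto
  also have "\<dots> = ennreal (\<Prod>b\<in>Basis. (?w - ?l) \<bullet> b)"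
    using le' by (intro emeasure_lborel_box) (auto simp: Basis_vec_def inner_axis)
  also have "(\<Prod>b\<in>Basis. (?w - ?l) \<bullet> b) = (\<Prod>i\<in>UNIV. (w - l) $ \<psi> i)"
    unfolding prod by simp
  also have "\<dots> = (\<Prod>k\<in>UNIV. (w - l) $ k)"
    by (subst prod.reindex_bij_betw[OF bij, symmetric]) (simp add: inv)
  finally show "emeasure (distr lborel borel ?r) (box l w) = ennreal (\<Prod>b\<in>Basis. (w - l) \<bullet> b)"
    unfolding prod .
qed simp

lemma nn_integral_change_of_variables:
  fixes f :: "real^'n::finite \<Rightarrow> real" and g :: "real^'n \<Rightarrow> real^'n"
  assumes S: "S \<in> sets borel" and der: "\<And>x. x \<in> S \<Longrightarrow> (g has_derivative g' x) (at x within S)"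
    and inj: "inj_on g S" and nonneg: "\<And>x. 0 \<le> f x"
    and meas: "(\<lambda>x. indicator S x * (\<bar>det (matrix (g' x))\<bar> * f (g x))) \<in> borel_measurable borel"
      "(\<lambda>y. indicator (g ` S) y * f y) \<in> borel_measurable borel"
  shows "(\<integral>\<^sup>+x\<in>S. ennreal (\<bar>det (matrix (g' x))\<bar> * f (g x)) \<partial>lborel) = (\<integral>\<^sup>+y\<in>g ` S. ennreal (f y) \<partial>lborel)"
proof -
  \<comment> \<open>\<open>r\<close> and its inverse \<open>q\<close> preserve Lebesgue measure, and
    conjugating a derivative with them leaves its determinant unchanged.\<close>
  define r :: "real^'n \<Rightarrow> real^'n ranked" where "r x = (\<chi> k. x $ Rep_ranked k)" for x
  define q :: "real^'n ranked \<Rightarrow> real^'n" where "q z = (\<chi> i. z $ Abs_ranked i)" for z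
  have inv: "Abs_ranked (Rep_ranked k) = k" "Rep_ranked (Abs_ranked i) = i" for k :: "'n ranked" and i :: 'n
    by (simp_all add: Rep_ranked_inverse Abs_ranked_inverse)
  have rq: "r (q z) = z" and qr: "q (r x) = x" for z x
    by (simp_all add: r_def q_def vec_eq_iff inv)
  have blr: "bounded_linear r" and blq: "bounded_linear q"
    unfolding r_def q_def by (auto intro!: linear_conv_bounded_linear[THEN iffD1] linearI simp: vec_eq_iff)
  have cont: "continuous_on A r" "continuous_on B q" for A B
    using linear_continuous_on[OF blr] linear_continuous_on[OF blq] by auto
  have mr: "r \<in> borel_measurable borel" and mq: "q \<in> borel_measurable borel"
    using cont by (auto intro: borel_measurable_continuous_onI)
  have lb: "(lborel :: (real^'n) measure) = distr lborel borel q"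
    unfolding q_def by (rule lborel_distr_reindex[of Rep_ranked]) (simp_all add: inv)
  have vim: "r ` A = q -` A" for A
  proof (intro equalityI subsetI)
    fix z assume "z \<in> q -` A"
    then have "r (q z) \<in> r ` A" by blast
    then show "z \<in> r ` A" by (simp add: rq)
  qed (auto simp: qr)
  have tr: "(\<integral>\<^sup>+x\<in>A. ennreal (h x) \<partial>lborel) = (\<integral>\<^sup>+z\<in>r ` A. ennreal (h (q z)) \<partial>lborel)"
    if h: "(\<lambda>x. indicator A x * h x) \<in> borel_measurable borel" for h :: "real^'n \<Rightarrow> real" and A
  proof -
    have eq: "ennreal (h x) * indicator A x = ennreal (indicator A x * h x)" for x
      by (auto simp: indicator_def)
    have "(\<integral>\<^sup>+x\<in>A. ennreal (h x) \<partial>lborel) = (\<integral>\<^sup>+x. ennreal (indicator A x * h x) \<partial>distr lborel borel q)"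
      unfolding eq using lb by simp
    also have "\<dots> = (\<integral>\<^sup>+z. ennreal (indicator A (q z) * h (q z)) \<partial>lborel)"
      using h mq by (intro nn_integral_distr) auto
    also have "\<dots> = (\<integral>\<^sup>+z\<in>r ` A. ennreal (h (q z)) \<partial>lborel)"
      unfolding vim by (intro nn_integral_cong) (auto simp: indicator_def)
    finally show ?thesis .
  qed
  let ?g = "\<lambda>z. r (g (q z))" and ?g' = "\<lambda>z v. r (g' (q z) (q v))"
  have dg: "(?g has_derivative ?g' z) (at z within r ` S)" if "z \<in> r ` S" for z
  proof -
    have "q z \<in> S" and img: "q ` r ` S = S" using that by (auto simp: qr image_image)
    then have "(g has_derivative g' (q z)) (at (q z) within q ` r ` S)" using der by simp
    from bounded_linear.has_derivative[OF blr has_derivative_in_compose[OF bounded_linear_imp_has_derivative[OF blq] this]]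
    show ?thesis .
  qed
  have det: "det (matrix (?g' z)) = det (matrix (g' (q z)))" if "z \<in> r ` S" for z
  proof -
    have "q (axis k 1) = axis (Rep_ranked k) 1" for k
      by (auto simp: q_def vec_eq_iff axis_def inv)
    then have "matrix (?g' z) = (\<chi> i j. matrix (g' (q z)) $ Rep_ranked i $ Rep_ranked j)"
      by (simp add: matrix_def r_def)
    then show ?thesis using det_reindex[of Abs_ranked Rep_ranked "matrix (g' (q z))"] by (simp add: inv)
  qed
  have rS: "r ` S \<in> sets borel"
    unfolding vim using measurable_sets[OF mq, of S] S by simp
  have img: "r ` g ` S = ?g ` r ` S" by (auto simp: qr image_image)
  have m1: "(\<lambda>z. indicator (r ` S) z * (\<bar>det (matrix (?g' z))\<bar> * f (q (?g z)))) \<in> borel_measurable borel"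
  proof -
    have "(\<lambda>z. indicator S (q z) * (\<bar>det (matrix (g' (q z)))\<bar> * f (g (q z)))) \<in> borel_measurable borel"
      using measurable_compose[OF mq meas(1)] .
    moreover have "indicator S (q z) * (\<bar>det (matrix (g' (q z)))\<bar> * f (g (q z)))
       = indicator (r ` S) z * (\<bar>det (matrix (?g' z))\<bar> * f (q (?g z)))" for z
      using det[of z] by (cases "z \<in> r ` S") (auto simp: qr rq indicator_def vim)
    ultimately show ?thesis by simp
  qed
  have m2: "(\<lambda>z. indicator (?g ` r ` S) z * f (q z)) \<in> borel_measurable borel"
  proof -
    have "(\<lambda>z. indicator (g ` S) (q z) * f (q z)) \<in> borel_measurable borel"
      using measurable_compose[OF mq meas(2)] .
    moreover have "indicator (g ` S) (q z) * f (q z) = indicator (r ` g ` S) z * f (q z)" for z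
      by (auto simp: vim indicator_def)
    ultimately show ?thesis unfolding img by simp
  qed
  have "(\<integral>\<^sup>+x\<in>S. ennreal (\<bar>det (matrix (g' x))\<bar> * f (g x)) \<partial>lborel)
     = (\<integral>\<^sup>+z\<in>r ` S. ennreal (\<bar>det (matrix (g' (q z)))\<bar> * f (g (q z))) \<partial>lborel)"
    by (rule tr[OF meas(1)])
  also have "\<dots> = (\<integral>\<^sup>+z\<in>r ` S. ennreal (\<bar>det (matrix (?g' z))\<bar> * f (q (?g z))) \<partial>lborel)"
    by (intro nn_integral_cong) (auto simp: indicator_def det qr)
  also have "\<dots> = (\<integral>\<^sup>+z\<in>?g ` r ` S. ennreal (f (q z)) \<partial>lborel)"
  proof (rule nn_integral_change_of_variables_wellorder[OF rS dg _ nonneg m1 m2])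
    show "inj_on ?g (r ` S)"
      using inj by (auto simp: inj_on_def qr) (metis qr)
  qed
  also have "\<dots> = (\<integral>\<^sup>+y\<in>g ` S. ennreal (f y) \<partial>lborel)"
    unfolding img[symmetric] by (rule tr[OF meas(2), symmetric])
  finally show ?thesis .
qed

section \<open>The Riemannian volume measure\<close>

context riem_manifold
begin

abbreviation borel_sets :: "'a set set" where
  "borel_sets \<equiv> sigma_sets (topspace (mtop M)) {U. openin (mtop M) U}"

lemma openin_Pow: "{U. openin (mtop M) U} \<subseteq> Pow (topspace (mtop M))"
  using openin_subset by auto

sublocale bs: sigma_algebra "topspace (mtop M)" borel_sets
  by (rule sigma_algebra_sigma_sets[OF openin_Pow])

text \<open>For subsets of the chart domain this is the image under \<open>cmap c\<close>. As a
  preimage under \<open>cinv c\<close> it commutes with set operations, also for sets that leave the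
  chart.\<close>

definition pre :: "('a, 'm) chart \<Rightarrow> 'a set \<Rightarrow> (real^'m) set" where
  "pre c A = {y \<in> cimg c. cinv c y \<in> A}"

lemma openin_borel: "openin (mtop M) U \<Longrightarrow> U \<in> borel_sets"
  by (simp add: sigma_sets.Basic)

lemma pre_borel: "c \<in> atlas M \<Longrightarrow> A \<in> borel_sets \<Longrightarrow> pre c A \<in> sets borel"
proof -
  assume c: "c \<in> atlas M"
  have oc: "cimg c \<in> sets borel" using open_cimg[OF c] by simp
  assume "A \<in> borel_sets"
  then show ?thesis
  proof (induction rule: sigma_sets.induct)
    case (Basic U)
    then show ?case unfolding pre_def using open_preimage_cinv[OF c, of U] by simp
  next
    case Empty
    then show ?case by (simp add: pre_def)
  next
    case (Compl A)
    have "pre c (topspace (mtop M) - A) = cimg c - pre c A"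
      unfolding pre_def using cdom_subset[OF c] cinv_in by blast
    then show ?case using Compl oc by simp
  next
    case (Union A)
    have "pre c (\<Union>i. A i) = (\<Union>i. pre c (A i))" unfolding pre_def by blast
    then show ?case using Union by simp
  qed
qed

text \<open>The indicator makes the chart density a Borel function on the whole space.\<close>

definition cdens :: "('a, 'm) chart \<Rightarrow> real^'m \<Rightarrow> real" where
  "cdens c y = indicator (cimg c) y * sqrt (det (gram M c y))"

definition cmeas :: "('a, 'm) chart \<Rightarrow> (real^'m) measure" where
  "cmeas c = density lborel (\<lambda>y. ennreal (cdens c y))"

lemma det_gram_pos: "c \<in> atlas M \<Longrightarrow> y \<in> cimg c \<Longrightarrow> det (gram M c y) > 0"
  using metric_field.det_g[OF metric_field_chart] by blast

lemma cdens_nonneg: "c \<in> atlas M \<Longrightarrow> 0 \<le> cdens c y"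
  unfolding cdens_def using det_gram_pos[of c y] by (auto simp: indicator_def less_imp_le)

lemma continuous_sqrt_det_gram: "c \<in> atlas M \<Longrightarrow> continuous_on (cimg c) (\<lambda>y. sqrt (det (gram M c y)))"
  using metric_field.smooth_g[OF metric_field_chart] open_cimg det_gram_pos
  by (intro smooth_on_continuous smooth_on_sqrt smooth_on_det) auto

lemma cdens_measurable: "c \<in> atlas M \<Longrightarrow> cdens c \<in> borel_measurable borel"
  unfolding cdens_def using open_cimg[of c] continuous_sqrt_det_gram[of c]
    borel_measurable_continuous_on_indicator[of "cimg c" "\<lambda>y. sqrt (det (gram M c y))"] by simp

lemma sets_cmeas [simp]: "sets (cmeas c) = sets borel" "space (cmeas c) = UNIV"
  by (simp_all add: cmeas_def)

lemma emeasure_cmeas: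
  assumes "c \<in> atlas M" "B \<in> sets borel"
  shows "emeasure (cmeas c) B = (\<integral>\<^sup>+y\<in>B. ennreal (cdens c y) \<partial>lborel)"
  unfolding cmeas_def using assms cdens_measurable[OF assms(1)] by (subst emeasure_density) auto

lemma emeasure_cmeas_pre:
  assumes "c \<in> atlas M" "A \<in> borel_sets" "A \<subseteq> cdom c"
  shows "emeasure (cmeas c) (pre c A) = (\<integral>\<^sup>+y\<in>cmap c ` A. ennreal (sqrt (det (gram M c y))) \<partial>lborel)"
proof -
  have "cmap c ` A = pre c A" unfolding pre_def by (rule image_cmap[OF assms(1,3)])
  then show ?thesis unfolding emeasure_cmeas[OF assms(1) pre_borel[OF assms(1,2)]]
    by (intro nn_integral_cong) (auto simp: indicator_def cdens_def pre_def)
qed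

text \<open>The density of \<open>c\<close> is the density of \<open>d\<close> pulled back along the
  transition map, including the absolute Jacobian determinant; change of variables then identifies
  the two integrals.\<close>

lemma cmeas_overlap:
  assumes c: "c \<in> atlas M" "d \<in> atlas M" and A: "A \<in> borel_sets" "A \<subseteq> cdom c" "A \<subseteq> cdom d"
  shows "emeasure (cmeas c) (pre c A) = emeasure (cmeas d) (pre d A)"
proof -
  let ?g = "transition c d"
  have sub: "pre c A \<subseteq> overlap c d" using A by (auto simp: pre_def overlap_def)
  have img: "?g ` pre c A = pre d A"
  proof (intro equalityI subsetI)
    fix z assume z: "z \<in> pre d A"
    then have "z \<in> overlap d c" using A by (auto simp: pre_def overlap_def)
    then have "?g (transition d c z) = z" "transition d c z \<in> pre c A"
      using transition_transition[OF c(2,1)] transition_in[OF c(2,1)] z A(2)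
      by (auto simp: pre_def overlap_def transition_eq cinv_cmap c subset_iff)
    then show "z \<in> ?g ` pre c A" by (metis image_eqI)
  next
    fix z assume "z \<in> ?g ` pre c A"
    then show "z \<in> pre d A" using A(3) by (auto simp: pre_def transition_eq cinv_cmap c subset_iff)
  qed
  have D: "indicator (pre c A) x * (\<bar>det (matrix (fder ?g x))\<bar> * cdens d (?g x)) = indicator (pre c A) x * cdens c x" for x
  proof (cases "x \<in> pre c A")
    case True
    then have x: "x \<in> overlap c d" using sub by blast
    then have "x \<in> cimg c" "?g x \<in> cimg d" using transition_in[OF c x] by (auto simp: overlap_def)
    then show ?thesis using sqrt_det_gram_transition[OF c x] by (simp add: cdens_def)
  qed simp
  have bc: "pre c A \<in> sets borel" and bd: "pre d A \<in> sets borel" using pre_borel c A by auto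
  have "emeasure (cmeas c) (pre c A) = (\<integral>\<^sup>+x\<in>pre c A. ennreal (\<bar>det (matrix (fder ?g x))\<bar> * cdens d (?g x)) \<partial>lborel)"
    unfolding emeasure_cmeas[OF c(1) bc]
    by (intro nn_integral_cong) (use D in \<open>auto simp: indicator_def split: if_splits\<close>)
  also have "\<dots> = (\<integral>\<^sup>+y\<in>?g ` pre c A. ennreal (cdens d y) \<partial>lborel)"
  proof (rule nn_integral_change_of_variables[OF bc])
    show "(?g has_derivative fder ?g x) (at x within pre c A)" if "x \<in> pre c A" for x
      using transition_has_derivative[OF c, of x] that sub by (auto intro: has_derivative_at_withinI)
    show "inj_on ?g (pre c A)"
      using transition_transition[OF c] sub by (intro inj_on_inverseI[of _ "transition d c"]) auto
    show "0 \<le> cdens d x" for x by (rule cdens_nonneg[OF c(2)])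
    show "(\<lambda>x. indicator (pre c A) x * (\<bar>det (matrix (fder ?g x))\<bar> * cdens d (?g x))) \<in> borel_measurable borel"
      unfolding D using cdens_measurable[OF c(1)] bc by auto
    show "(\<lambda>y. indicator (?g ` pre c A) y * cdens d y) \<in> borel_measurable borel"
      unfolding img using cdens_measurable[OF c(2)] bd by auto
  qed
  finally show ?thesis unfolding img emeasure_cmeas[OF c(2) bd] .
qed

text \<open>The property under the choice operator of \<open>vol_measure\<close>; once it is
  satisfiable, the chosen measure has it.\<close>

definition volume_spec :: "'a measure \<Rightarrow> bool" where
  "volume_spec \<mu> \<longleftrightarrow> space \<mu> = topspace (mtop M) \<and> sets \<mu> = borel_sets \<and>
     (\<forall>c\<in>atlas M. \<forall>A\<in>sets \<mu>. A \<subseteq> cdom c \<longrightarrow>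
        emeasure \<mu> A = (\<integral>\<^sup>+y\<in>cmap c ` A. ennreal (sqrt (det (gram M c y))) \<partial>lborel))"

lemma finite_chart_cover:
  assumes "compact_space (mtop M)"
  obtains cs where "set cs \<subseteq> atlas M" "topspace (mtop M) = (\<Union>c\<in>set cs. cdom c)"
proof -
  have "\<exists>\<F>. finite \<F> \<and> \<F> \<subseteq> cdom ` atlas M \<and> topspace (mtop M) \<subseteq> \<Union>\<F>"
  proof -
    have "\<forall>U\<in>cdom ` atlas M. openin (mtop M) U" using openin_cdom by blast
    moreover have "topspace (mtop M) \<subseteq> \<Union>(cdom ` atlas M)" using atlas unfolding smooth_atlas_def by simp
    ultimately show ?thesis using spec[OF assms[unfolded compact_space_alt], of "cdom ` atlas M"] by simp
  qed
  then obtain \<F> where F: "finite \<F>" "\<F> \<subseteq> cdom ` atlas M" "topspace (mtop M) \<subseteq> \<Union>\<F>" by blast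
  obtain C where C: "C \<subseteq> atlas M" "finite C" "\<F> = cdom ` C"
    using finite_subset_image[OF F(1,2)] by blast
  obtain cs where "set cs = C" using finite_list[OF C(2)] by blast
  moreover have "(\<Union>c\<in>C. cdom c) \<subseteq> topspace (mtop M)"
    using C(1) by (intro UN_least cdom_subset) blast
  ultimately have "topspace (mtop M) = (\<Union>c\<in>set cs. cdom c)"
    using C(3) F(3) by simp
  then show thesis using that[of cs] C \<open>set cs = C\<close> by simp
qed

text \<open>A finite chart cover is cut into disjoint Borel pieces and each piece is measured in its
  own chart. For a set inside an arbitrary chart, \<open>cmeas_overlap\<close> moves every piece
  into that chart.\<close>

lemma ex_volume_measure:
  assumes "compact_space (mtop M)"
  shows "\<exists>\<mu>. volume_spec \<mu>"
proof -
  obtain cs where cs: "set cs \<subseteq> atlas M" "topspace (mtop M) = (\<Union>c\<in>set cs. cdom c)"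
    by (rule finite_chart_cover[OF assms])
  let ?n = "length cs"
  have at: "cs ! k \<in> atlas M" if "k < ?n" for k using that cs(1) by auto
  define P where "P k = cdom (cs ! k) - (\<Union>j<k. cdom (cs ! j))" for k
  have PB: "P k \<in> borel_sets" if "k < ?n" for k
    unfolding P_def using that at openin_cdom
    by (intro bs.Diff bs.finite_UN openin_borel) auto
  have Pd: "P k \<subseteq> cdom (cs ! k)" for k by (auto simp: P_def)
  have Pdisj: "P j \<inter> P k = {}" if "j \<noteq> k" for j k
    using that by (cases j k rule: linorder_cases) (auto simp: P_def)
  have Pcov: "A = (\<Union>k<?n. A \<inter> P k)" if "A \<subseteq> topspace (mtop M)" for A
  proof (intro equalityI subsetI)
    fix x assume x: "x \<in> A"
    then have "x \<in> (\<Union>c\<in>set cs. cdom c)" using that cs(2) by blast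
    then obtain k where k: "k < ?n" "x \<in> cdom (cs ! k)" by (auto simp: in_set_conv_nth)
    define l where "l = (LEAST l. x \<in> cdom (cs ! l))"
    have "x \<in> cdom (cs ! l)" "l \<le> k" unfolding l_def using k by (auto intro: LeastI Least_le)
    moreover have "x \<notin> cdom (cs ! j)" if "j < l" for j using not_less_Least that unfolding l_def by blast
    ultimately show "x \<in> (\<Union>k<?n. A \<inter> P k)" using k x by (auto simp: P_def intro!: bexI[of _ l])
  qed auto
  \<comment> \<open>A finite sum of measures of disjointness-preserving preimages, so countable
    additivity is inherited term by term.\<close>
  define \<nu> where "\<nu> A = (\<Sum>k<?n. emeasure (cmeas (cs ! k)) (pre (cs ! k) (A \<inter> P k)))" for A
  define \<mu> where "\<mu> = measure_of (topspace (mtop M)) {U. openin (mtop M) U} \<nu>"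
  have space: "space \<mu> = topspace (mtop M)" and sets: "sets \<mu> = borel_sets"
    unfolding \<mu>_def using openin_Pow by (simp_all add: space_measure_of sets_measure_of)
  have preB: "pre (cs ! k) (A \<inter> P k) \<in> sets borel" if "k < ?n" "A \<in> borel_sets" for k A
    using that at PB by (intro pre_borel bs.Int)
  have "countably_additive (sets \<mu>) \<nu>"
    unfolding countably_additive_def
  proof (intro allI impI)
    fix A :: "nat \<Rightarrow> 'a set"
    assume A: "range A \<subseteq> sets \<mu>" and disj: "disjoint_family A" and "(\<Union>i. A i) \<in> sets \<mu>"
    have "(\<Sum>i. \<nu> (A i)) = (\<Sum>k<?n. \<Sum>i. emeasure (cmeas (cs ! k)) (pre (cs ! k) (A i \<inter> P k)))"
      unfolding \<nu>_def by (rule suminf_sum) auto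
    also have "\<dots> = (\<Sum>k<?n. emeasure (cmeas (cs ! k)) (\<Union>i. pre (cs ! k) (A i \<inter> P k)))"
      using A disj preB sets
      by (intro sum.cong refl suminf_emeasure) (auto simp: disjoint_family_on_def pre_def)
    also have "\<dots> = \<nu> (\<Union>i. A i)"
      unfolding \<nu>_def by (intro sum.cong refl arg_cong[of _ _ "emeasure _"]) (auto simp: pre_def)
    finally show "(\<Sum>i. \<nu> (A i)) = \<nu> (\<Union>i. A i)" .
  qed
  moreover have "positive (sets \<mu>) \<nu>" by (simp add: positive_def \<nu>_def pre_def)
  ultimately have em: "emeasure \<mu> A = \<nu> A" if "A \<in> sets \<mu>" for A
    using emeasure_measure_of[OF \<mu>_def openin_Pow _ _ that] by blast
  have "emeasure \<mu> A = (\<integral>\<^sup>+y\<in>cmap c ` A. ennreal (sqrt (det (gram M c y))) \<partial>lborel)"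
    if c: "c \<in> atlas M" and A: "A \<in> sets \<mu>" "A \<subseteq> cdom c" for c A
  proof -
    have AB: "A \<in> borel_sets" using A sets by simp
    have "emeasure \<mu> A = (\<Sum>k<?n. emeasure (cmeas c) (pre c (A \<inter> P k)))"
      unfolding em[OF A(1)] \<nu>_def
    proof (intro sum.cong refl)
      fix k assume "k \<in> {..<?n}"
      then show "emeasure (cmeas (cs ! k)) (pre (cs ! k) (A \<inter> P k)) = emeasure (cmeas c) (pre c (A \<inter> P k))"
        using at[of k] c AB PB[of k] A(2) Pd by (intro cmeas_overlap bs.Int) auto
    qed
    also have "\<dots> = emeasure (cmeas c) (\<Union>k<?n. pre c (A \<inter> P k))"
    proof (rule sum_emeasure)
      show "(\<lambda>k. pre c (A \<inter> P k)) ` {..<?n} \<subseteq> sets (cmeas c)"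
        using c AB PB by (auto intro!: pre_borel bs.Int)
      show "disjoint_family_on (\<lambda>k. pre c (A \<inter> P k)) {..<?n}"
        unfolding disjoint_family_on_def pre_def using Pdisj by blast
    qed simp
    also have "(\<Union>k<?n. pre c (A \<inter> P k)) = pre c A"
      using Pcov[of A] A(2) cdom_subset[OF c] unfolding pre_def by blast
    finally show ?thesis using emeasure_cmeas_pre[OF c AB A(2)] by simp
  qed
  then have "volume_spec \<mu>" unfolding volume_spec_def using space sets by blast
  then show ?thesis by blast
qed

section \<open>Integration against the volume measure\<close>

context
  assumes compact: "compact_space (mtop M)"
begin

lemma vol_spec: "volume_spec (vol_measure M)"
  unfolding vol_measure_def using someI_ex[OF ex_volume_measure[OF compact]] unfolding volume_spec_def by simp

lemma space_vol: "space (vol_measure M) = topspace (mtop M)" and sets_vol: "sets (vol_measure M) = borel_sets"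
  using vol_spec unfolding volume_spec_def by auto

lemma emeasure_vol:
  assumes "c \<in> atlas M" "A \<in> borel_sets" "A \<subseteq> cdom c"
  shows "emeasure (vol_measure M) A = emeasure (cmeas c) (pre c A)"
  unfolding emeasure_cmeas_pre[OF assms] using vol_spec assms unfolding volume_spec_def by auto

text \<open>A point has a neighbourhood whose coordinate image lies in a closed ball inside the
  chart image, where the density is bounded; finitely many of these cover.\<close>

lemma finite_vol: "emeasure (vol_measure M) (topspace (mtop M)) < \<infinity>"
proof -
  have "\<exists>U. openin (mtop M) U \<and> x \<in> U \<and> emeasure (vol_measure M) U < \<infinity>" if x: "x \<in> topspace (mtop M)" for x
  proof -
    obtain c where c: "c \<in> atlas M" "x \<in> cdom c" using chart_at_spec[OF x] by blast
    then have "cmap c x \<in> cimg c" by simp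
    then obtain r where r: "r > 0" "cball (cmap c x) r \<subseteq> cimg c"
      using open_cimg[OF c(1)] open_contains_cball by blast
    let ?U = "{x' \<in> cdom c. cmap c x' \<in> ball (cmap c x) r}"
    have U: "openin (mtop M) ?U" by (rule openin_preimage_cmap[OF c(1)]) simp
    have "continuous_on (cball (cmap c x) r) (\<lambda>y. sqrt (det (gram M c y)))"
      using continuous_on_subset[OF continuous_sqrt_det_gram[OF c(1)] r(2)] .
    then have "bounded ((\<lambda>y. sqrt (det (gram M c y))) ` cball (cmap c x) r)"
      by (intro compact_imp_bounded compact_continuous_image) auto
    then obtain B where B: "\<And>y. y \<in> cball (cmap c x) r \<Longrightarrow> \<bar>sqrt (det (gram M c y))\<bar> \<le> B"
      unfolding bounded_iff by (auto simp del: mem_cball)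
    have "emeasure (vol_measure M) ?U = (\<integral>\<^sup>+y\<in>pre c ?U. ennreal (cdens c y) \<partial>lborel)"
      using c U by (subst emeasure_vol) (auto intro!: emeasure_cmeas pre_borel openin_borel)
    also have "\<dots> \<le> (\<integral>\<^sup>+y. ennreal B * indicator (cball (cmap c x) r) y \<partial>lborel)"
    proof (intro nn_integral_mono)
      fix y
      have "cdens c y \<le> B" if "y \<in> pre c ?U"
        using that B[of y] by (auto simp: pre_def cdens_def less_imp_le)
      then show "ennreal (cdens c y) * indicator (pre c ?U) y \<le> ennreal B * indicator (cball (cmap c x) r) y"
        by (auto simp: indicator_def pre_def ennreal_leI)
    qed
    also have "\<dots> = ennreal B * emeasure lborel (cball (cmap c x) r)"
      by (intro nn_integral_cmult_indicator) simp
    also have "\<dots> < \<infinity>" using emeasure_lborel_cball_finite by (auto simp: ennreal_mult_less_top)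
    finally show ?thesis using U c r by (intro exI[of _ ?U]) auto
  qed
  then obtain U where U: "\<And>x. x \<in> topspace (mtop M) \<Longrightarrow> openin (mtop M) (U x) \<and> x \<in> U x \<and> emeasure (vol_measure M) (U x) < \<infinity>"
    by metis
  have "\<exists>\<F>. finite \<F> \<and> \<F> \<subseteq> U ` topspace (mtop M) \<and> topspace (mtop M) \<subseteq> \<Union>\<F>"
    using U by (intro compact[unfolded compact_space_alt, THEN spec, THEN mp] conjI) auto
  then obtain \<F> where F: "finite \<F>" "\<F> \<subseteq> U ` topspace (mtop M)" "topspace (mtop M) \<subseteq> \<Union>\<F>" by blast
  obtain X where X: "X \<subseteq> topspace (mtop M)" "finite X" "topspace (mtop M) \<subseteq> (\<Union>x\<in>X. U x)"
    using finite_subset_image[OF F(1,2)] F(3) by blast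
  have "emeasure (vol_measure M) (topspace (mtop M)) \<le> emeasure (vol_measure M) (\<Union>x\<in>X. U x)"
    using X U by (intro emeasure_mono) (auto simp: sets_vol intro!: bs.finite_UN openin_borel)
  also have "\<dots> \<le> (\<Sum>x\<in>X. emeasure (vol_measure M) (U x))"
    using X U by (intro emeasure_subadditive_finite) (auto simp: sets_vol intro!: openin_borel)
  also have "\<dots> < \<infinity>" using X U by (auto simp: ennreal_sum_less_top)
  finally show ?thesis .
qed

lemma continuous_imp_integrable_vol:
  assumes f: "continuous_map (mtop M) euclideanreal f"
  shows "integrable (vol_measure M) f"
proof -
  interpret finite_measure "vol_measure M"
    using finite_vol by (intro finite_measureI) (simp add: space_vol)
  have meas: "f \<in> borel_measurable (vol_measure M)"
  proof (rule borel_measurableI)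
    fix S :: "real set" assume "open S"
    then have "openin (mtop M) {x \<in> topspace (mtop M). f x \<in> S}"
      using f by (auto intro: openin_continuous_map_preimage)
    moreover have "f -` S \<inter> space (vol_measure M) = {x \<in> topspace (mtop M). f x \<in> S}"
      by (auto simp: space_vol)
    ultimately show "f -` S \<inter> space (vol_measure M) \<in> sets (vol_measure M)"
      by (simp add: sets_vol openin_borel)
  qed
  have "compactin euclideanreal (f ` topspace (mtop M))"
    using compact f unfolding compact_space_def by (rule image_compactin)
  then have "bounded (f ` topspace (mtop M))" by (simp add: compact_imp_bounded)
  then obtain B where "\<And>x. x \<in> topspace (mtop M) \<Longrightarrow> \<bar>f x\<bar> \<le> B" unfolding bounded_iff by auto
  then show ?thesis using meas by (intro integrable_const_bound[of _ B]) (auto simp: space_vol)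
qed

lemma cmap_measurable: "c \<in> atlas M \<Longrightarrow> cmap c \<in> borel_measurable (restrict_space (vol_measure M) (cdom c))"
proof -
  assume c: "c \<in> atlas M"
  have D: "cdom c \<inter> space (vol_measure M) \<in> sets (vol_measure M)"
    using openin_borel[OF openin_cdom[OF c]] cdom_subset[OF c] by (simp add: space_vol sets_vol Int_absorb2)
  show ?thesis
  proof (rule borel_measurableI)
    fix S :: "(real^'m) set" assume "open S"
    have "cmap c -` S \<inter> space (restrict_space (vol_measure M) (cdom c)) = {x \<in> cdom c. cmap c x \<in> S}"
      using cdom_subset[OF c] by (auto simp: space_restrict_space space_vol)
    moreover have "{x \<in> cdom c. cmap c x \<in> S} \<in> borel_sets"
      by (rule openin_borel[OF openin_preimage_cmap[OF c \<open>open S\<close>]])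
    ultimately show "cmap c -` S \<inter> space (restrict_space (vol_measure M) (cdom c))
        \<in> sets (restrict_space (vol_measure M) (cdom c))"
      using D by (auto simp: sets_restrict_space_iff sets_vol)
  qed
qed

text \<open>Identifies the push-forward of the volume under a chart, which reduces integrals
  supported in a chart domain to Lebesgue integrals.\<close>

lemma distr_vol_chart:
  assumes c: "c \<in> atlas M"
  shows "distr (restrict_space (vol_measure M) (cdom c)) borel (cmap c) = cmeas c"
proof (rule measure_eqI)
  have D: "cdom c \<inter> space (vol_measure M) \<in> sets (vol_measure M)"
    using openin_borel[OF openin_cdom[OF c]] cdom_subset[OF c] by (simp add: space_vol sets_vol Int_absorb2)
  fix B assume "B \<in> sets (distr (restrict_space (vol_measure M) (cdom c)) borel (cmap c))"
  then have B: "B \<in> sets borel" by simp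
  let ?A = "{x \<in> cdom c. cmap c x \<in> B}"
  have A: "cmap c -` B \<inter> space (restrict_space (vol_measure M) (cdom c)) = ?A"
    using cdom_subset[OF c] by (auto simp: space_restrict_space space_vol)
  have "?A \<in> sets (restrict_space (vol_measure M) (cdom c))"
    using measurable_sets[OF cmap_measurable[OF c] B] unfolding A .
  then have AB: "?A \<in> borel_sets" using D by (auto simp: sets_restrict_space_iff sets_vol)
  have "emeasure (distr (restrict_space (vol_measure M) (cdom c)) borel (cmap c)) B = emeasure (vol_measure M) ?A"
    using B D by (simp add: emeasure_distr cmap_measurable[OF c] A) (subst emeasure_restrict_space, auto)
  also have "\<dots> = emeasure (cmeas c) (pre c ?A)" using c AB by (intro emeasure_vol) auto
  also have "pre c ?A = B \<inter> cimg c" by (auto simp: pre_def)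
  also have "emeasure (cmeas c) (B \<inter> cimg c) = emeasure (cmeas c) B"
    using B open_cimg[OF c] by (simp add: emeasure_cmeas[OF c])
      (intro nn_integral_cong, auto simp: indicator_def cdens_def)
  finally show "emeasure (distr (restrict_space (vol_measure M) (cdom c)) borel (cmap c)) B = emeasure (cmeas c) B" .
qed simp

lemma vol_integral_chart:
  fixes \<phi> :: "real^'m \<Rightarrow> real"
  assumes c: "c \<in> atlas M" and \<phi>: "\<phi> \<in> borel_measurable borel"
  shows "(LINT x|vol_measure M. indicator (cdom c) x * \<phi> (cmap c x)) = (LINT y|lborel. cdens c y * \<phi> y)"
proof -
  have D: "cdom c \<inter> space (vol_measure M) \<in> sets (vol_measure M)"
    using openin_borel[OF openin_cdom[OF c]] cdom_subset[OF c] by (simp add: space_vol sets_vol Int_absorb2)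
  have "(LINT x|vol_measure M. indicator (cdom c) x * \<phi> (cmap c x))
     = (LINT x|restrict_space (vol_measure M) (cdom c). \<phi> (cmap c x))"
    using integral_restrict_space[OF D, of "\<lambda>x. \<phi> (cmap c x)"] by simp
  also have "\<dots> = (LINT y|cmeas c. \<phi> y)"
    unfolding distr_vol_chart[OF c, symmetric] by (rule integral_distr[symmetric, OF cmap_measurable[OF c] \<phi>])
  also have "\<dots> = (LINT y|lborel. cdens c y * \<phi> y)"
    unfolding cmeas_def using \<phi> cdens_measurable[OF c] cdens_nonneg[OF c]
    by (subst integral_density) auto
  finally show ?thesis .
qed

end

end

section \<open>The energy density\<close>

text \<open>The coordinate expression of \<open>hs_norm_sq\<close> for an arbitrary map between
  coordinate spaces, so that it applies to the test variations as well.\<close>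

definition esq :: "(real^'m \<Rightarrow> real^'m^'m::finite) \<Rightarrow> (real^'n \<Rightarrow> real^'n^'n::finite) \<Rightarrow> (real^'m \<Rightarrow> real^'n) \<Rightarrow> real^'m \<Rightarrow> real" where
  "esq g h f y = (\<Sum>i\<in>UNIV. \<Sum>j\<in>UNIV. matrix_inv (g y) $ i $ j *
     (fder f y (axis i 1) \<bullet> (h (f y) *v fder f y (axis j 1))))"

lemma congruent_inverse:
  fixes g :: "real^'m^'m::finite"
  assumes g0: "g0 = transpose J ** g ** J" and nz: "det J \<noteq> 0" "det g \<noteq> 0"
  shows "J ** matrix_inv g0 ** transpose J = matrix_inv g"
proof -
  have d0: "det g0 \<noteq> 0" using nz by (simp add: g0 det_mul)
  note inv = matrix_inv_det_nz[OF nz(1)] matrix_inv_det_nz[OF nz(2)] matrix_inv_det_nz[OF d0]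
  have "J ** matrix_inv g0 ** transpose J ** g = J ** matrix_inv g0 ** (transpose J ** g ** J) ** matrix_inv J"
    by (simp add: matrix_mul_assoc[symmetric] inv)
  also have "\<dots> = mat 1" unfolding g0[symmetric] by (simp add: matrix_mul_assoc[symmetric] inv)
  finally have "J ** matrix_inv g0 ** transpose J ** (g ** matrix_inv g) = matrix_inv g"
    by (simp add: matrix_mul_assoc)
  then show ?thesis by (simp add: inv)
qed

text \<open>Coordinate invariance of the metric trace of a bilinear form, with \<open>J\<close> as
  Jacobian: the inverse metric transforms by \<open>congruent_inverse\<close>.\<close>

lemma trace_congruent:
  fixes g :: "real^'m^'m::finite"
  assumes g0: "g0 = transpose J ** g ** J" and nz: "det J \<noteq> 0" "det g \<noteq> 0"
    and B: "\<And>v. linear (B v)" "\<And>w. linear (\<lambda>v. B v w)"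
  shows "(\<Sum>i\<in>UNIV. \<Sum>j\<in>UNIV. matrix_inv g0 $ i $ j * B (J *v axis i 1) (J *v axis j 1))
    = (\<Sum>k\<in>UNIV. \<Sum>l\<in>UNIV. matrix_inv g $ k $ l * (B (axis k 1) (axis l 1) :: real))"
proof -
  let ?G = "\<lambda>i j. matrix_inv g0 $ i $ j" and ?B = "\<lambda>k l. B (axis k 1) (axis l 1)"
  have Jax: "(J *v axis i 1) $ k = J $ k $ i" for i k
    by (simp add: matrix_vector_mul_component inner_axis)
  have "B (J *v axis i 1) (J *v axis j 1) = (\<Sum>k\<in>UNIV. \<Sum>l\<in>UNIV. J $ k $ i * J $ l $ j * ?B k l)" for i j
    using linear_axis_expansion[OF B(2), of "J *v axis i 1" "J *v axis j 1"]
      linear_axis_expansion[OF B(1), of _ "J *v axis j 1"]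
    by (simp add: Jax sum_distrib_left mult.assoc)
  then have "(\<Sum>i\<in>UNIV. \<Sum>j\<in>UNIV. ?G i j * B (J *v axis i 1) (J *v axis j 1))
     = (\<Sum>i\<in>UNIV. \<Sum>j\<in>UNIV. \<Sum>k\<in>UNIV. \<Sum>l\<in>UNIV. J $ k $ i * ?G i j * J $ l $ j * ?B k l)"
    by (simp add: sum_distrib_left mult_ac)
  also have "\<dots> = (\<Sum>k\<in>UNIV. \<Sum>l\<in>UNIV. \<Sum>i\<in>UNIV. \<Sum>j\<in>UNIV. J $ k $ i * ?G i j * J $ l $ j * ?B k l)"
  proof -
    have "(\<Sum>i\<in>UNIV. \<Sum>j\<in>UNIV. \<Sum>k\<in>UNIV. \<Sum>l\<in>UNIV. P i j k l)
        = (\<Sum>k\<in>UNIV. \<Sum>l\<in>UNIV. \<Sum>i\<in>UNIV. \<Sum>j\<in>UNIV. P i j k l)" for P :: "'m \<Rightarrow> 'm \<Rightarrow> 'm \<Rightarrow> 'm \<Rightarrow> real"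
    proof -
      have "(\<Sum>i\<in>UNIV. \<Sum>j\<in>UNIV. \<Sum>k\<in>UNIV. \<Sum>l\<in>UNIV. P i j k l)
          = (\<Sum>i\<in>UNIV. \<Sum>k\<in>UNIV. \<Sum>j\<in>UNIV. \<Sum>l\<in>UNIV. P i j k l)"
        by (intro sum.cong refl sum.swap)
      also have "\<dots> = (\<Sum>k\<in>UNIV. \<Sum>i\<in>UNIV. \<Sum>j\<in>UNIV. \<Sum>l\<in>UNIV. P i j k l)"
        by (rule sum.swap)
      also have "\<dots> = (\<Sum>k\<in>UNIV. \<Sum>i\<in>UNIV. \<Sum>l\<in>UNIV. \<Sum>j\<in>UNIV. P i j k l)"
        by (intro sum.cong refl sum.swap)
      also have "\<dots> = (\<Sum>k\<in>UNIV. \<Sum>l\<in>UNIV. \<Sum>i\<in>UNIV. \<Sum>j\<in>UNIV. P i j k l)"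
        by (intro sum.cong refl sum.swap)
      finally show ?thesis .
    qed
    then show ?thesis .
  qed
  also have "\<dots> = (\<Sum>k\<in>UNIV. \<Sum>l\<in>UNIV. (J ** matrix_inv g0 ** transpose J) $ k $ l * ?B k l)"
  proof (intro sum.cong refl)
    fix k l
    have "(J ** matrix_inv g0 ** transpose J) $ k $ l = (\<Sum>j\<in>UNIV. \<Sum>i\<in>UNIV. J $ k $ i * ?G i j * J $ l $ j)"
      by (simp add: matrix_matrix_mult_def transpose_def sum_distrib_right)
    also have "\<dots> = (\<Sum>i\<in>UNIV. \<Sum>j\<in>UNIV. J $ k $ i * ?G i j * J $ l $ j)" by (rule sum.swap)
    finally show "(\<Sum>i\<in>UNIV. \<Sum>j\<in>UNIV. J $ k $ i * ?G i j * J $ l $ j * ?B k l)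
       = (J ** matrix_inv g0 ** transpose J) $ k $ l * ?B k l"
      by (simp add: sum_distrib_right)
  qed
  finally show ?thesis unfolding congruent_inverse[OF g0 nz] .
qed

context riem_smooth_map
begin

text \<open>Removes both uses of \<open>chart_at\<close>: in the source by invariance of the trace,
  in the target because \<open>jac\<close> is an isometry between the two Gram matrices.\<close>

lemma hs_norm_sq_chart:
  assumes c: "c \<in> atlas M" and d: "d \<in> atlas N" and x: "x \<in> cdom c" "u x \<in> cdom d"
  shows "hs_norm_sq M N u x = esq (gram M c) (gram N d) (local_rep c d u) (cmap c x)"
proof -
  define c0 where "c0 = chart_at M x"
  define y0 where "y0 = cmap c0 x"
  let ?f0 = "local_rep c0 d u" and ?f = "local_rep c d u" and ?y = "cmap c x" and ?h = "gram N d"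
  have xM: "x \<in> topspace (mtop M)" using A.cdom_subset[OF c] x by blast
  have c0: "c0 \<in> atlas M" "x \<in> cdom c0" unfolding c0_def using A.chart_at_spec[OF xM] by auto
  have cy0: "cinv c0 y0 = x" unfolding y0_def by (rule A.cinv_cmap[OF c0])
  have y0: "y0 \<in> reg c0 d" using x c0 A.cmap_in[OF c0(2)] by (simp add: reg_def cy0) (simp add: y0_def)
  have ov: "y0 \<in> A.overlap c0 c" using x c0 A.cmap_in[OF c0(2)] by (simp add: A.overlap_def cy0) (simp add: y0_def)
  have tr: "transition c0 c y0 = ?y" by (simp add: A.transition_eq cy0)
  note src = fder_local_rep_source[OF c0(1) c d ov y0, unfolded tr]
  let ?J = "matrix (fder (transition c0 c) y0)"
  have J: "?J *v v = fder (transition c0 c) y0 v" for v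
    by (rule fun_cong[OF matrix_vector_mul(2)[OF A.transition_linear[OF c0(1) c ov]]])
  let ?B = "\<lambda>v w. fder ?f ?y v \<bullet> (?h (?f ?y) *v fder ?f ?y w)"
  have lin: "linear (fder ?f ?y)"
    using local_rep_has_derivative[OF c d src(1)] by (rule has_derivative_linear)
  have B: "linear (?B v)" "linear (\<lambda>v. ?B v w)" for v w
    by (auto intro!: linearI simp: linear_add[OF lin] linear_scale[OF lin] matrix_vector_right_distrib
        inner_add_right inner_add_left matrix_vector_mult_scaleR)
  have "target_inner M N u c0 y0 (differential M N u c0 y0 v) (differential M N u c0 y0 w)
     = ?B (?J *v v) (?J *v w)" for v w
    unfolding differential_eq[OF c0(1) d y0] target_inner_eq[OF c0(1) d y0] src(2,3)[symmetric] J
    using src(2,3) by simp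
  then have "hs_norm_sq M N u x = (\<Sum>i\<in>UNIV. \<Sum>j\<in>UNIV. matrix_inv (gram M c0 y0) $ i $ j * ?B (?J *v axis i 1) (?J *v axis j 1))"
    unfolding hs_norm_sq_def Let_def c0_def[symmetric] y0_def[symmetric] by simp
  also have "\<dots> = (\<Sum>k\<in>UNIV. \<Sum>l\<in>UNIV. matrix_inv (gram M c ?y) $ k $ l * ?B (axis k 1) (axis l 1))"
  proof (rule trace_congruent[OF _ A.det_transition[OF c0(1) c ov] _ B])
    show "gram M c0 y0 = transpose ?J ** gram M c ?y ** ?J"
      using A.gram_transition[OF c0(1) c ov] unfolding tr .
    show "det (gram M c ?y) \<noteq> 0" using A.det_gram_pos[OF c, of ?y] x by simp
  qed
  finally show ?thesis unfolding esq_def .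
qed

end

context conformal_map
begin

text \<open>The inverse metric and one differential combine to \<open>hv\<close>. What remains is
  the trace of the differential times its adjoint against \<open>h\<close>, and by
  \<open>h_df_hv\<close> each of the CARD('n) diagonal terms equals \<open>l y\<close>.\<close>

lemma esq_conformal:
  assumes y: "y \<in> D"
  shows "esq g h f y = real CARD('n) * l y"
proof -
  let ?A = "\<lambda>i. fder f y (axis i 1)" and ?G = "\<lambda>i j. matrix_inv (g y) $ i $ j"
  have "?A i \<bullet> (h (f y) *v ?A j) = (\<Sum>\<alpha>\<in>UNIV. (?A j \<bullet> axis \<alpha> 1) * (?A i \<bullet> (h (f y) *v axis \<alpha> 1)))" for i j
  proof -
    have "linear (\<lambda>v. ?A i \<bullet> (h (f y) *v v))"
      by (rule linearI) (simp_all add: matrix_vector_right_distrib inner_add_right matrix_vector_mult_scaleR)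
    from linear_axis_expansion[OF this, of "?A j"] show ?thesis by (simp add: inner_axis)
  qed
  then have "esq g h f y = (\<Sum>i\<in>UNIV. \<Sum>\<alpha>\<in>UNIV. \<Sum>j\<in>UNIV. ?G i j * (?A j \<bullet> axis \<alpha> 1) * (?A i \<bullet> (h (f y) *v axis \<alpha> 1)))"
    unfolding esq_def by (simp add: sum_distrib_left mult.assoc) (intro sum.cong refl sum.swap)
  also have "\<dots> = (\<Sum>\<alpha>\<in>UNIV. \<Sum>i\<in>UNIV. hv y (axis \<alpha> 1) $ i * (?A i \<bullet> (h (f y) *v axis \<alpha> 1)))"
    by (subst sum.swap) (simp add: hv_component sum_distrib_right)
  also have "\<dots> = (\<Sum>\<alpha>\<in>UNIV. fder f y (hv y (axis \<alpha> 1)) \<bullet> (h (f y) *v axis \<alpha> 1))"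
  proof (rule sum.cong[OF refl])
    fix \<alpha>
    show "(\<Sum>i\<in>UNIV. hv y (axis \<alpha> 1) $ i * (?A i \<bullet> (h (f y) *v axis \<alpha> 1))) = fder f y (hv y (axis \<alpha> 1)) \<bullet> (h (f y) *v axis \<alpha> 1)"
      using arg_cong[OF linear_axis_expansion[OF df_linear[OF y], of "hv y (axis \<alpha> 1)"], of "\<lambda>v. v \<bullet> (h (f y) *v axis \<alpha> 1)"]
      by (simp add: inner_sum_left)
  qed
  also have "\<dots> = (\<Sum>\<alpha>\<in>(UNIV :: 'n set). l y)"
  proof (rule sum.cong[OF refl])
    fix \<alpha> :: 'n
    show "fder f y (hv y (axis \<alpha> 1)) \<bullet> (h (f y) *v axis \<alpha> 1) = l y"
      unfolding T.g_commute[OF f_mem[OF y], of "fder f y (hv y (axis \<alpha> 1))"]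
      using h_df_hv[OF y, of "axis \<alpha> 1"] by (simp add: inner_axis)
  qed
  finally show ?thesis by simp
qed

end

context riem_manifold
begin

lemma continuous_map_smooth_fun:
  assumes "smooth_fun M f"
  shows "continuous_map (mtop M) euclideanreal f"
  unfolding continuous_map_def
proof (intro conjI allI impI)
  fix S :: "real set" assume "openin euclideanreal S"
  then have S: "open S" by simp
  have "openin (mtop M) (\<Union>c\<in>atlas M. {x \<in> cdom c. cmap c x \<in> cimg c \<inter> (\<lambda>y. f (cinv c y)) -` S})"
  proof (intro openin_Union ballI)
    fix T assume "T \<in> (\<lambda>c. {x \<in> cdom c. cmap c x \<in> cimg c \<inter> (\<lambda>y. f (cinv c y)) -` S}) ` atlas M"
    then obtain c where c: "c \<in> atlas M" and T: "T = {x \<in> cdom c. cmap c x \<in> cimg c \<inter> (\<lambda>y. f (cinv c y)) -` S}" by blast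
    have "continuous_on (cimg c) (\<lambda>y. f (cinv c y))"
      using assms c smooth_on_continuous unfolding smooth_fun_def o_def by blast
    then have "open (cimg c \<inter> (\<lambda>y. f (cinv c y)) -` S)"
      by (rule continuous_open_preimage[OF _ open_cimg[OF c] S])
    then show "openin (mtop M) T" unfolding T by (rule openin_preimage_cmap[OF c])
  qed
  moreover have "(\<Union>c\<in>atlas M. {x \<in> cdom c. cmap c x \<in> cimg c \<inter> (\<lambda>y. f (cinv c y)) -` S}) = {x \<in> topspace (mtop M). f x \<in> S}"
    (is "?L = ?R")
  proof (intro equalityI subsetI)
    fix x assume "x \<in> ?R"
    then show "x \<in> ?L" using chart_at_spec[of x] by (auto simp: cinv_cmap intro!: bexI[of _ "chart_at M x"])
  next
    fix x assume "x \<in> ?L"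
    then obtain c where "c \<in> atlas M" "x \<in> cdom c" "f (cinv c (cmap c x)) \<in> S" by blast
    then show "x \<in> ?R" using cdom_subset[of c] by (auto simp: cinv_cmap)
  qed
  ultimately show "openin (mtop M) {x \<in> topspace (mtop M). f x \<in> S}" by simp
qed auto

lemma vol_integrable_chart:
  fixes \<phi> :: "real^'m \<Rightarrow> real"
  assumes comp: "compact_space (mtop M)" and c: "c \<in> atlas M" and \<phi>: "\<phi> \<in> borel_measurable borel"
    and B: "\<And>y. \<bar>\<phi> y\<bar> \<le> B"
  shows "integrable (vol_measure M) (\<lambda>x. indicator (cdom c) x * \<phi> (cmap c x))"
proof -
  interpret finite_measure "vol_measure M"
    using finite_vol[OF comp] by (intro finite_measureI) (simp add: space_vol[OF comp])
  have D: "cdom c \<inter> space (vol_measure M) \<in> sets (vol_measure M)"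
    using openin_borel[OF openin_cdom[OF c]] cdom_subset[OF c]
    by (simp add: space_vol[OF comp] sets_vol[OF comp] Int_absorb2)
  have "(\<lambda>x. \<phi> (cmap c x)) \<in> borel_measurable (restrict_space (vol_measure M) (cdom c))"
    by (rule measurable_compose[OF cmap_measurable[OF comp c] \<phi>])
  then have "(\<lambda>x. indicator (cdom c) x *\<^sub>R \<phi> (cmap c x)) \<in> borel_measurable (vol_measure M)"
    using borel_measurable_restrict_space_iff[OF D, of "\<lambda>x. \<phi> (cmap c x)"] by simp
  then have "(\<lambda>x. indicator (cdom c) x * \<phi> (cmap c x)) \<in> borel_measurable (vol_measure M)" by simp
  then show ?thesis using B abs_ge_zero[of "\<phi> _"] order_trans
    by (intro integrable_const_bound[of _ B]) (auto simp: indicator_def intro: order_trans[OF abs_ge_zero B])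
qed

end

text \<open>The integral of a compactly supported function does not change under translation along
  \<open>v\<close>; differentiating it at translation parameter 0 under the integral sign gives the
  claim.\<close>

lemma integral_partial_zero:
  fixes \<psi> :: "'a::euclidean_space \<Rightarrow> real"
  assumes K: "compact K" "K \<subseteq> box a b" and zero: "\<And>y. y \<notin> K \<Longrightarrow> \<psi> y = 0"
    and der: "\<And>y. y \<in> box a b \<Longrightarrow> \<psi> differentiable (at y)"
    and cont: "continuous_on (box a b) (\<lambda>y. fder \<psi> y v)"
  shows "integral (cbox a b) (\<lambda>y. fder \<psi> y v) = 0"
proof -
  \<comment> \<open>Off \<open>K\<close> the function vanishes on an open set, so the regularity
    assumed on the box extends to the whole space.\<close>
  have oK: "open (- K)" using K by (simp add: compact_imp_closed open_Compl)
  have d0: "(\<psi> has_derivative (\<lambda>v. 0)) (at y)" if "y \<notin> K" for y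
    by (rule has_derivative_transform_within_open[OF has_derivative_const oK, of _ 0]) (use that zero in auto)
  have f0: "fder \<psi> y v = 0" if "y \<notin> K" for y using fder_eqI[OF d0[OF that]] by simp
  have der': "\<psi> differentiable (at y)" for y
    using der K(2) d0 by (cases "y \<in> K") (auto simp: differentiable_def)
  have cont': "isCont (\<lambda>y. fder \<psi> y v) y" for y
  proof (cases "y \<in> K")
    case True
    then show ?thesis using cont K(2) by (auto simp: continuous_on_eq_continuous_at open_box)
  next
    case False
    have "((\<lambda>y. fder \<psi> y v) \<longlongrightarrow> 0) (at y)"
      by (rule tendsto_eventually) (use eventually_at_topological oK False f0 in blast)
    then show ?thesis using f0[OF False] by (simp add: isCont_def)
  qed
  obtain B where B: "\<And>y. y \<in> K \<Longrightarrow> norm y \<le> B" using compact_imp_bounded[OF K(1)] unfolding bounded_iff by blast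
  \<comment> \<open>A fixed box containing all translates of the support by
    \<open>t *\<^sub>R v\<close> with \<bar>t\<bar> \<le> 1, so that the domain of integration is
    independent of \<open>t\<close>.\<close>
  obtain c :: 'a where c: "cball 0 (B + norm v) \<subseteq> cbox (- c) c"
    using bounded_subset_cbox_symmetric[OF bounded_cball] by blast
  have big: "y \<in> cbox (- c) c" if "y + t *\<^sub>R v \<in> K" "\<bar>t\<bar> \<le> 1" for y and t :: real
  proof -
    have "norm y \<le> norm (y + t *\<^sub>R v) + norm (t *\<^sub>R v)" using norm_triangle_ineq4[of "y + t *\<^sub>R v" "t *\<^sub>R v"] by simp
    also have "\<dots> \<le> B + norm v" using B[OF that(1)] that(2) by (intro add_mono) (auto intro: mult_left_le_one_le)
    finally show ?thesis using c by (auto simp: subset_iff)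
  qed
  have c\<psi>: "continuous_on A \<psi>" for A
    using der' by (intro continuous_at_imp_continuous_on ballI differentiable_imp_continuous_within)
  have on_UNIV: "integral S F = integral UNIV F" if "\<And>y. y \<notin> S \<Longrightarrow> F y = 0" for S and F :: "'a \<Rightarrow> real"
  proof -
    have "F = (\<lambda>y. if y \<in> S then F y else 0)" using that by auto
    then show ?thesis using integral_restrict_UNIV[of S F] by simp
  qed
  have const: "integral (cbox (- c) c) (\<lambda>y. \<psi> (y + t *\<^sub>R v)) = integral UNIV \<psi>" if t: "\<bar>t\<bar> \<le> 1" for t :: real
  proof -
    have "integral (cbox (- c) c) (\<lambda>y. \<psi> (y + t *\<^sub>R v)) = integral (cbox (- c + t *\<^sub>R v) (c + t *\<^sub>R v)) \<psi>"
      using integral_shift_cbox_plus[of "- c" c \<psi> "t *\<^sub>R v"] by (simp add: o_def add.commute)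
    also have "\<dots> = integral UNIV \<psi>"
    proof (rule on_UNIV)
      fix y assume "y \<notin> cbox (- c + t *\<^sub>R v) (c + t *\<^sub>R v)"
      then have "y - t *\<^sub>R v \<notin> cbox (- c) c" by (auto simp: mem_box inner_diff_left inner_add_left algebra_simps)
      then have "y \<notin> K" using big[of "y - t *\<^sub>R v" t] t by auto
      then show "\<psi> y = 0" by (rule zero)
    qed
    finally show ?thesis .
  qed
  let ?I = "\<lambda>t. integral (cbox (- c) c) (\<lambda>y. \<psi> (y + t *\<^sub>R v))"
  have "(?I has_field_derivative integral (cbox (- c) c) (\<lambda>y. fder \<psi> (y + 0 *\<^sub>R v) v)) (at 0 within {-1<..<1})"
  proof (rule leibniz_rule_field_derivative)
    fix t y
    have "((\<lambda>t. y + t *\<^sub>R v) has_derivative (\<lambda>s. s *\<^sub>R v)) (at t)"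
      by (auto intro!: derivative_eq_intros)
    then have "((\<lambda>t. \<psi> (y + t *\<^sub>R v)) has_derivative (\<lambda>s. fder \<psi> (y + t *\<^sub>R v) (s *\<^sub>R v))) (at t)"
      by (rule has_derivative_compose[OF _ fder_works[OF der']])
    moreover have "(\<lambda>s. fder \<psi> (y + t *\<^sub>R v) (s *\<^sub>R v)) = (*) (fder \<psi> (y + t *\<^sub>R v) v)"
      using linear_frechet_derivative[OF der'] by (auto simp: linear_scale fun_eq_iff)
    ultimately show "((\<lambda>t. \<psi> (y + t *\<^sub>R v)) has_field_derivative fder \<psi> (y + t *\<^sub>R v) v) (at t within {-1<..<1})"
      by (simp add: has_field_derivative_def has_derivative_at_withinI)
  next
    fix t :: real
    have "continuous_on (cbox (- c) c) (\<lambda>y. \<psi> (y + t *\<^sub>R v))"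
      by (intro continuous_on_compose2[OF c\<psi>[of UNIV]] continuous_intros) auto
    then show "(\<lambda>y. \<psi> (y + t *\<^sub>R v)) integrable_on cbox (- c) c" by (rule integrable_continuous)
  next
    have "continuous_on UNIV (\<lambda>y. fder \<psi> y v)" using cont' by (intro continuous_at_imp_continuous_on) auto
    then show "continuous_on ({-1<..<1} \<times> cbox (- c) c) (\<lambda>(t, y). fder \<psi> (y + t *\<^sub>R v) v)"
      unfolding case_prod_unfold by (rule continuous_on_compose2) (auto intro!: continuous_intros)
  qed auto
  then have "(?I has_field_derivative integral (cbox (- c) c) (\<lambda>y. fder \<psi> y v)) (at 0)"
    by (simp add: at_within_open[of 0 "{-1<..<1::real}"])
  moreover have "(?I has_field_derivative 0) (at 0)"
    by (rule has_field_derivative_transform_within_open[of "\<lambda>t. integral UNIV \<psi>" _ _ "{-1<..<1}"]) (auto simp: const)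
  ultimately have "integral (cbox (- c) c) (\<lambda>y. fder \<psi> y v) = 0" by (rule DERIV_unique)
  moreover have "integral (cbox (- c) c) (\<lambda>y. fder \<psi> y v) = integral UNIV (\<lambda>y. fder \<psi> y v)"
    using big[of _ 0] f0 by (intro on_UNIV) auto
  moreover have "integral (cbox a b) (\<lambda>y. fder \<psi> y v) = integral UNIV (\<lambda>y. fder \<psi> y v)"
    using K(2) f0 box_subset_cbox by (intro on_UNIV) blast
  ultimately show ?thesis by simp
qed

section \<open>The first variation in a chart\<close>

context conformal_map
begin

text \<open>A straight-line motion in target coordinates, cut off by \<open>\<phi>\<close>. It stays
  in the target domain only for small \<open>t\<close>, which \<open>ex_variation_bound\<close>
  provides.\<close>

definition var_map :: "(real^'m \<Rightarrow> real) \<Rightarrow> real^'n \<Rightarrow> real \<Rightarrow> real^'m \<Rightarrow> real^'n" where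
  "var_map \<phi> w t y = f y + (t * \<phi> y) *\<^sub>R w"

text \<open>The partial derivatives of \<open>var_map\<close>, written out so that their affine
  dependence on \<open>t\<close> is visible.\<close>

definition var_partial :: "(real^'m \<Rightarrow> real) \<Rightarrow> real^'n \<Rightarrow> 'm \<Rightarrow> real \<Rightarrow> real^'m \<Rightarrow> real^'n" where
  "var_partial \<phi> w i t y = fder f y (axis i 1) + t *\<^sub>R (fder \<phi> y (axis i 1) *\<^sub>R w)"

definition var_energy :: "(real^'m \<Rightarrow> real) \<Rightarrow> real^'n \<Rightarrow> real \<Rightarrow> real^'m \<Rightarrow> real" where
  "var_energy \<phi> w t y = (\<Sum>i\<in>UNIV. \<Sum>j\<in>UNIV. matrix_inv (g y) $ i $ j *
     (var_partial \<phi> w i t y \<bullet> (h (var_map \<phi> w t y) *v var_partial \<phi> w j t y)))"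

definition var_energy_deriv :: "(real^'m \<Rightarrow> real) \<Rightarrow> real^'n \<Rightarrow> real \<Rightarrow> real^'m \<Rightarrow> real" where
  "var_energy_deriv \<phi> w t y = (\<Sum>i\<in>UNIV. \<Sum>j\<in>UNIV. matrix_inv (g y) $ i $ j *
     (var_partial \<phi> w i t y \<bullet> (h (var_map \<phi> w t y) *v (fder \<phi> y (axis j 1) *\<^sub>R w) + \<phi> y *\<^sub>R (T.dg (var_map \<phi> w t y) w *v var_partial \<phi> w j t y))
       + (fder \<phi> y (axis i 1) *\<^sub>R w) \<bullet> (h (var_map \<phi> w t y) *v var_partial \<phi> w j t y)))"

lemma esq_var_map:
  assumes sm: "smooth_on UNIV \<phi>" and y: "y \<in> D"
  shows "esq g h (var_map \<phi> w t) y = var_energy \<phi> w t y"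
proof -
  have "(var_map \<phi> w t has_derivative (\<lambda>v. fder f y v + (t * fder \<phi> y v) *\<^sub>R w)) (at y)"
    unfolding var_map_def
    by (intro has_derivative_add f_has_derivative[OF y] has_derivative_scaleR_left has_derivative_mult_right
        smooth_on_has_derivative[OF sm]) simp
  then have "fder (var_map \<phi> w t) y (axis i 1) = var_partial \<phi> w i t y" for i
    by (simp add: fder_eqI var_partial_def)
  then show ?thesis by (simp add: esq_def var_energy_def)
qed

lemma var_energy_has_derivative:
  assumes y: "y \<in> D" and p: "var_map \<phi> w t y \<in> E"
  shows "((\<lambda>t. var_energy \<phi> w t y) has_real_derivative var_energy_deriv \<phi> w t y) (at t)"
proof -
  let ?p = "var_map \<phi> w t y"
  have dv: "((\<lambda>t. var_partial \<phi> w i t y) has_derivative (\<lambda>s. s *\<^sub>R (fder \<phi> y (axis i 1) *\<^sub>R w))) (at t)" for i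
    unfolding var_partial_def by (auto intro!: derivative_eq_intros)
  have "((\<lambda>t. var_map \<phi> w t y) has_derivative (\<lambda>s. (s * \<phi> y) *\<^sub>R w)) (at t)"
    unfolding var_map_def by (auto intro!: derivative_eq_intros)
  from has_derivative_compose[OF this T.g_has_derivative[OF p]]
  have dh: "((\<lambda>t. h (var_map \<phi> w t y)) has_derivative (\<lambda>s. T.dg ?p ((s * \<phi> y) *\<^sub>R w))) (at t)" .
  have "((\<lambda>t. var_energy \<phi> w t y) has_derivative (\<lambda>s. \<Sum>i\<in>UNIV. \<Sum>j\<in>UNIV. matrix_inv (g y) $ i $ j *
     (var_partial \<phi> w i t y \<bullet> (h ?p *v (s *\<^sub>R (fder \<phi> y (axis j 1) *\<^sub>R w)) + T.dg ?p ((s * \<phi> y) *\<^sub>R w) *v var_partial \<phi> w j t y)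
       + (s *\<^sub>R (fder \<phi> y (axis i 1) *\<^sub>R w)) \<bullet> (h ?p *v var_partial \<phi> w j t y)))) (at t)"
    unfolding var_energy_def
    by (intro has_derivative_sum has_derivative_mult_right bounded_bilinear.FDERIV[OF bounded_bilinear_inner dv]
        bounded_bilinear.FDERIV[OF bounded_bilinear_matrix_vector_mult dh dv])
  moreover have "(\<Sum>i\<in>UNIV. \<Sum>j\<in>UNIV. matrix_inv (g y) $ i $ j *
     (var_partial \<phi> w i t y \<bullet> (h ?p *v (s *\<^sub>R (fder \<phi> y (axis j 1) *\<^sub>R w)) + T.dg ?p ((s * \<phi> y) *\<^sub>R w) *v var_partial \<phi> w j t y)
       + (s *\<^sub>R (fder \<phi> y (axis i 1) *\<^sub>R w)) \<bullet> (h ?p *v var_partial \<phi> w j t y))) = var_energy_deriv \<phi> w t y * s" for s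
    unfolding var_energy_deriv_def sum_distrib_right
    by (intro sum.cong refl) (simp add: linear_scale[OF T.dg_linear[OF p]] matrix_vector_mult_scaleR
        scaleR_matrix_vector_assoc[symmetric] inner_add_right algebra_simps)
  ultimately show ?thesis by (simp add: has_field_derivative_def)
qed

lemma continuous_var_energy:
  assumes sm: "smooth_on UNIV \<phi>" and S: "S \<subseteq> UNIV \<times> D" "\<And>t y. (t, y) \<in> S \<Longrightarrow> var_map \<phi> w t y \<in> E"
  shows "continuous_on S (\<lambda>(t, y). var_energy \<phi> w t y)" "continuous_on S (\<lambda>(t, y). var_energy_deriv \<phi> w t y)"
proof -
  have snd: "continuous_on S (\<lambda>p. F (snd p))" if "continuous_on D F" for F :: "real^'m \<Rightarrow> 'c::topological_space"
    using S(1) by (intro continuous_on_compose2[OF that]) (auto intro: continuous_intros)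
  have G: "continuous_on S (\<lambda>p. matrix_inv (g (snd p)) $ i $ j)" for i j
    using smooth_on_continuous[OF S.smooth_inv_g] by (intro snd continuous_intros)
  have A: "continuous_on S (\<lambda>p. fder f (snd p) v)" for v
    by (intro snd smooth_on_continuous smooth_on_fder smooth_f)
  have \<phi>: "continuous_on S (\<lambda>p. \<phi> (snd p))" "continuous_on S (\<lambda>p. fder \<phi> (snd p) v)" for v
    using smooth_on_continuous[OF smooth_on_subset[OF sm]] smooth_on_continuous[OF smooth_on_subset[OF smooth_on_fder[OF sm]]]
    by (auto intro!: snd)
  have p: "continuous_on S (\<lambda>p. var_map \<phi> w (fst p) (snd p))"
    unfolding var_map_def by (intro continuous_intros \<phi> snd smooth_on_continuous smooth_f)
  have E: "continuous_on S (\<lambda>p. F (var_map \<phi> w (fst p) (snd p)))" if "continuous_on E F" for F :: "real^'n \<Rightarrow> 'c::topological_space"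
    using S(2) by (intro continuous_on_compose2[OF that p]) auto
  have h: "continuous_on S (\<lambda>p. h (var_map \<phi> w (fst p) (snd p)))" "continuous_on S (\<lambda>p. T.dg (var_map \<phi> w (fst p) (snd p)) v)" for v
    using smooth_on_continuous[OF T.smooth_g] smooth_on_continuous[OF smooth_on_fder[OF T.smooth_g]] by (auto intro!: E)
  have v: "continuous_on S (\<lambda>p. var_partial \<phi> w i (fst p) (snd p))" for i
    unfolding var_partial_def by (intro continuous_intros \<phi> A)
  show "continuous_on S (\<lambda>(t, y). var_energy \<phi> w t y)" "continuous_on S (\<lambda>(t, y). var_energy_deriv \<phi> w t y)"
    unfolding case_prod_unfold var_energy_def var_energy_deriv_def
    by (intro continuous_intros G v \<phi> h bounded_bilinear.continuous_on[OF bounded_bilinear_matrix_vector_mult])+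
qed

lemma var_energy_0: "y \<in> D \<Longrightarrow> var_energy \<phi> w 0 y = real CARD('n) * l y"
  using esq_conformal[of y] by (simp add: var_energy_def esq_def var_partial_def var_map_def)

text \<open>The two terms that differentiate \<open>\<phi>\<close> agree after exchanging the
  summation indices; contraction with the inverse metric turns them into a component of
  \<open>hv\<close>.\<close>

lemma var_energy_deriv_0:
  assumes y: "y \<in> D"
  shows "var_energy_deriv \<phi> w 0 y = 2 * (\<Sum>i\<in>UNIV. fder \<phi> y (axis i 1) * hv y (h (f y) *v w) $ i)
    + \<phi> y * (\<Sum>i\<in>UNIV. \<Sum>j\<in>UNIV. matrix_inv (g y) $ i $ j *
          (fder f y (axis i 1) \<bullet> (T.dg (f y) w *v fder f y (axis j 1))))"
proof -
  let ?A = "\<lambda>i. fder f y (axis i 1)" and ?G = "\<lambda>i j. matrix_inv (g y) $ i $ j" and ?d = "\<lambda>i. fder \<phi> y (axis i 1)"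
  have "?A i \<bullet> (h (f y) *v w) = w \<bullet> (h (f y) *v ?A i)" for i by (rule T.g_commute[OF f_mem[OF y]])
  then have hv: "hv y (h (f y) *v w) $ i = (\<Sum>j\<in>UNIV. ?G i j * (w \<bullet> (h (f y) *v ?A j)))" for i
    by (simp add: hv_component)
  have "var_energy_deriv \<phi> w 0 y = (\<Sum>i\<in>UNIV. \<Sum>j\<in>UNIV. ?G i j * (?d j * (?A i \<bullet> (h (f y) *v w))))
    + \<phi> y * (\<Sum>i\<in>UNIV. \<Sum>j\<in>UNIV. ?G i j * (?A i \<bullet> (T.dg (f y) w *v ?A j)))
    + (\<Sum>i\<in>UNIV. \<Sum>j\<in>UNIV. ?G i j * (?d i * (w \<bullet> (h (f y) *v ?A j))))"
    by (simp add: var_energy_deriv_def var_partial_def var_map_def matrix_vector_mult_scaleR inner_add_right sum.distrib sum_distrib_left algebra_simps)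
  also have "(\<Sum>i\<in>UNIV. \<Sum>j\<in>UNIV. ?G i j * (?d j * (?A i \<bullet> (h (f y) *v w))))
      = (\<Sum>i\<in>UNIV. \<Sum>j\<in>UNIV. ?G i j * (?d i * (w \<bullet> (h (f y) *v ?A j))))"
    by (subst sum_inv_g_commute[OF y]) (simp add: T.g_commute[OF f_mem[OF y], of w])
  also have "(\<Sum>i\<in>UNIV. \<Sum>j\<in>UNIV. ?G i j * (?d i * (w \<bullet> (h (f y) *v ?A j))))
      = (\<Sum>i\<in>UNIV. ?d i * hv y (h (f y) *v w) $ i)"
    by (simp add: hv sum_distrib_left mult_ac)
  finally show ?thesis by simp
qed

text \<open>Compactness keeps the variation inside the target domain and its energy density
  positive. Positivity matters because \<open>F\<close> is differentiated at this density and is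
  two-sided differentiable at positive arguments.\<close>

lemma ex_variation_bound:
  assumes sm: "smooth_on UNIV \<phi>" and sub: "cbox a b \<subseteq> D"
  obtains \<epsilon> where "\<epsilon> > 0" "\<And>t y. \<bar>t\<bar> < \<epsilon> \<Longrightarrow> y \<in> cbox a b \<Longrightarrow> var_map \<phi> w t y \<in> E \<and> var_energy \<phi> w t y > 0"
proof (cases "cbox a b = {}")
  case True
  then show ?thesis using that[of 1] by auto
next
  case ne: False
  have "compact (f ` cbox a b)"
    using smooth_on_continuous[OF smooth_on_subset[OF smooth_f sub]] by (rule compact_continuous_image) simp
  moreover have "f ` cbox a b \<subseteq> E" using f_mem sub by blast
  ultimately obtain \<delta> where \<delta>: "\<delta> > 0" "(\<Union>x\<in>f ` cbox a b. ball x \<delta>) \<subseteq> E"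
    using compact_subset_open_imp_ball_epsilon_subset[OF _ T.open_D] by metis
  have "compact (\<phi> ` cbox a b)"
    using smooth_on_continuous[OF smooth_on_subset[OF sm]] by (intro compact_continuous_image) auto
  then have "bounded (\<phi> ` cbox a b)" by (rule compact_imp_bounded)
  then obtain B where "\<forall>x\<in>\<phi> ` cbox a b. norm x \<le> B" unfolding bounded_iff by blast
  then have B: "\<bar>\<phi> y\<bar> \<le> B" if "y \<in> cbox a b" for y using that by simp
  have B0: "B \<ge> 0" using ne B by (metis abs_ge_zero all_not_in_conv order_trans)
  \<comment> \<open>Makes the displacement \<bar>t\<bar> \<bar>\<phi>\<bar> \<bar>w\<bar> smaller
    than \<open>\<delta>\<close>; the summand 1 keeps the denominator positive.\<close>
  define e where "e = \<delta> / (B * norm w + 1)"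
  have Bw: "B * norm w + 1 > 0" using B0 by (simp add: add_nonneg_pos)
  have e: "e > 0" using \<delta> Bw by (simp add: e_def)
  have p: "var_map \<phi> w t y \<in> E" if "\<bar>t\<bar> < e" "y \<in> cbox a b" for t y
  proof -
    have "dist (f y) (var_map \<phi> w t y) = \<bar>t\<bar> * (\<bar>\<phi> y\<bar> * norm w)" by (simp add: var_map_def dist_norm abs_mult)
    also have "\<dots> \<le> \<bar>t\<bar> * (B * norm w + 1)"
      using B[OF that(2)] by (intro mult_left_mono) (auto intro: order_trans[OF mult_right_mono])
    also have "\<dots> < e * (B * norm w + 1)" using that(1) Bw by (intro mult_strict_right_mono)
    also have "\<dots> = \<delta>" using Bw by (simp add: e_def)
    finally have "var_map \<phi> w t y \<in> (\<Union>x\<in>f ` cbox a b. ball x \<delta>)" using that(2) by auto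
    then show ?thesis using \<delta>(2) by blast
  qed
  let ?S = "{-(e/2)..e/2} \<times> cbox a b"
  have "continuous_on ?S (\<lambda>(t, y). var_energy \<phi> w t y)"
    using sub p e by (intro continuous_var_energy(1) sm) auto
  then have "uniformly_continuous_on ?S (\<lambda>(t, y). var_energy \<phi> w t y)"
    by (rule compact_uniformly_continuous) (auto intro: compact_Times)
  moreover obtain m where m: "m > 0" "\<And>y. y \<in> cbox a b \<Longrightarrow> m \<le> var_energy \<phi> w 0 y"
  proof -
    have "continuous_on (cbox a b) l" using smooth_on_continuous[OF smooth_on_subset[OF smooth_l sub]] .
    then obtain z where z: "z \<in> cbox a b" "\<And>y. y \<in> cbox a b \<Longrightarrow> l z \<le> l y"
      using continuous_attains_inf[OF compact_cbox ne] by blast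
    show ?thesis
    proof (rule that[of "real CARD('n) * l z"])
      show "real CARD('n) * l z > 0" using l_pos z sub by auto
      show "real CARD('n) * l z \<le> var_energy \<phi> w 0 y" if "y \<in> cbox a b" for y
        using z(2)[OF that] that sub by (subst var_energy_0) (auto intro: mult_left_mono)
    qed
  qed
  \<comment> \<open>The density at parameter 0 is at least \<open>m\<close>, so a change of less
    than \<open>m\<close> keeps it positive.\<close>
  ultimately obtain d where d: "d > 0" "\<And>p q. p \<in> ?S \<Longrightarrow> q \<in> ?S \<Longrightarrow> dist p q < d \<Longrightarrow>
      dist (case p of (t, y) \<Rightarrow> var_energy \<phi> w t y) (case q of (t, y) \<Rightarrow> var_energy \<phi> w t y) < m"
    unfolding uniformly_continuous_on_def by (metis (no_types, lifting) m(1))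
  show ?thesis
  proof (rule that[of "min d (e/2)"])
    show "min d (e/2) > 0" using d e by simp
    fix t y assume t: "\<bar>t\<bar> < min d (e/2)" and y: "y \<in> cbox a b"
    have "-(e/2) \<le> t" "t \<le> e/2" using t by (auto simp: abs_less_iff)
    then have "dist (var_energy \<phi> w t y) (var_energy \<phi> w 0 y) < m"
      using d(2)[of "(t, y)" "(0, y)"] t y e by (auto simp: dist_Pair_Pair abs_le_iff)
    then have "var_energy \<phi> w t y > 0" using m(2)[OF y] by (auto simp: dist_real_def)
    then show "var_map \<phi> w t y \<in> E \<and> var_energy \<phi> w t y > 0" using p[of t y] t y e by auto
  qed
qed

text \<open>Differentiation under the integral sign. The value at parameter 0 is subtracted because
  the global energies of the varied map and of \<open>u\<close> differ by exactly this
  integral.\<close>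

lemma energy_has_derivative:
  assumes sm: "smooth_on UNIV \<phi>" and sub: "cbox a b \<subseteq> D" and \<epsilon>: "\<epsilon> > 0"
    and pos: "\<And>t y. \<bar>t\<bar> < \<epsilon> \<Longrightarrow> y \<in> cbox a b \<Longrightarrow> var_map \<phi> w t y \<in> E \<and> var_energy \<phi> w t y > 0"
    and F: "\<And>s. s > 0 \<Longrightarrow> (F has_real_derivative F' s) (at s)" and F': "continuous_on {0<..} F'"
  shows "((\<lambda>t. integral (cbox a b) (\<lambda>y. sqrt (det (g y)) * (F (var_energy \<phi> w t y / 2) - F (var_energy \<phi> w 0 y / 2))))
     has_real_derivative integral (cbox a b) (\<lambda>y. sqrt (det (g y)) * (F' (var_energy \<phi> w 0 y / 2) * (var_energy_deriv \<phi> w 0 y / 2)))) (at 0)"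
proof -
  let ?U = "{-\<epsilon><..<\<epsilon>}"
  have sg: "continuous_on D (\<lambda>y. sqrt (det (g y)))"
    using S.det_g by (intro smooth_on_continuous smooth_on_sqrt smooth_on_det S.open_D S.smooth_g)
  have SU: "continuous_on (?U \<times> cbox a b) (\<lambda>(t, y). var_energy \<phi> w t y)" "continuous_on (?U \<times> cbox a b) (\<lambda>(t, y). var_energy_deriv \<phi> w t y)"
    using sub pos by (auto intro!: continuous_var_energy sm)
  have cF: "continuous_on {0<..} F"
    using F DERIV_isCont by (intro continuous_at_imp_continuous_on) auto
  have "((\<lambda>t. integral (cbox a b) (\<lambda>y. sqrt (det (g y)) * (F (var_energy \<phi> w t y / 2) - F (var_energy \<phi> w 0 y / 2))))
     has_field_derivative integral (cbox a b) (\<lambda>y. sqrt (det (g y)) * (F' (var_energy \<phi> w 0 y / 2) * (var_energy_deriv \<phi> w 0 y / 2)))) (at 0 within ?U)"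
  proof (rule leibniz_rule_field_derivative)
    fix t y assume t: "t \<in> ?U" and y: "y \<in> cbox a b"
    have y': "y \<in> D" using y sub by blast
    have p: "var_map \<phi> w t y \<in> E" "var_energy \<phi> w t y > 0" using pos[of t y] t y by auto
    have "((\<lambda>t. F (var_energy \<phi> w t y / 2)) has_real_derivative F' (var_energy \<phi> w t y / 2) * (var_energy_deriv \<phi> w t y / 2)) (at t)"
      using p by (intro DERIV_chain2[OF F] DERIV_cdivide var_energy_has_derivative[OF y' p(1)]) auto
    then have "((\<lambda>t. sqrt (det (g y)) * (F (var_energy \<phi> w t y / 2) - F (var_energy \<phi> w 0 y / 2))) has_real_derivative
       sqrt (det (g y)) * (F' (var_energy \<phi> w t y / 2) * (var_energy_deriv \<phi> w t y / 2))) (at t)"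
      by (auto intro!: derivative_eq_intros)
    then show "((\<lambda>t. sqrt (det (g y)) * (F (var_energy \<phi> w t y / 2) - F (var_energy \<phi> w 0 y / 2))) has_real_derivative
       sqrt (det (g y)) * (F' (var_energy \<phi> w t y / 2) * (var_energy_deriv \<phi> w t y / 2))) (at t within ?U)"
      by (rule has_field_derivative_at_within)
  next
    fix t assume t: "t \<in> ?U"
    have var_energy: "continuous_on (cbox a b) (\<lambda>y. F (var_energy \<phi> w t y / 2))" if "t \<in> ?U" for t
    proof -
      have "continuous_on (cbox a b) (\<lambda>y. case (t, y) of (t, y) \<Rightarrow> var_energy \<phi> w t y)"
        using that by (intro continuous_on_compose2[OF SU(1)] continuous_intros) auto
      then show ?thesis using that pos by (intro continuous_on_compose2[OF cF] continuous_intros) auto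
    qed
    have "continuous_on (cbox a b) (\<lambda>y. sqrt (det (g y)) * (F (var_energy \<phi> w t y / 2) - F (var_energy \<phi> w 0 y / 2)))"
      using t \<epsilon> by (intro continuous_on_mult continuous_on_diff continuous_on_subset[OF sg sub] var_energy) auto
    then show "(\<lambda>y. sqrt (det (g y)) * (F (var_energy \<phi> w t y / 2) - F (var_energy \<phi> w 0 y / 2))) integrable_on cbox a b"
      by (rule integrable_continuous)
  next
    have 1: "continuous_on (?U \<times> cbox a b) (\<lambda>p. sqrt (det (g (snd p))))"
      using sub by (intro continuous_on_compose2[OF sg]) (auto intro: continuous_intros)
    have 2: "continuous_on (?U \<times> cbox a b) (\<lambda>p. F' (var_energy \<phi> w (fst p) (snd p) / 2))"
      using SU(1) pos unfolding case_prod_unfold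
      by (intro continuous_on_compose2[OF F'] continuous_intros) auto
    show "continuous_on (?U \<times> cbox a b) (\<lambda>(t, y). sqrt (det (g y)) * (F' (var_energy \<phi> w t y / 2) * (var_energy_deriv \<phi> w t y / 2)))"
      using SU(2) unfolding case_prod_unfold by (intro continuous_on_mult 1 2 continuous_on_divide continuous_on_const) auto
  qed (use \<epsilon> in auto)
  then show ?thesis using \<epsilon> by (simp add: at_within_open[of 0 ?U])
qed

text \<open>Fundamental lemma of the calculus of variations. \<open>R\<close> is the Euler-Lagrange
  expression for a constant direction \<open>w\<close>; criticality makes its integral against every
  bump vanish, so \<open>R y0\<close> is 0, and \<open>euler_lagrange_tension\<close> identifies it
  with a positive multiple of the tension paired with \<open>w\<close>.\<close>

lemma tension_zero:
  assumes y0: "y0 \<in> D"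
    and F: "\<And>s. s > 0 \<Longrightarrow> (F has_real_derivative F' s) (at s)"
    and F': "\<And>s. s > 0 \<Longrightarrow> (F' has_real_derivative F'' s) (at s)"
    and F'': "continuous_on {0<..} F''" and F'_pos: "\<And>s. s > 0 \<Longrightarrow> F' s > 0"
    and dl: "\<And>y c. y \<in> D \<Longrightarrow> fder l y (hv y c) = 0"
    and crit: "\<And>\<phi> w a b K \<epsilon>. smooth_on UNIV \<phi> \<Longrightarrow> cbox a b \<subseteq> D \<Longrightarrow> compact K \<Longrightarrow> K \<subseteq> box a b \<Longrightarrow>
       (\<And>y. y \<notin> K \<Longrightarrow> \<phi> y = 0) \<Longrightarrow> \<epsilon> > 0 \<Longrightarrow>
       (\<And>t y. \<bar>t\<bar> < \<epsilon> \<Longrightarrow> y \<in> cbox a b \<Longrightarrow> var_map \<phi> w t y \<in> E \<and> var_energy \<phi> w t y > 0) \<Longrightarrow>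
       ((\<lambda>t. integral (cbox a b) (\<lambda>y. sqrt (det (g y)) * (F (var_energy \<phi> w t y / 2) - F (var_energy \<phi> w 0 y / 2))))
          has_real_derivative 0) (at 0)"
  shows "tension y0 = 0"
proof -
  let ?n = "real CARD('n)"
  \<comment> \<open>The argument is half of |df|^2, by \<open>esq_conformal\<close>.\<close>
  define P where "P y = F' (?n * l y / 2)" for y
  define P' where "P' y v = F'' (?n * l y / 2) * (?n * fder l y v / 2)" for y v
  have nl: "?n * l y / 2 > 0" if "y \<in> D" for y using l_pos[OF that] by simp
  have dP: "(P has_derivative P' y) (at y)" if y: "y \<in> D" for y
  proof -
    have "((\<lambda>y. ?n * l y / 2) has_derivative (\<lambda>v. ?n * fder l y v / 2)) (at y)"
      by (intro bounded_linear.has_derivative[OF bounded_linear_divide] has_derivative_mult_right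
        smooth_on_has_derivative[OF smooth_l y])
    from has_derivative_compose[OF this F'[OF nl[OF y], unfolded has_field_derivative_def]]
    show ?thesis unfolding P_def P'_def[abs_def] .
  qed
  have cP: "continuous_on D P"
    using dP by (intro has_derivative_continuous_on[of D P P']) (auto intro: has_derivative_at_withinI)
  have cP': "continuous_on D (\<lambda>y. P' y v)" for v
    unfolding P'_def
    by (intro continuous_intros continuous_on_compose2[OF F''] smooth_on_continuous[OF smooth_l]
        smooth_on_continuous[OF smooth_on_fder[OF smooth_l]]) (use nl in auto)
  have "tension y0 \<bullet> (h (f y0) *v w) = 0" for w
  proof -
    \<comment> \<open>The smooth factor is kept apart from \<open>P\<close>, for which only one
      continuous derivative is available.\<close>
    define s where "s i y = sqrt (det (g y)) * hv y (h (f y) *v w) $ i" for i y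
    define q where "q i y = P y * s i y" for i y
    have smh: "smooth_on D (\<lambda>z. h (f z) *v w)"
      by (intro smooth_on_matrix_vector_mult S.open_D smooth_on_const
        smooth_on_compose[OF S.open_D T.open_D T.smooth_g smooth_f]) (auto intro: f_mem)
    have sms: "smooth_on D (s i)" for i
      unfolding s_def using S.det_g
      by (intro smooth_on_mult smooth_on_sqrt smooth_on_det smooth_on_vec_nth smooth_hv S.open_D S.smooth_g smh) auto
    have dq: "(q i has_derivative (\<lambda>v. P y * fder (s i) y v + P' y v * s i y)) (at y)" if "y \<in> D" for i y
      unfolding q_def by (rule has_derivative_mult[OF dP[OF that] smooth_on_has_derivative[OF sms that]])
    have fq: "fder (q i) y v = P y * fder (s i) y v + P' y v * s i y" if "y \<in> D" for i y v
      using fder_eqI[OF dq[OF that]] by simp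
    have cq: "continuous_on D (q i)" "continuous_on D (\<lambda>y. fder (q i) y v)" for i v
    proof -
      show "continuous_on D (q i)" unfolding q_def by (intro continuous_intros cP smooth_on_continuous sms)
      have "continuous_on D (\<lambda>y. P y * fder (s i) y v + P' y v * s i y)"
        by (intro continuous_intros cP cP' smooth_on_continuous sms smooth_on_fder)
      then show "continuous_on D (\<lambda>y. fder (q i) y v)" using fq by (simp cong: continuous_on_cong)
    qed
    define H where "H y = (\<Sum>i\<in>UNIV. \<Sum>j\<in>UNIV. matrix_inv (g y) $ i $ j *
          (fder f y (axis i 1) \<bullet> (T.dg (f y) w *v fder f y (axis j 1))))" for y
    define R where "R y = (\<Sum>i\<in>UNIV. fder (q i) y (axis i 1)) - P y * sqrt (det (g y)) * (H y / 2)" for y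
    have R: "R y = P y * sqrt (det (g y)) * (tension y \<bullet> (h (f y) *v w))" if y: "y \<in> D" for y
    proof -
      have "P' y (hv y a) = 0" for a using dl[OF y] by (simp add: P'_def)
      from euler_lagrange_tension[OF y dP[OF y] this, of w] show ?thesis
        unfolding R_def H_def q_def s_def by (simp add: mult.assoc)
    qed
    have cR: "continuous_on D R"
    proof -
      have "continuous_on D (\<lambda>y. T.dg (f y) w)"
        using smooth_on_continuous[OF smooth_on_fder[OF T.smooth_g]] f_mem
        by (intro continuous_on_compose2[OF _ smooth_on_continuous[OF smooth_f]]) auto
      then have "continuous_on D H" unfolding H_def
        by (intro continuous_intros bounded_bilinear.continuous_on[OF bounded_bilinear_matrix_vector_mult]
          smooth_on_continuous[OF S.smooth_inv_g] smooth_on_continuous[OF smooth_on_fder[OF smooth_f]])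
      then show ?thesis unfolding R_def using S.det_g
        by (intro continuous_intros cq cP smooth_on_continuous[OF smooth_on_det[OF S.open_D S.smooth_g]]) auto
    qed
    have int0: "integral (cbox a b) (\<lambda>y. \<phi> y * R y) = 0"
      if sm: "smooth_on UNIV \<phi>" and sub: "cbox a b \<subseteq> D" and K: "compact K" "K \<subseteq> box a b" and z: "\<And>y. y \<notin> K \<Longrightarrow> \<phi> y = 0"
      for \<phi> a b K
    proof -
      obtain \<epsilon> where \<epsilon>: "\<epsilon> > 0" "\<And>t y. \<bar>t\<bar> < \<epsilon> \<Longrightarrow> y \<in> cbox a b \<Longrightarrow> var_map \<phi> w t y \<in> E \<and> var_energy \<phi> w t y > 0"
        by (rule ex_variation_bound[OF sm sub, of w]) blast
      have cF': "continuous_on {0<..} F'" using F' DERIV_isCont by (intro continuous_at_imp_continuous_on) auto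
      have "integral (cbox a b) (\<lambda>y. sqrt (det (g y)) * (F' (var_energy \<phi> w 0 y / 2) * (var_energy_deriv \<phi> w 0 y / 2))) = 0"
        by (rule DERIV_unique[OF energy_has_derivative[OF sm sub \<epsilon> F cF'] crit[OF sm sub K z \<epsilon>]])
      have box: "box a b \<subseteq> D" using sub box_subset_cbox by blast
      \<comment> \<open>Integration by parts: the divergence of these compactly supported components
        integrates to 0, which moves the derivative from \<open>\<phi>\<close> to
        \<open>q\<close>.\<close>
      let ?\<psi> = "\<lambda>i y. \<phi> y * q i y"
      have d\<psi>: "(?\<psi> i has_derivative (\<lambda>v. \<phi> y * fder (q i) y v + fder \<phi> y v * q i y)) (at y)" if "y \<in> D" for i y
        using has_derivative_mult[OF smooth_on_has_derivative[OF sm UNIV_I] dq[OF that]] fq[OF that] by simp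
      have f\<psi>: "fder (?\<psi> i) y v = \<phi> y * fder (q i) y v + fder \<phi> y v * q i y" if "y \<in> D" for i y v
        using fder_eqI[OF d\<psi>[OF that]] by simp
      have c\<psi>: "continuous_on D (\<lambda>y. fder (?\<psi> i) y v)" for i v
      proof -
        have "continuous_on D (\<lambda>y. \<phi> y * fder (q i) y v + fder \<phi> y v * q i y)"
          by (intro continuous_intros cq smooth_on_continuous[OF smooth_on_subset[OF sm]]
            smooth_on_continuous[OF smooth_on_subset[OF smooth_on_fder[OF sm]]]) auto
        then show ?thesis using f\<psi> by (simp cong: continuous_on_cong)
      qed
      have i\<psi>: "integral (cbox a b) (\<lambda>y. fder (?\<psi> i) y (axis i 1)) = 0" for i
      proof (rule integral_partial_zero[OF K _ _ continuous_on_subset[OF c\<psi> box]])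
        show "?\<psi> i differentiable (at y)" if "y \<in> box a b" for y
          using d\<psi>[of y i] that box unfolding differentiable_def by blast
      qed (simp add: z)
      have "sqrt (det (g y)) * (F' (var_energy \<phi> w 0 y / 2) * (var_energy_deriv \<phi> w 0 y / 2))
         = (\<Sum>i\<in>UNIV. fder (?\<psi> i) y (axis i 1)) - \<phi> y * R y" if y: "y \<in> cbox a b" for y
      proof -
        have yD: "y \<in> D" using y sub by blast
        have "sqrt (det (g y)) * (F' (var_energy \<phi> w 0 y / 2) * (var_energy_deriv \<phi> w 0 y / 2))
          = (\<Sum>i\<in>UNIV. fder \<phi> y (axis i 1) * q i y) + \<phi> y * (P y * sqrt (det (g y)) * (H y / 2))"
          unfolding var_energy_deriv_0[OF yD] var_energy_0[OF yD] P_def[symmetric] H_def[symmetric] q_def s_def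
          by (simp add: sum_distrib_left algebra_simps)
        then show ?thesis unfolding R_def f\<psi>[OF yD] by (simp add: sum.distrib sum_distrib_left algebra_simps)
      qed
      then have "integral (cbox a b) (\<lambda>y. sqrt (det (g y)) * (F' (var_energy \<phi> w 0 y / 2) * (var_energy_deriv \<phi> w 0 y / 2)))
         = integral (cbox a b) (\<lambda>y. (\<Sum>i\<in>UNIV. fder (?\<psi> i) y (axis i 1)) - \<phi> y * R y)"
        by (rule integral_cong)
      also have "\<dots> = (\<Sum>i\<in>UNIV. integral (cbox a b) (\<lambda>y. fder (?\<psi> i) y (axis i 1))) - integral (cbox a b) (\<lambda>y. \<phi> y * R y)"
      proof -
        have 1: "(\<lambda>y. fder (?\<psi> i) y (axis i 1)) integrable_on cbox a b" for i
          by (rule integrable_continuous[OF continuous_on_subset[OF c\<psi> sub]])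
        have 2: "(\<lambda>y. \<phi> y * R y) integrable_on cbox a b"
          by (intro integrable_continuous continuous_intros continuous_on_subset[OF cR sub]
            smooth_on_continuous[OF smooth_on_subset[OF sm]]) auto
        show ?thesis using 1 2 by (subst integral_diff) (auto intro!: integrable_sum simp: integral_sum)
      qed
      finally show ?thesis
        using i\<psi> \<open>integral (cbox a b) (\<lambda>y. sqrt (det (g y)) * (F' (var_energy \<phi> w 0 y / 2) * (var_energy_deriv \<phi> w 0 y / 2))) = 0\<close> by simp
    qed
    \<comment> \<open>\<open>c\<close> will be 1 or -1, so one argument excludes both signs of
      \<open>R y0\<close>.\<close>
    have nonzero: False if R0: "c * R y0 > 0" for c
    proof -
      have "continuous_on D (\<lambda>y. c * R y)" by (intro continuous_intros cR)
      then have "open (D \<inter> (\<lambda>y. c * R y) -` {0<..})"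
        by (rule continuous_open_preimage[OF _ S.open_D]) simp
      moreover have "y0 \<in> D \<inter> (\<lambda>y. c * R y) -` {0<..}" using y0 R0 by simp
      ultimately obtain a b where ab: "cbox a b \<subseteq> D \<inter> (\<lambda>y. c * R y) -` {0<..}" "y0 \<in> box a b"
        using open_contains_cbox by metis
      obtain r where r: "r > 0" "cball y0 r \<subseteq> box a b" using open_box ab(2) open_contains_cball by blast
      obtain \<phi> :: "real^'m \<Rightarrow> real" where \<phi>: "smooth_on UNIV \<phi>" "\<And>y. \<phi> y \<ge> 0" "\<phi> y0 > 0" "\<And>y. dist y0 y \<ge> r \<Longrightarrow> \<phi> y = 0"
        using smooth_bump[OF r(1)] by blast
      have sub: "cbox a b \<subseteq> D" using ab by blast
      have i0: "integral (cbox a b) (\<lambda>y. \<phi> y * R y) = 0"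
        using r(2) \<phi>(4) by (intro int0[OF \<phi>(1) sub compact_cball]) auto
      have cont: "continuous_on (cbox a b) (\<lambda>y. c * (\<phi> y * R y))"
        by (intro continuous_intros continuous_on_subset[OF cR sub] smooth_on_continuous[OF smooth_on_subset[OF \<phi>(1)]]) auto
      have "c * (\<phi> y0 * R y0) = 0"
      proof (rule has_integral_0_cbox_imp_0[OF cont])
        show "0 \<le> c * (\<phi> y * R y)" if "y \<in> box a b" for y
        proof -
          have "0 < c * R y" using that ab(1) box_subset_cbox by blast
          then have "0 \<le> \<phi> y * (c * R y)" using \<phi>(2)[of y] by simp
          then show ?thesis by (simp add: mult.left_commute)
        qed
        have "((\<lambda>y. c * (\<phi> y * R y)) has_integral integral (cbox a b) (\<lambda>y. c * (\<phi> y * R y))) (cbox a b)"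
          by (rule integrable_integral[OF integrable_continuous[OF cont]])
        then show "((\<lambda>y. c * (\<phi> y * R y)) has_integral 0) (cbox a b)" by (simp add: i0)
        show "box a b \<noteq> {}" "y0 \<in> cbox a b" using ab(2) box_subset_cbox by blast+
      qed
      then show False using R0 \<phi>(3) by auto
    qed
    have "R y0 = 0" using nonzero[of 1] nonzero[of "-1"] by (cases "R y0 > 0"; cases "R y0 < 0") auto
    moreover have "P y0 > 0" unfolding P_def by (rule F'_pos[OF nl[OF y0]])
    moreover have "sqrt (det (g y0)) > 0" using S.det_g[OF y0] by simp
    ultimately show ?thesis using R[OF y0] by simp
  qed
  \<comment> \<open>Taking the tension itself as \<open>w\<close> and using positive
    definiteness.\<close>
  then have "tension y0 \<bullet> (h (f y0) *v tension y0) = 0" by blast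
  then show ?thesis using T.pos_g[OF f_mem[OF y0], of "tension y0"] by (metis less_irrefl)
qed

end

section \<open>Variations supported in a chart\<close>

lemma esq_cong:
  assumes "open T" "y \<in> T" "\<And>z. z \<in> T \<Longrightarrow> f z = f' z"
  shows "esq g h f y = esq g h f' y"
  using fder_cong_open[OF assms] assms(2,3) by (simp add: esq_def)

text \<open>One test variation in a pair of charts, to be extended by \<open>u\<close> to the whole
  manifold.\<close>

locale chart_variation = riem_map M N u
  for M :: "('a, 'm::finite) riemannian" and N :: "('b, 'n::finite) riemannian" and u +
  fixes c d lam \<phi> and w :: "real^'n" and a b K \<epsilon>
  assumes cm: "compact_space (mtop M)" "Hausdorff_space (mtop M)"
    and hc: "horizontally_conformal M N u lam" and c: "c \<in> atlas M" and d: "d \<in> atlas N"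
    and sm_\<phi>: "smooth_on UNIV \<phi>" and sub: "cbox a b \<subseteq> reg c d" and K: "compact K" "K \<subseteq> box a b"
    and \<phi>_zero: "\<And>y. y \<notin> K \<Longrightarrow> \<phi> y = 0" and \<epsilon>: "\<epsilon> > 0"
    and pos: "\<And>t y. \<bar>t\<bar> < \<epsilon> \<Longrightarrow> y \<in> cbox a b \<Longrightarrow>
       conformal_map.var_map (local_rep c d u) \<phi> w t y \<in> cimg d \<and>
       conformal_map.var_energy (gram M c) (gram N d) (local_rep c d u) \<phi> w t y > 0"
begin

sublocale L: conformal_map "reg c d" "gram M c" "cimg d" "gram N d" "local_rep c d u" "\<lambda>y. (lam (cinv c y))\<^sup>2"
  by (rule conformal_map[OF hc c d])

abbreviation "p \<equiv> L.var_map \<phi> w"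

definition var_support :: "'a set" where
  "var_support = {x \<in> cdom c. cmap c x \<in> K}"

definition U :: "real \<Rightarrow> 'a \<Rightarrow> 'b" where
  "U t x = (if x \<in> var_support then cinv d (p t (cmap c x)) else u x)"

lemma box_sub: "box a b \<subseteq> reg c d" "K \<subseteq> reg c d" "reg c d \<subseteq> cimg c"
  using sub K box_subset_cbox[of a b] unfolding reg_def by blast+

text \<open>The support is a compact image in a Hausdorff space. Its complement is therefore open,
  which is needed to glue the variation to \<open>u\<close>.\<close>

lemma closed_var_support: "closedin (mtop M) var_support"
proof -
  have "continuous_map (top_of_set (cimg c)) (mtop M) (cinv c)"
    unfolding continuous_map_def
  proof (intro conjI allI impI funcsetI)
    fix V assume "openin (mtop M) V"
    from A.open_preimage_cinv[OF c this]
    show "openin (top_of_set (cimg c)) {x \<in> topspace (top_of_set (cimg c)). cinv c x \<in> V}"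
      using open_subset[of "{y \<in> cimg c. cinv c y \<in> V}" "cimg c"] by auto
  qed (use A.cdom_subset[OF c] A.cinv_in[of _ c] in auto)
  moreover have "compactin (top_of_set (cimg c)) K"
    using K box_sub by (simp add: compactin_subtopology)
  ultimately have "compactin (mtop M) (cinv c ` K)" by (rule image_compactin[rotated])
  moreover have "cinv c ` K = var_support"
    unfolding var_support_def using box_sub A.cinv_in[of _ c] A.cmap_cinv[of _ c] A.cinv_cmap[OF c] by (force simp: image_iff)
  ultimately show ?thesis using compactin_imp_closedin[OF cm(2)] by simp
qed

lemma open_compl_var_support: "openin (mtop M) (topspace (mtop M) - var_support)"
  using closed_var_support by (simp add: openin_diff)

lemma local_rep_box: "y \<in> reg c d \<Longrightarrow> cinv d (local_rep c d u y) = u (cinv c y)"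
  by (simp add: local_rep_eq reg_def B.cinv_cmap d)

text \<open>On the box outside \<open>K\<close> the cutoff vanishes and both branches of
  \<open>U\<close> agree. Thus \<open>U\<close> has a single formula on each of two open sets
  covering \<open>M\<close>: the box and the complement of the support.\<close>

lemma U_box:
  assumes "x \<in> cdom c" "cmap c x \<in> box a b"
  shows "U t x = cinv d (p t (cmap c x))"
proof (cases "x \<in> var_support")
  case False
  then have "\<phi> (cmap c x) = 0" using assms \<phi>_zero by (auto simp: var_support_def)
  then have "p t (cmap c x) = local_rep c d u (cmap c x)" by (simp add: L.var_map_def)
  then show ?thesis using False local_rep_box[of "cmap c x"] assms box_sub
    by (auto simp: U_def A.cinv_cmap[OF c])
qed (simp add: U_def)

lemma U_outside: "x \<notin> var_support \<Longrightarrow> U t x = u x"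
  by (simp add: U_def)

lemma var_support_box: "x \<in> var_support \<Longrightarrow> x \<in> cdom c \<and> cmap c x \<in> box a b"
  using K by (auto simp: var_support_def)

lemma p_in: "\<bar>t\<bar> < \<epsilon> \<Longrightarrow> y \<in> box a b \<Longrightarrow> p t y \<in> cimg d"
  using pos box_subset_cbox by blast

lemma continuous_p: "continuous_on (UNIV \<times> reg c d) (\<lambda>q. p (fst q) (snd q))"
  unfolding L.var_map_def
  by (intro continuous_intros continuous_on_compose2[OF smooth_on_continuous[OF smooth_local_rep[OF c d]]]
      continuous_on_compose2[OF smooth_on_continuous[OF sm_\<phi>]]) auto

lemma continuous_U:
  "continuous_map (prod_topology (top_of_set {-\<epsilon><..<\<epsilon>}) (mtop M)) (mtop N) (\<lambda>(t, x). U t x)"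
proof -
  let ?X = "prod_topology (top_of_set {-\<epsilon><..<\<epsilon>}) (mtop M)"
  have UN: "U t x \<in> topspace (mtop N)" if "\<bar>t\<bar> < \<epsilon>" "x \<in> topspace (mtop M)" for t x
  proof (cases "x \<in> var_support")
    case True
    then have "U t x \<in> cdom d" using U_box var_support_box[OF True] p_in that by (simp add: B.cinv_in)
    then show ?thesis using B.cdom_subset[OF d] by blast
  qed (use that u_in U_outside in auto)
  have "openin ?X {q \<in> topspace ?X. (case q of (t, x) \<Rightarrow> U t x) \<in> V}" if V: "openin (mtop N) V" for V
  proof (subst openin_subopen, intro ballI)
    fix q assume "q \<in> {q \<in> topspace ?X. (case q of (t, x) \<Rightarrow> U t x) \<in> V}"
    then obtain t0 x0 where q: "q = (t0, x0)" "t0 \<in> {-\<epsilon><..<\<epsilon>}" "x0 \<in> topspace (mtop M)" "U t0 x0 \<in> V" by auto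
    show "\<exists>T. openin ?X T \<and> q \<in> T \<and> T \<subseteq> {q \<in> topspace ?X. (case q of (t, x) \<Rightarrow> U t x) \<in> V}"
    proof (cases "x0 \<in> var_support")
      case False
      let ?W = "{x \<in> topspace (mtop M). u x \<in> V} \<inter> (topspace (mtop M) - var_support)"
      have "openin (mtop M) ?W"
        using smooth_u V unfolding smooth_map_def
        by (intro openin_Int open_compl_var_support) (auto intro: openin_continuous_map_preimage)
      then have "openin ?X ({-\<epsilon><..<\<epsilon>} \<times> ?W)" by (simp add: openin_prod_Times_iff)
      moreover have "q \<in> {-\<epsilon><..<\<epsilon>} \<times> ?W" using q False U_outside[OF False] by auto
      moreover have "{-\<epsilon><..<\<epsilon>} \<times> ?W \<subseteq> {q \<in> topspace ?X. (case q of (t, x) \<Rightarrow> U t x) \<in> V}"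
        using U_outside by auto
      ultimately show ?thesis by blast
    next
      case True
      let ?Z = "{z \<in> cimg d. cinv d z \<in> V}"
      have S: "open ({-\<epsilon><..<\<epsilon>} \<times> box a b)" by (intro open_Times open_greaterThanLessThan open_box)
      have "open (({-\<epsilon><..<\<epsilon>} \<times> box a b) \<inter> (\<lambda>q. p (fst q) (snd q)) -` ?Z)"
        using box_sub by (intro continuous_open_preimage S B.open_preimage_cinv d V
          continuous_on_subset[OF continuous_p]) auto
      moreover have "(t0, cmap c x0) \<in> ({-\<epsilon><..<\<epsilon>} \<times> box a b) \<inter> (\<lambda>q. p (fst q) (snd q)) -` ?Z"
        using q var_support_box[OF True] U_box[of x0 t0] p_in[of t0 "cmap c x0"] by auto
      ultimately obtain T W where TW: "open T" "open W" "t0 \<in> T" "cmap c x0 \<in> W"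
        "T \<times> W \<subseteq> ({-\<epsilon><..<\<epsilon>} \<times> box a b) \<inter> (\<lambda>q. p (fst q) (snd q)) -` ?Z"
        by (rule open_prod_elim) (auto simp: subset_iff)
      have "T \<subseteq> {-\<epsilon><..<\<epsilon>}" using TW by blast
      then have "openin (top_of_set {-\<epsilon><..<\<epsilon>}) T" using TW(1) by (simp add: open_subset)
      then have "openin ?X (T \<times> {x \<in> cdom c. cmap c x \<in> W})"
        using A.openin_preimage_cmap[OF c TW(2)] by (simp add: openin_prod_Times_iff)
      moreover have "q \<in> T \<times> {x \<in> cdom c. cmap c x \<in> W}" using q TW var_support_box[OF True] by auto
      moreover have "T \<times> {x \<in> cdom c. cmap c x \<in> W} \<subseteq> {q \<in> topspace ?X. (case q of (t, x) \<Rightarrow> U t x) \<in> V}"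
      proof (intro subsetI)
        fix r assume "r \<in> T \<times> {x \<in> cdom c. cmap c x \<in> W}"
        then obtain t x where r: "r = (t, x)" "t \<in> T" "x \<in> cdom c" "cmap c x \<in> W" by blast
        then have "(t, cmap c x) \<in> ({-\<epsilon><..<\<epsilon>} \<times> box a b) \<inter> (\<lambda>q. p (fst q) (snd q)) -` ?Z" using TW by blast
        then show "r \<in> {q \<in> topspace ?X. (case q of (t, x) \<Rightarrow> U t x) \<in> V}"
          using r U_box[of x t] A.cdom_subset[OF c] by auto
      qed
      ultimately show ?thesis by blast
    qed
  qed
  then show ?thesis unfolding continuous_map_def using UN by auto
qed

text \<open>Off the support \<open>U\<close> is \<open>u\<close> and does not depend on
  \<open>t\<close>; on the box it is \<open>p\<close> conjugated by the two chart transitions.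
  Either formula is smooth jointly in \<open>t\<close> and the coordinates.\<close>

lemma U_local_smooth:
  assumes c': "c' \<in> atlas M" and d': "d' \<in> atlas N" and t0: "\<bar>t0\<bar> < \<epsilon>" and y0: "y0 \<in> cimg c'" "U t0 (cinv c' y0) \<in> cdom d'"
  obtains T g where "open T" "(t0, y0) \<in> T" "smooth_on T g" "\<And>t y. (t, y) \<in> T \<Longrightarrow> local_rep c' d' (U t) y = g (t, y)"
proof (cases "cinv c' y0 \<in> var_support")
  case False
  let ?W = "reg c' d' \<inter> {y \<in> cimg c'. cinv c' y \<in> topspace (mtop M) - var_support}"
  have oW: "open ?W" by (intro open_Int open_reg A.open_preimage_cinv open_compl_var_support c' d')
  have "smooth_on (UNIV \<times> ?W) (\<lambda>q :: real \<times> (real^'m). local_rep c' d' u (snd q))"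
    by (rule smooth_on_compose[OF _ open_reg[OF c' d'] smooth_local_rep[OF c' d'] smooth_on_linear[OF bounded_linear_snd]])
       (use oW in \<open>auto intro: open_Times\<close>)
  moreover have "(t0, y0) \<in> UNIV \<times> ?W"
    using y0 False U_outside[OF False] A.cdom_subset[OF c'] A.cinv_in[OF y0(1)] by (auto simp: reg_def)
  ultimately show ?thesis
    using U_outside oW by (intro that[of "UNIV \<times> ?W"]) (auto simp: local_rep_eq local_rep_def intro: open_Times)
next
  case True
  let ?tr = "transition c' c"
  let ?S1 = "{-\<epsilon><..<\<epsilon>} \<times> (A.overlap c' c \<inter> ?tr -` box a b)"
  let ?P = "\<lambda>q. p (fst q) (?tr (snd q))"
  let ?T = "?S1 \<inter> ?P -` B.overlap d d'"
  have ctr: "continuous_on (A.overlap c' c) ?tr" by (rule smooth_on_continuous[OF A.smooth_transition[OF c' c]])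
  have oS2: "open (A.overlap c' c \<inter> ?tr -` box a b)"
    by (rule continuous_open_preimage[OF ctr A.open_overlap[OF c' c] open_box])
  have oS1: "open ?S1" by (intro open_Times oS2 open_greaterThanLessThan)
  have smt: "smooth_on ?S1 (\<lambda>q. ?tr (snd q))"
    by (rule smooth_on_compose[OF oS1 A.open_overlap[OF c' c] A.smooth_transition[OF c' c] smooth_on_linear[OF bounded_linear_snd]]) auto
  have smP: "smooth_on ?S1 ?P"
    unfolding L.var_map_def
  proof (intro smooth_on_add smooth_on_scaleR smooth_on_mult smooth_on_const oS1)
    show "smooth_on ?S1 (\<lambda>q. local_rep c d u (?tr (snd q)))"
      by (rule smooth_on_compose[OF oS1 open_reg[OF c d] smooth_local_rep[OF c d] smt]) (use box_sub in auto)
    show "smooth_on ?S1 fst" by (rule smooth_on_linear[OF bounded_linear_fst])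
    show "smooth_on ?S1 (\<lambda>q. \<phi> (?tr (snd q)))"
      by (rule smooth_on_compose[OF oS1 open_UNIV sm_\<phi> smt]) auto
  qed
  have oT: "open ?T" by (rule continuous_open_preimage[OF smooth_on_continuous[OF smP] oS1 B.open_overlap[OF d d']])
  have smg: "smooth_on ?T (\<lambda>q. transition d d' (?P q))"
    by (rule smooth_on_compose[OF oT B.open_overlap[OF d d'] B.smooth_transition[OF d d'] smooth_on_subset[OF smP]]) auto
  have tr_eq: "?tr y = cmap c (cinv c' y)" for y by (rule A.transition_eq)
  have "(t0, y0) \<in> ?T"
    using True var_support_box[OF True] U_box[of "cinv c' y0" t0] y0 t0 p_in[OF t0, of "?tr y0"]
    by (auto simp: A.overlap_def B.overlap_def tr_eq)
  moreover have "local_rep c' d' (U t) y = transition d d' (?P (t, y))" if "(t, y) \<in> ?T" for t y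
    using that U_box[of "cinv c' y" t] by (auto simp: local_rep_def A.overlap_def tr_eq B.transition_eq)
  ultimately show ?thesis using that[OF oT _ smg] by blast
qed

lemma smooth_variation_U: "smooth_variation M N u \<epsilon> U"
  unfolding smooth_variation_def
proof (intro conjI ballI)
  show "\<epsilon> > 0" by (rule \<epsilon>)
  show "continuous_map (prod_topology (top_of_set {-\<epsilon><..<\<epsilon>}) (mtop M)) (mtop N) (\<lambda>(t, x). U t x)" by (rule continuous_U)
  show "U 0 x = u x" if "x \<in> topspace (mtop M)" for x
    using U_box[of x 0] local_rep_box[of "cmap c x"] var_support_box[of x] box_sub A.cinv_cmap[OF c, of x]
    by (cases "x \<in> var_support") (auto simp: U_outside L.var_map_def)
  fix c' d' assume c': "c' \<in> atlas M" "d' \<in> atlas N"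
  show "smooth_on {(t, y). t \<in> {-\<epsilon><..<\<epsilon>} \<and> y \<in> cimg c' \<and> U t (cinv c' y) \<in> cdom d'} (\<lambda>(t, y). local_rep c' d' (U t) y)"
  proof (rule smooth_on_local)
    fix q assume "q \<in> {(t, y). t \<in> {-\<epsilon><..<\<epsilon>} \<and> y \<in> cimg c' \<and> U t (cinv c' y) \<in> cdom d'}"
    then obtain t0 y0 where q: "q = (t0, y0)" "\<bar>t0\<bar> < \<epsilon>" "y0 \<in> cimg c'" "U t0 (cinv c' y0) \<in> cdom d'" by auto
    obtain T g where "open T" "(t0, y0) \<in> T" "smooth_on T g" "\<And>t y. (t, y) \<in> T \<Longrightarrow> local_rep c' d' (U t) y = g (t, y)"
      by (rule U_local_smooth[OF c' q(2-4)]) blast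
    then show "\<exists>T g. open T \<and> q \<in> T \<and> smooth_on T g \<and> (\<forall>z\<in>T. (case z of (t, y) \<Rightarrow> local_rep c' d' (U t) y) = g z)"
      using q by (intro exI[of _ T] exI[of _ g]) auto
  qed
qed

text \<open>Lets \<open>hs_norm_sq_chart\<close> be applied to each map \<open>U t\<close>, not only
  to \<open>u\<close>.\<close>

lemma smooth_map_U:
  assumes t: "\<bar>t\<bar> < \<epsilon>"
  shows "smooth_map M N (U t)"
  unfolding smooth_map_def
proof (intro conjI ballI)
  have "continuous_map (mtop M) (prod_topology (top_of_set {-\<epsilon><..<\<epsilon>}) (mtop M)) (\<lambda>x. (t, x))"
    using t by (auto intro!: continuous_map_pairedI simp: continuous_map_const)
  from continuous_map_compose[OF this continuous_U] show "continuous_map (mtop M) (mtop N) (U t)"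
    by (simp add: o_def)
  fix c' d' assume c': "c' \<in> atlas M" "d' \<in> atlas N"
  show "smooth_on {y \<in> cimg c'. U t (cinv c' y) \<in> cdom d'} (local_rep c' d' (U t))"
  proof (rule smooth_on_local)
    fix y0 assume "y0 \<in> {y \<in> cimg c'. U t (cinv c' y) \<in> cdom d'}"
    then obtain T g where T: "open T" "(t, y0) \<in> T" "smooth_on T g" "\<And>t y. (t, y) \<in> T \<Longrightarrow> local_rep c' d' (U t) y = g (t, y)"
      by (auto intro: U_local_smooth[OF c' t])
    have "open (Pair t -` T)" using T(1) by (intro open_vimage) (auto intro: continuous_intros)
    moreover have "smooth_on (Pair t -` T) (\<lambda>y. g (t, y))"
      using calculation by (intro smooth_on_compose[OF _ T(1,3)] smooth_on_Pair smooth_on_const smooth_on_ident) auto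
    ultimately show "\<exists>T g. open T \<and> y0 \<in> T \<and> smooth_on T g \<and> (\<forall>z\<in>T. local_rep c' d' (U t) z = g z)"
      using T by (intro exI[of _ "Pair t -` T"] exI[of _ "\<lambda>y. g (t, y)"]) auto
  qed
qed

lemma hs_norm_sq_U_box:
  assumes t: "\<bar>t\<bar> < \<epsilon>" and x: "x \<in> cdom c" "cmap c x \<in> box a b"
  shows "hs_norm_sq M N (U t) x = L.var_energy \<phi> w t (cmap c x)"
proof -
  interpret V: riem_smooth_map M N "U t" by unfold_locales (rule smooth_map_U[OF t])
  have "U t x \<in> cdom d" unfolding U_box[OF x] using p_in[OF t x(2)] by (rule B.cinv_in)
  then have "hs_norm_sq M N (U t) x = esq (gram M c) (gram N d) (local_rep c d (U t)) (cmap c x)"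
    by (rule V.hs_norm_sq_chart[OF c d x(1)])
  also have "\<dots> = esq (gram M c) (gram N d) (p t) (cmap c x)"
  proof (rule esq_cong[OF open_box x(2)])
    fix z assume z: "z \<in> box a b"
    then have "z \<in> cimg c" using box_sub by blast
    then show "local_rep c d (U t) z = p t z"
      using U_box[of "cinv c z" t] z p_in[OF t z] by (simp add: local_rep_def)
  qed
  also have "\<dots> = L.var_energy \<phi> w t (cmap c x)" using x box_sub by (intro L.esq_var_map sm_\<phi>) auto
  finally show ?thesis .
qed

lemma hs_norm_sq_U_outside:
  assumes t: "\<bar>t\<bar> < \<epsilon>" and x: "x \<in> topspace (mtop M)" "x \<notin> var_support"
  shows "hs_norm_sq M N (U t) x = hs_norm_sq M N u x"
proof -
  interpret V: riem_smooth_map M N "U t" by unfold_locales (rule smooth_map_U[OF t])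
  obtain c' d' where c': "c' \<in> atlas M" "x \<in> cdom c'" and d': "d' \<in> atlas N" "u x \<in> cdom d'"
    using A.chart_at_spec[OF x(1)] B.chart_at_spec[OF u_in[OF x(1)]] by blast
  have "esq (gram M c') (gram N d') (local_rep c' d' (U t)) (cmap c' x) = esq (gram M c') (gram N d') (local_rep c' d' u) (cmap c' x)"
  proof (rule esq_cong[OF A.open_preimage_cinv[OF c'(1) open_compl_var_support]])
    show "cmap c' x \<in> {y \<in> cimg c'. cinv c' y \<in> topspace (mtop M) - var_support}"
      using c' x by (simp add: A.cinv_cmap)
  qed (simp add: local_rep_def U_outside)
  then show ?thesis
    using V.hs_norm_sq_chart[OF c'(1) d'(1) c'(2)] hs_norm_sq_chart[OF c'(1) d'(1) c'(2) d'(2)] d'(2) U_outside[OF x(2)]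
    by simp
qed

lemma hs_norm_sq_u: "x \<in> topspace (mtop M) \<Longrightarrow> hs_norm_sq M N u x = real CARD('n) * (lam x)\<^sup>2"
proof -
  assume x: "x \<in> topspace (mtop M)"
  obtain c' d' where c': "c' \<in> atlas M" "x \<in> cdom c'" and d': "d' \<in> atlas N" "u x \<in> cdom d'"
    using A.chart_at_spec[OF x] B.chart_at_spec[OF u_in[OF x]] by blast
  interpret L': conformal_map "reg c' d'" "gram M c'" "cimg d'" "gram N d'" "local_rep c' d' u" "\<lambda>y. (lam (cinv c' y))\<^sup>2"
    by (rule conformal_map[OF hc c'(1) d'(1)])
  have "cmap c' x \<in> reg c' d'" using c' d' by (simp add: reg_def A.cinv_cmap)
  then show ?thesis
    unfolding hs_norm_sq_chart[OF c'(1) d'(1) c'(2) d'(2)] using L'.esq_conformal[of "cmap c' x"] c' by (simp add: A.cinv_cmap)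
qed

text \<open>The complement of \<open>K\<close> is open, so the derivative of \<open>\<phi>\<close>
  vanishes there along with \<open>\<phi>\<close>.\<close>

lemma var_energy_outside:
  assumes "y \<notin> K"
  shows "L.var_energy \<phi> w t y = L.var_energy \<phi> w 0 y"
proof -
  have "open (- K)" using K(1) by (simp add: compact_imp_closed open_Compl)
  then have "fder \<phi> y = fder (\<lambda>y. 0) y"
    using assms \<phi>_zero by (intro fder_cong_open[of "- K"]) auto
  then show ?thesis using \<phi>_zero[OF assms] by (simp add: L.var_energy_def L.var_partial_def L.var_map_def)
qed

text \<open>Splits the energy density into that of \<open>u\<close> plus a bounded Borel function
  supported in one chart. Both parts are integrable, and the second becomes an integral over the
  box.\<close>

lemma F_energy_U:
  assumes t: "\<bar>t\<bar> < \<epsilon>" and F: "continuous_on {0..} F"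
  shows "F_energy F M N (U t) = F_energy F M N u
     + integral (cbox a b) (\<lambda>y. sqrt (det (gram M c y)) * (F (L.var_energy \<phi> w t y / 2) - F (L.var_energy \<phi> w 0 y / 2)))"
proof -
  define \<Delta> where "\<Delta> y = F (L.var_energy \<phi> w t y / 2) - F (L.var_energy \<phi> w 0 y / 2)" for y
  define \<psi> where "\<psi> y = indicator (cbox a b) y * \<Delta> y" for y
  have var_energy: "continuous_on (cbox a b) (\<lambda>y. L.var_energy \<phi> w s y)" if "\<bar>s\<bar> < \<epsilon>" for s
  proof -
    have "continuous_on ({s} \<times> cbox a b) (\<lambda>(t, y). L.var_energy \<phi> w t y)"
      using sub pos that by (intro L.continuous_var_energy sm_\<phi>) auto
    then have "continuous_on (cbox a b) (\<lambda>y. case (s, y) of (t, y) \<Rightarrow> L.var_energy \<phi> w t y)"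
      by (rule continuous_on_compose2) (auto intro!: continuous_intros)
    then show ?thesis by simp
  qed
  have c\<Delta>: "continuous_on (cbox a b) \<Delta>"
    unfolding \<Delta>_def using t \<epsilon> pos
    by (intro continuous_on_diff continuous_on_compose2[OF F] continuous_on_divide var_energy continuous_on_const)
       (auto simp: less_imp_le)
  have m\<psi>: "\<psi> \<in> borel_measurable borel"
    unfolding \<psi>_def using borel_measurable_continuous_on_indicator[OF _ c\<Delta>] by simp
  have "bounded (\<Delta> ` cbox a b)" by (rule compact_imp_bounded[OF compact_continuous_image[OF c\<Delta> compact_cbox]])
  then obtain B0 where B0: "\<forall>x\<in>\<Delta> ` cbox a b. norm x \<le> B0" unfolding bounded_iff by blast
  have B: "\<bar>\<psi> y\<bar> \<le> max B0 0" for y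
    using B0 by (cases "y \<in> cbox a b") (auto simp: \<psi>_def)
  have ind: "F (hs_norm_sq M N (U t) x / 2) = F (hs_norm_sq M N u x / 2) + indicator (cdom c) x * \<psi> (cmap c x)"
    if x: "x \<in> topspace (mtop M)" for x
  proof (cases "x \<in> var_support")
    case True
    then have xb: "x \<in> cdom c" "cmap c x \<in> box a b" using var_support_box by auto
    then have "cmap c x \<in> reg c d" "cmap c x \<in> cbox a b" using box_sub box_subset_cbox by blast+
    moreover have "hs_norm_sq M N u x = L.var_energy \<phi> w 0 (cmap c x)"
      using hs_norm_sq_u[OF x] L.var_energy_0[OF \<open>cmap c x \<in> reg c d\<close>] xb by (simp add: A.cinv_cmap c)
    ultimately show ?thesis using hs_norm_sq_U_box[OF t xb] xb by (simp add: \<psi>_def \<Delta>_def)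
  next
    case False
    have "indicator (cdom c) x * \<psi> (cmap c x) = 0"
      using False var_energy_outside[of "cmap c x" t] by (auto simp: \<psi>_def \<Delta>_def indicator_def var_support_def)
    then show ?thesis using hs_norm_sq_U_outside[OF t x False] by simp
  qed
  note vol = A.space_vol[OF cm(1)]
  \<comment> \<open>The density of \<open>u\<close> is a continuous function of the dilation, hence
    integrable on a compact manifold.\<close>
  have int_u: "integrable (vol_measure M) (\<lambda>x. F (hs_norm_sq M N u x / 2))"
  proof -
    have "continuous_map (mtop M) euclideanreal lam"
      using hc unfolding horizontally_conformal_def by (intro A.continuous_map_smooth_fun) simp
    moreover have "continuous_on UNIV (\<lambda>s. F (real CARD('n) * s\<^sup>2 / 2))"
      by (intro continuous_on_compose2[OF F] continuous_intros) auto
    ultimately have "continuous_map (mtop M) euclideanreal ((\<lambda>s. F (real CARD('n) * s\<^sup>2 / 2)) \<circ> lam)"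
      by (intro continuous_map_compose) auto
    from A.continuous_imp_integrable_vol[OF cm(1) this]
    have "integrable (vol_measure M) ((\<lambda>s. F (real CARD('n) * s\<^sup>2 / 2)) \<circ> lam)" .
    moreover have "integrable (vol_measure M) ((\<lambda>s. F (real CARD('n) * s\<^sup>2 / 2)) \<circ> lam)
      = integrable (vol_measure M) (\<lambda>x. F (hs_norm_sq M N u x / 2))"
      by (rule Bochner_Integration.integrable_cong) (simp_all add: vol hs_norm_sq_u)
    ultimately show ?thesis by simp
  qed
  have "F_energy F M N (U t) = (LINT x|vol_measure M. F (hs_norm_sq M N u x / 2) + indicator (cdom c) x * \<psi> (cmap c x))"
    unfolding F_energy_def by (rule Bochner_Integration.integral_cong) (simp_all add: vol ind)
  also have "\<dots> = F_energy F M N u + (LINT x|vol_measure M. indicator (cdom c) x * \<psi> (cmap c x))"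
    unfolding F_energy_def
    by (rule Bochner_Integration.integral_add[OF int_u A.vol_integrable_chart[OF cm(1) c m\<psi> B]])
  also have "(LINT x|vol_measure M. indicator (cdom c) x * \<psi> (cmap c x)) = (LINT y|lborel. A.cdens c y * \<psi> y)"
    by (rule A.vol_integral_chart[OF cm(1) c m\<psi>])
  also have "\<dots> = (LINT y:cbox a b|lborel. sqrt (det (gram M c y)) * \<Delta> y)"
    unfolding set_lebesgue_integral_def using sub box_sub
    by (intro Bochner_Integration.integral_cong) (auto simp: \<psi>_def A.cdens_def indicator_def)
  also have "\<dots> = integral (cbox a b) (\<lambda>y. sqrt (det (gram M c y)) * \<Delta> y)"
  proof (rule set_borel_integral_eq_integral(2))
    have "continuous_on (cbox a b) (\<lambda>y. sqrt (det (gram M c y)) * \<Delta> y)"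
      using sub box_sub by (intro continuous_on_mult c\<Delta> continuous_on_subset[OF A.continuous_sqrt_det_gram[OF c]]) auto
    from borel_integrable_compact[OF compact_cbox this]
    show "set_integrable lborel (cbox a b) (\<lambda>y. sqrt (det (gram M c y)) * \<Delta> y)"
      by (simp add: set_integrable_def)
  qed
  finally show ?thesis unfolding \<Delta>_def .
qed

lemma critical:
  assumes "F_harmonic F M N u" and F: "continuous_on {0..} F"
  shows "((\<lambda>t. integral (cbox a b) (\<lambda>y. sqrt (det (gram M c y)) * (F (L.var_energy \<phi> w t y / 2) - F (L.var_energy \<phi> w 0 y / 2))))
     has_real_derivative 0) (at 0)"
proof -
  have "((\<lambda>t. F_energy F M N (U t)) has_real_derivative 0) (at 0)"
    using assms(1) smooth_variation_U unfolding F_harmonic_def by blast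
  then have "((\<lambda>t. F_energy F M N (U t) - F_energy F M N u) has_real_derivative 0) (at 0)"
    using DERIV_diff[OF _ DERIV_const] by fastforce
  then show ?thesis
    by (rule has_field_derivative_transform_within_open[of _ _ _ "{-\<epsilon><..<\<epsilon>}"]) (use \<epsilon> F_energy_U[OF _ F] in auto)
qed

end

theorem theorem3:
  fixes M :: "('a, 'm::finite) riemannian" and N :: "('b, 'n::finite) riemannian"
    and sg :: "('b, 'n) chart \<Rightarrow> real^'n \<Rightarrow> real"
    and u :: "'a \<Rightarrow> 'b" and lam :: "'a \<Rightarrow> real"
    and F F' F'' :: "real \<Rightarrow> real"
  assumes "compact_riemannian_manifold M" and "compact_riemannian_manifold N"
    and "CARD('m) > CARD('n)"
    and "orientation N sg"
    and "\<And>t. t \<ge> 0 \<Longrightarrow> F t \<ge> 0" and "F 0 = 0"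
    and "\<And>t. t \<ge> 0 \<Longrightarrow> (F has_real_derivative F' t) (at t within {0..})"
    and "\<And>t. t \<ge> 0 \<Longrightarrow> (F' has_real_derivative F'' t) (at t within {0..})"
    and "continuous_on {0..} F''"
    and "strict_mono_on {0..} F"
    and "\<And>t. t > 0 \<Longrightarrow> F' t > 0"
    and "F_harmonic F M N u"
    and "submersion M N u" and "horizontally_conformal M N u lam"
    and "horizontal_mean_curvature M N u
           (\<lambda>c y. (1 / (2 * (lam (cinv c y))\<^sup>2)) *\<^sub>R grad M (\<lambda>x. (lam x)\<^sup>2) c y)"
    and "discrete {t \<in> {0..}. (real CARD('n) - 2) * F' t - 2 * t * F'' t = 0}"
  shows "harmonic_form M CARD('n) (pullback M N u (volume_form N sg))
           \<longleftrightarrow> horizontal_completely_integrable M N u"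
proof -
  have "smooth_map M N u" using assms(13) unfolding submersion_def by simp
  interpret riem_map M N u
    using assms(1,2) assms(13) \<open>smooth_map M N u\<close> unfolding compact_riemannian_manifold_def by unfold_locales auto
  have cm: "compact_space (mtop M)" "Hausdorff_space (mtop M)"
    using assms(1) unfolding compact_riemannian_manifold_def by auto
  have cF: "continuous_on {0..} F"
    using assms(7) DERIV_continuous_on[of "{0..}" F F'] by auto
  \<comment> \<open>The derivatives are given within the half-line; at interior points these are
    ordinary derivatives.\<close>
  have within: "at s within {0..} = at s" if "s > 0" for s :: real
    using that by (intro at_within_interior) (simp add: interior_real_atLeast)
  show ?thesis
  proof (rule harmonic_iff_integrable[OF assms(4,14,15)])
    fix c d y assume c: "c \<in> atlas M" and d: "d \<in> atlas N" and y: "y \<in> reg c d"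
    interpret L: conformal_map "reg c d" "gram M c" "cimg d" "gram N d" "local_rep c d u" "\<lambda>y. (lam (cinv c y))\<^sup>2"
      by (rule conformal_map[OF assms(14) c d])
    show "L.tension y = 0"
    proof (rule L.tension_zero[OF y])
      show "(F has_real_derivative F' s) (at s)" if "s > 0" for s
        using assms(7)[of s] within[OF that] that by simp
      show "(F' has_real_derivative F'' s) (at s)" if "s > 0" for s
        using assms(8)[of s] within[OF that] that by simp
      show "continuous_on {0<..} F''" by (rule continuous_on_subset[OF assms(9)]) auto
      show "F' s > 0" if "s > 0" for s using assms(11)[OF that] .
      show "fder (\<lambda>y. (lam (cinv c y))\<^sup>2) y (L.hv y a) = 0" if "y \<in> reg c d" for y a
        by (rule dilation_horizontal[OF assms(14,15) c d that])
      fix \<phi> w a b K \<epsilon>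
      assume v: "smooth_on UNIV \<phi>" "cbox a b \<subseteq> reg c d" "compact K" "K \<subseteq> box a b" "\<And>y. y \<notin> K \<Longrightarrow> \<phi> y = 0" "\<epsilon> > 0"
        "\<And>t y. \<bar>t\<bar> < \<epsilon> \<Longrightarrow> y \<in> cbox a b \<Longrightarrow> L.var_map \<phi> w t y \<in> cimg d \<and> L.var_energy \<phi> w t y > 0"
      interpret chart_variation M N u c d lam \<phi> w a b K \<epsilon>
        by unfold_locales (use cm assms(14) c d v in auto)
      show "((\<lambda>t. integral (cbox a b) (\<lambda>y. sqrt (det (gram M c y)) * (F (L.var_energy \<phi> w t y / 2) - F (L.var_energy \<phi> w 0 y / 2))))
          has_real_derivative 0) (at 0)"
        by (rule critical[OF assms(12) cF])
    qed
  qed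
qed

end
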